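(* Let $p$ be an odd prime and $q = 2^p$, and let $\mathrm{Sz}(q)$ be the Suzuki group over the field with $q$ elements. Then $|\mathrm{Solv}(\mathrm{Sz}(q))| = \frac{3q^4 + q^3 - q^2 + q}{2}$.
   Context: For a finite group $G$ and $x \in G$, the solvabilizer of $x$ in $G$ is $\mathrm{Sol}_G(x) = \{y \in G : \langle x, y \rangle \text{ is solvable}\}$. $\mathrm{Solv}(G) = \{\mathrm{Sol}_G(x) : x \in G\}$ is the set of distinct solvabilizers of elements of $G$, and $|\mathrm{Solv}(G)|$ is its cardinality. *)

theory Defs
  imports "Jordan_Normal_Form.Matrix" "HOL-Algebra.Solvable_Groups"
begin

definition GL4 :: "('a::field) mat monoid" where
  "GL4 = \<lparr> carrier = {A \<in> carrier_mat 4 4. invertible_mat A}, mult = (*), one = 1\<^sub>m 4 \<rparr>"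

text \<open>Suzuki field automorphism theta: x \<mapsto> x^(2^(m+1)) where |F| = 2^(2m+1) = 2^p,
  i.e. exponent 2^((p+1) div 2).\<close>
definition sz_theta :: "nat \<Rightarrow> 'a::field \<Rightarrow> 'a" where
  "sz_theta p x = x ^ (2 ^ ((p + 1) div 2))"

text \<open>Generators of Sz(q) (Wilson, The Finite Simple Groups, Sect. 4.2).\<close>
definition sz_T :: "nat \<Rightarrow> 'a::field \<Rightarrow> 'a \<Rightarrow> 'a mat" where
  "sz_T p a b = mat_of_rows_list 4
     [[1, 0, 0, 0],
      [a, 1, 0, 0],
      [b, sz_theta p a, 1, 0],
      [a^2 * sz_theta p a + a * b + sz_theta p b, a * sz_theta p a + b, a, 1]]"

definition sz_M :: "nat \<Rightarrow> 'a::field \<Rightarrow> 'a mat" where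
  "sz_M p l = (let e = 2 ^ ((p - 1) div 2) in mat_of_rows_list 4
     [[l ^ (1 + e), 0, 0, 0],
      [0, l ^ e, 0, 0],
      [0, 0, inverse l ^ e, 0],
      [0, 0, 0, inverse l ^ (1 + e)]])"

definition sz_W :: "'a::field mat" where
  "sz_W = mat_of_rows_list 4 [[0,0,0,1],[0,0,1,0],[0,1,0,0],[1,0,0,0]]"

definition Sz_gens :: "nat \<Rightarrow> ('a::field) mat set" where
  "Sz_gens p = {sz_T p a b | a b. True} \<union> {sz_M p l | l. l \<noteq> 0} \<union> {sz_W}"

text \<open>The Suzuki group Sz(q), q = 2^p = |F|, as a subgroup of GL(4,F).\<close>
definition Sz :: "nat \<Rightarrow> ('a::{field,finite}) mat monoid" where
  "Sz p = GL4 \<lparr> carrier := generate GL4 (Sz_gens p) \<rparr>"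

definition Sol :: "('g, 'b) monoid_scheme \<Rightarrow> 'g \<Rightarrow> 'g set" where
  "Sol G x = {y \<in> carrier G. solvable (G \<lparr> carrier := generate G {x, y} \<rparr>)}"

definition Solv :: "('g, 'b) monoid_scheme \<Rightarrow> 'g set set" where
  "Solv G = Sol G ` carrier G"

end

theory Submission
  imports Defs "HOL-Algebra.Multiplicative_Group" "HOL-Computational_Algebra.Polynomial" "HOL-Library.Product_Plus"
begin

text \<open>
  Sz(q) acts two-transitively on the \<open>q\<^sup>2 + 1\<close> points of the Tits ovoid, and a nontrivial element fixes
  none, one or two points. The last nontrivial term of the derived series of a solvable subgroup is
  abelian, and looking at the fixed points of one of its elements shows that every nontrivial solvable
  subgroup lies in a point stabilizer, in the stabilizer of a pair of points, or in the normalizer of a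
  torus, i.e. of the centralizer of a fixed-point-free element; all of these are solvable. Hence the
  solvabilizer of an element with two fixed points is determined by that pair, and the solvabilizer of a
  fixed-point-free element is the normalizer of its torus. By symmetry of the relation this controls the
  solvabilizers of the elements with one fixed point too: they coincide only for an element and its
  inverse. It remains to count the tori, which is possible without knowing their orders: a counting
  argument shows that they form exactly two conjugacy classes, each of index 4 in the normalizer.
\<close>

section \<open>Conjugation and solvable subgroups\<close>

text \<open>Two facts about an element x of order dividing q^2 + 1 take the place of a list of
  subgroups: its centralizer is commutative and contains at most four conjugates of x.
  Fixed-point-free elements qualify because their centralizers act semiregularly on the q^2 + 1
  points. The bound four comes from the powers x^(q^i) with i < 4; the field with q^4 elements is
  not constructed, annihilators of vectors in a polynomial ring stand in for it.

  Elements of order four are reached indirectly. They are conjugate up to inversion, so one of them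
  normalizing a torus suffices, and index 4 forces one to exist, since involutions normalizing a
  torus invert it. Given such an x, another y in the same unipotent group and torus normalizer would
  make 1, x, x^2, x^-1, y lie in five cosets of the torus, where only four exist.

  The final count adds 1 for the identity, (q^4 - q^2)/2 tori, q^2 (q^2 + 1)/2 pairs of points, (q -
  1)(q^2 + 1) involutions and (q^2 - q)(q^2 + 1)/2 inverse pairs of elements of order four.\<close>

lemma card_eq_fibres:
  assumes "finite A" "\<And>y. y \<in> f ` A \<Longrightarrow> card {x \<in> A. f x = y} = k"
  shows "card A = k * card (f ` A)"
proof -
  have "card A = (\<Sum>y\<in>f ` A. card {x \<in> A. f x = y})"
    using sum.image_gen[OF assms(1), of "\<lambda>_. 1::nat" f] by simp
  then show ?thesis using assms(2) by simp
qed

definition fixpts :: "('g \<Rightarrow> 'p \<Rightarrow> 'p) \<Rightarrow> 'g \<Rightarrow> 'p set" where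
  "fixpts act x = {P. act x P = P}"

context group
begin

definition cj :: "'a \<Rightarrow> 'a \<Rightarrow> 'a" where
  "cj g x = g \<otimes> x \<otimes> inv g"

lemma cj_closed [simp]: "g \<in> carrier G \<Longrightarrow> x \<in> carrier G \<Longrightarrow> cj g x \<in> carrier G"
  by (simp add: cj_def)

lemma cj_one [simp]: "x \<in> carrier G \<Longrightarrow> cj \<one> x = x"
  by (simp add: cj_def)

lemma cj_of_one [simp]: "g \<in> carrier G \<Longrightarrow> cj g \<one> = \<one>"
  by (simp add: cj_def)

lemma cj_comp: "g \<in> carrier G \<Longrightarrow> h \<in> carrier G \<Longrightarrow> x \<in> carrier G \<Longrightarrow> cj g (cj h x) = cj (g \<otimes> h) x"
  by (simp add: cj_def inv_mult_group m_assoc)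

lemma cj_mult: "g \<in> carrier G \<Longrightarrow> x \<in> carrier G \<Longrightarrow> y \<in> carrier G \<Longrightarrow> cj g (x \<otimes> y) = cj g x \<otimes> cj g y"
  by (simp add: cj_def m_assoc) (simp add: inv_solve_left flip: m_assoc)

lemma cj_inv_cancel [simp]: "g \<in> carrier G \<Longrightarrow> x \<in> carrier G \<Longrightarrow> cj (inv g) (cj g x) = x"
  by (simp add: cj_comp)

lemma cj_cancel_inv [simp]: "g \<in> carrier G \<Longrightarrow> x \<in> carrier G \<Longrightarrow> cj g (cj (inv g) x) = x"
  by (simp add: cj_comp)

lemma cj_inj: "g \<in> carrier G \<Longrightarrow> x \<in> carrier G \<Longrightarrow> y \<in> carrier G \<Longrightarrow> cj g x = cj g y \<longleftrightarrow> x = y"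
  by (metis cj_inv_cancel)

lemma cj_eq_one: "g \<in> carrier G \<Longrightarrow> x \<in> carrier G \<Longrightarrow> cj g x = \<one> \<longleftrightarrow> x = \<one>"
  by (metis cj_inv_cancel cj_of_one inv_closed)

lemma cj_inv: "g \<in> carrier G \<Longrightarrow> x \<in> carrier G \<Longrightarrow> cj g (inv x) = inv (cj g x)"
  by (simp add: cj_def inv_mult_group m_assoc)

lemma cj_eq_self: "g \<in> carrier G \<Longrightarrow> x \<in> carrier G \<Longrightarrow> cj g x = x \<longleftrightarrow> g \<otimes> x = x \<otimes> g"
  by (metis cj_def inv_solve_right m_closed)

lemma cj_hom: "g \<in> carrier G \<Longrightarrow> group_hom G G (cj g)"
  by unfold_locales (auto simp: hom_def cj_mult)

lemma subgroup_pow_card: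
  assumes "subgroup H G" "x \<in> H" shows "x [^] card H = \<one>"
proof -
  interpret H: group "G\<lparr>carrier := H\<rparr>" using assms by (simp add: subgroup_imp_group)
  have "x [^]\<^bsub>G\<lparr>carrier := H\<rparr>\<^esub> Coset.order (G\<lparr>carrier := H\<rparr>) = \<one>"
    using H.pow_order_eq_1[of x] assms by simp
  then show ?thesis by (simp add: Coset.order_def nat_pow_def)
qed

lemma pow_coprime_eq_one:
  assumes "x \<in> carrier G" "x [^] (m::nat) = \<one>" "x [^] (n::nat) = \<one>" "coprime m n"
  shows "x = \<one>"
proof -
  have "ord x dvd 1" using assms pow_eq_id by (metis coprime_common_divisor_nat coprime_def nat_dvd_1_iff_1)
  then show ?thesis using assms(1) pow_eq_id[of x 1] by simp
qed

lemma derived_one_imp_comm: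
  assumes "A \<subseteq> carrier G" "derived G A = {\<one>}" "a \<in> A" "b \<in> A"
  shows "a \<otimes> b = b \<otimes> a"
proof -
  have "a \<otimes> b \<otimes> inv a \<otimes> inv b \<in> derived G A"
    unfolding derived_def using assms(3,4) by (intro generate.incl) auto
  then have "a \<otimes> b \<otimes> inv a \<otimes> inv b = \<one>" using assms(2) by simp
  moreover have "a \<in> carrier G" "b \<in> carrier G" using assms by auto
  ultimately show ?thesis by (metis inv_closed inv_equality inv_inv inv_mult_group m_assoc m_closed)
qed

text \<open>The witness is the last nontrivial term of the derived series. It is abelian because its
  derived subgroup is trivial, and it is normal because conjugation by \<open>h\<close> maps
  \<open>H\<close> onto itself and commutes with forming derived subgroups.\<close>

lemma solvable_seq_abelian_normal:
  assumes H: "subgroup H G" and "solvable_seq G H" "H \<noteq> {\<one>}"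
  shows "\<exists>A\<subseteq>H. (\<exists>a\<in>A. a \<noteq> \<one>) \<and> (\<forall>a\<in>A. \<forall>b\<in>A. a \<otimes> b = b \<otimes> a) \<and> (\<forall>h\<in>H. \<forall>a\<in>A. cj h a \<in> A)"
proof -
  let ?D = "\<lambda>n. (derived G ^^ n) H"
  define n where "n = (LEAST n. ?D n = {\<one>})"
  have n: "?D n = {\<one>}"
    unfolding n_def using solvable_imp_trivial_derived_seq[OF assms(2)] by (rule LeastI_ex)
  have "n \<noteq> 0" using n assms(3) by (intro notI) simp
  then obtain k where k: "n = Suc k" by (cases n) auto
  have nk: "?D k \<noteq> {\<one>}" using not_less_Least[of k "\<lambda>n. ?D n = {\<one>}"] k by (simp add: n_def)
  have sub: "subgroup (?D k) G" by (rule exp_of_derived_is_subgroup[OF H])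
  have DH: "?D j \<subseteq> H" for j
    by (induct j) (use derived_incl[OF _ H] in auto)
  show ?thesis
  proof (intro exI[of _ "?D k"] conjI ballI)
    show "?D k \<subseteq> H" by (rule DH)
    show "\<exists>a\<in>?D k. a \<noteq> \<one>" using nk subgroup.one_closed[OF sub] by blast
    show "a \<otimes> b = b \<otimes> a" if "a \<in> ?D k" "b \<in> ?D k" for a b
      using derived_one_imp_comm[OF subgroup.subset[OF sub] _ that] n k by simp
    show "cj h a \<in> ?D k" if h: "h \<in> H" and a: "a \<in> ?D k" for h a
    proof -
      have hG: "h \<in> carrier G" using h subgroup.subset[OF H] by auto
      interpret c: group_hom G G "cj h" by (rule cj_hom[OF hG])
      have "cj h ` H = H"
      proof
        have i: "cj g ` H \<subseteq> H" if "g \<in> H" for g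
          using that H unfolding cj_def by (auto intro!: subgroup.m_closed subgroup.m_inv_closed)
        show "cj h ` H \<subseteq> H" by (rule i[OF h])
        show "H \<subseteq> cj h ` H"
        proof
          fix x assume x: "x \<in> H"
          have "cj (inv h) x \<in> H" using i[of "inv h"] h x H by (auto simp: subgroup.m_inv_closed)
          moreover have "x = cj h (cj (inv h) x)" using x hG subgroup.subset[OF H] by auto
          ultimately show "x \<in> cj h ` H" by blast
        qed
      qed
      then have "?D k = cj h ` ?D k"
        using c.exp_of_derived_img[OF subgroup.subset[OF H], of k] by simp
      then show ?thesis using a by blast
    qed
  qed
qed

lemma derived_le:
  assumes "subgroup K G" "\<And>a b. a \<in> H \<Longrightarrow> b \<in> H \<Longrightarrow> a \<otimes> b \<otimes> inv a \<otimes> inv b \<in> K"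
  shows "derived G H \<subseteq> K"
  unfolding derived_def by (rule generate_subgroup_incl[OF _ assms(1)]) (use assms(2) in auto)

text \<open>The derived subgroup of \<open>H\<close> lies in \<open>K\<close>, so the derived series
  of \<open>H\<close> ends at most one step later than that of \<open>K\<close>. In this form
  solvability of stabilizers reduces to computing commutators.\<close>

lemma solvable_seq_step:
  assumes "subgroup H G" "solvable_seq G K"
    "\<And>a b. a \<in> H \<Longrightarrow> b \<in> H \<Longrightarrow> a \<otimes> b \<otimes> inv a \<otimes> inv b \<in> K"
  shows "solvable_seq G H"
proof -
  have K: "subgroup K G" by (rule solvable_imp_subgroup[OF assms(2)])
  obtain n where n: "(derived G ^^ n) K = {\<one>}" using solvable_imp_trivial_derived_seq[OF assms(2)] by auto
  have "(derived G ^^ n) (derived G H) \<subseteq> {\<one>}"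
    using mono_exp_of_derived[OF derived_le[OF K assms(3)], where n = n] n by simp
  moreover have "\<one> \<in> (derived G ^^ n) (derived G H)"
    by (intro subgroup.one_closed exp_of_derived_is_subgroup derived_is_subgroup subgroup.subset[OF assms(1)])
  ultimately have "(derived G ^^ Suc n) H = {\<one>}" by (auto simp: funpow_swap1)
  then show ?thesis by (rule trivial_derived_seq_imp_solvable[OF assms(1)])
qed

lemma solvable_seq_comm:
  assumes "subgroup H G" "\<And>a b. a \<in> H \<Longrightarrow> b \<in> H \<Longrightarrow> a \<otimes> b = b \<otimes> a"
  shows "solvable_seq G H"
proof (rule solvable_seq_step[OF assms(1) solvable_seq.unity])
  fix a b assume ab: "a \<in> H" "b \<in> H"
  then have "a \<in> carrier G" "b \<in> carrier G" using subgroup.subset[OF assms(1)] by auto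
  then show "a \<otimes> b \<otimes> inv a \<otimes> inv b \<in> {\<one>}"
    using assms(2)[OF ab] by (simp add: m_assoc)
qed

lemma solvable_seq_mono:
  assumes "solvable_seq G H" "subgroup K G" "K \<subseteq> H" shows "solvable_seq G K"
proof -
  obtain n where n: "(derived G ^^ n) H = {\<one>}" using solvable_imp_trivial_derived_seq[OF assms(1)] by auto
  have "(derived G ^^ n) K = {\<one>}"
    using mono_exp_of_derived[OF assms(3), where n = n] n
      subgroup.one_closed[OF exp_of_derived_is_subgroup[OF assms(2), of n]] by auto
  then show ?thesis by (rule trivial_derived_seq_imp_solvable[OF assms(2)])
qed

text \<open>Derived subgroups of a subgroup are the same computed inside it or in \<open>G\<close>.
  This links the definition of \<open>Sol\<close>, which restricts the carrier, to
  \<open>solvable_seq G\<close>, where subgroups can be compared.\<close>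

lemma solvable_carrier_iff:
  assumes "subgroup H G" shows "solvable (G\<lparr>carrier := H\<rparr>) \<longleftrightarrow> solvable_seq G H"
proof -
  interpret K: group "G\<lparr>carrier := H\<rparr>" by (rule subgroup_imp_group[OF assms])
  have DH: "(derived G ^^ j) H \<subseteq> H" for j
    by (induct j) (use derived_incl[OF _ assms] in auto)
  have "(derived (G\<lparr>carrier := H\<rparr>) ^^ n) H = (derived G ^^ n) H" for n
    by (induct n) (simp_all add: derived_consistent[OF DH assms])
  then show ?thesis
    using K.solvable_iff_trivial_derived_seq solvable_imp_trivial_derived_seq[of H]
      trivial_derived_seq_imp_solvable[OF assms] by auto
qed

end

section \<open>Two-transitive actions of Suzuki type\<close>

text \<open>For Sz(q) this is the Sylow 2-subgroup fixing \<open>P\<close>. Describing it by fixed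
  points makes it compatible with conjugation at once; closure under products then has to be
  established separately.\<close>

definition uni :: "('g, 'b) monoid_scheme \<Rightarrow> ('g \<Rightarrow> 'p \<Rightarrow> 'p) \<Rightarrow> 'p \<Rightarrow> 'g set" where
  "uni G act P = {x \<in> carrier G. x = \<one>\<^bsub>G\<^esub> \<or> fixpts act x = {P}}"

text \<open>For Sz(q) and distinct points this is a copy of the multiplicative group of the
  field.\<close>

definition stab2 :: "('g, 'b) monoid_scheme \<Rightarrow> ('g \<Rightarrow> 'p \<Rightarrow> 'p) \<Rightarrow> 'p \<Rightarrow> 'p \<Rightarrow> 'g set" where
  "stab2 G act P Q = {x \<in> carrier G. act x P = P \<and> act x Q = Q}"

definition cent :: "('g, 'b) monoid_scheme \<Rightarrow> 'g \<Rightarrow> 'g set" where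
  "cent G x = {y \<in> carrier G. x \<otimes>\<^bsub>G\<^esub> y = y \<otimes>\<^bsub>G\<^esub> x}"

locale point_action = group G for G (structure) +
  fixes act :: "'a \<Rightarrow> 'p \<Rightarrow> 'p"
  assumes act_mult: "x \<in> carrier G \<Longrightarrow> y \<in> carrier G \<Longrightarrow> act (x \<otimes> y) P = act x (act y P)"
    and act_one: "act \<one> P = P"
begin

abbreviation "F \<equiv> fixpts act"
abbreviation "U \<equiv> uni G act"
abbreviation "T2 \<equiv> stab2 G act"
abbreviation "C \<equiv> cent G"

lemma F_iff: "P \<in> F x \<longleftrightarrow> act x P = P"
  by (simp add: fixpts_def)

lemma F_one [simp]: "F \<one> = UNIV"
  by (simp add: fixpts_def act_one)

lemma act_inv [simp]: "x \<in> carrier G \<Longrightarrow> act (inv x) (act x P) = P"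
  using act_mult[of "inv x" x P] by (simp add: act_one)

lemma act_inv' [simp]: "x \<in> carrier G \<Longrightarrow> act x (act (inv x) P) = P"
  using act_mult[of x "inv x" P] by (simp add: act_one)

lemma act_inj: "x \<in> carrier G \<Longrightarrow> act x P = act x Q \<longleftrightarrow> P = Q"
  using act_inv[of x P] act_inv[of x Q] by metis

lemma act_inv_fix: "x \<in> carrier G \<Longrightarrow> act x P = Q \<Longrightarrow> act (inv x) Q = P"
  by auto

lemma F_inv: "x \<in> carrier G \<Longrightarrow> F (inv x) = F x"
proof -
  assume x: "x \<in> carrier G"
  have "act (inv x) P = P \<longleftrightarrow> act x P = P" for P
    using act_inj[OF x, of "act (inv x) P" P] x by auto
  then show ?thesis by (simp add: fixpts_def)
qed

lemma F_conj:
  assumes "g \<in> carrier G" "x \<in> carrier G"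
  shows "F (cj g x) = act g ` F x"
proof -
  have *: "act g ` F y \<subseteq> F (cj g y)" if "g \<in> carrier G" "y \<in> carrier G" for g y
  proof (rule image_subsetI)
    fix P assume "P \<in> F y"
    then have "act y P = P" by (simp only: F_iff)
    then show "act g P \<in> F (cj g y)" using that by (simp add: F_iff cj_def act_mult)
  qed
  have "F (cj g x) \<subseteq> act g ` F x"
  proof
    fix P assume "P \<in> F (cj g x)"
    then have "act (inv g) P \<in> F (cj (inv g) (cj g x))" using *[of "inv g" "cj g x"] assms by auto
    then have "act (inv g) P \<in> F x" using assms by (simp only: cj_inv_cancel)
    moreover have "P = act g (act (inv g) P)" using assms by simp
    ultimately show "P \<in> act g ` F x" by (rule rev_image_eqI)
  qed
  then show ?thesis using *[OF assms] by (rule antisym)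
qed

end

text \<open>The last two assumptions hold for Sz(q) because an element of order dividing \<open>q\<^sup>2 + 1\<close> acts
  irreducibly on the natural module, so that its centralizer lies in a field with \<open>q ^ 4\<close> elements
  and its conjugates there are roots of one quartic polynomial.\<close>

locale suzuki_action = point_action G act for G (structure) and act :: "'a \<Rightarrow> 'p::finite \<Rightarrow> 'p" +
  fixes q :: nat
  assumes fin: "finite (carrier G)"
    and q_even: "even q" and q_ge: "8 \<le> q" and q_mod3: "q mod 3 = 2"
    and card_points: "card (UNIV :: 'p set) = q\<^sup>2 + 1"
    and trans2: "P \<noteq> Q \<Longrightarrow> P' \<noteq> Q' \<Longrightarrow> \<exists>g\<in>carrier G. act g P = P' \<and> act g Q = Q'"
    and fix3: "x \<in> carrier G \<Longrightarrow> x \<noteq> \<one> \<Longrightarrow> card (fixpts act x) \<le> 2"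
    and swap: "x \<in> carrier G \<Longrightarrow> P \<noteq> Q \<Longrightarrow> act x P = Q \<Longrightarrow> act x Q = P \<Longrightarrow>
                 x \<otimes> x = \<one> \<and> card (fixpts act x) = 1"
    and stab2_card: "P \<noteq> Q \<Longrightarrow> card (stab2 G act P Q) = q - 1"
    and stab2_comm: "P \<noteq> Q \<Longrightarrow> x \<in> stab2 G act P Q \<Longrightarrow> y \<in> stab2 G act P Q \<Longrightarrow> x \<otimes> y = y \<otimes> x"
    and uni_mult: "x \<in> uni G act P \<Longrightarrow> y \<in> uni G act P \<Longrightarrow> x \<otimes> y \<in> uni G act P"
    and uni_card: "card (uni G act P) = q\<^sup>2"
    and uni_invol: "card {x \<in> uni G act P. x \<otimes> x = \<one>} = q"
    and uni_pow4: "x \<in> uni G act P \<Longrightarrow> (x \<otimes> x) \<otimes> (x \<otimes> x) = \<one>"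
    and borel_comm: "x \<in> carrier G \<Longrightarrow> y \<in> carrier G \<Longrightarrow> act x P = P \<Longrightarrow> act y P = P \<Longrightarrow>
                 x \<otimes> y \<otimes> inv x \<otimes> inv y \<in> uni G act P"
    and uni_comm: "x \<in> uni G act P \<Longrightarrow> y \<in> uni G act P \<Longrightarrow> z = x \<otimes> y \<otimes> inv x \<otimes> inv y \<Longrightarrow>
                 z \<otimes> z = \<one>"
    and invol_comm: "x \<in> uni G act P \<Longrightarrow> y \<in> uni G act P \<Longrightarrow> x \<otimes> x = \<one> \<Longrightarrow> y \<otimes> y = \<one> \<Longrightarrow>
                 x \<otimes> y = y \<otimes> x"
    and uni_conj: "x \<in> uni G act P \<Longrightarrow> y \<in> uni G act P \<Longrightarrow> x \<otimes> x \<noteq> \<one> \<Longrightarrow> y \<otimes> y \<noteq> \<one> \<Longrightarrow>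
                 \<exists>g\<in>carrier G. g \<otimes> x \<otimes> inv g = y \<or> g \<otimes> x \<otimes> inv g = inv y"
    and lin_comm: "x \<in> carrier G \<Longrightarrow> x \<noteq> \<one> \<Longrightarrow> x [^] (q\<^sup>2 + 1) = \<one> \<Longrightarrow>
                 y \<in> cent G x \<Longrightarrow> z \<in> cent G x \<Longrightarrow> y \<otimes> z = z \<otimes> y"
    and lin_conj: "x \<in> carrier G \<Longrightarrow> x \<noteq> \<one> \<Longrightarrow> x [^] (q\<^sup>2 + 1) = \<one> \<Longrightarrow>
                 card ({g \<otimes> x \<otimes> inv g | g. g \<in> carrier G} \<inter> cent G x) \<le> 4"
begin

section \<open>Stabilizers and centralizers of fixed-point-free elements\<close>

definition fpf :: "'a set" where "fpf = {x \<in> carrier G. F x = {}}"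
text \<open>For fixed-point-free \<open>x\<close> this is the normalizer of the torus
  \<open>C x\<close>. Testing the single element \<open>x\<close> is enough because distinct tori
  meet trivially, and it fits the count of conjugates of \<open>x\<close> inside
  \<open>C x\<close>.\<close>

definition nrm :: "'a \<Rightarrow> 'a set" where "nrm x = {g \<in> carrier G. cj g x \<in> C x}"
definition pstab :: "'p \<Rightarrow> 'a set" where "pstab P = {x \<in> carrier G. act x P = P}"
definition sstab :: "'p \<Rightarrow> 'p \<Rightarrow> 'a set" where
  "sstab P Q = {x \<in> carrier G. act x ` {P, Q} = {P, Q}}"

text \<open>A crude bound suffices: it separates the identity, which fixes everything, from elements
  with at most two fixed points, and leaves points to choose outside a few given ones.\<close>

lemma card_points_big: "card (UNIV :: 'p set) > 64"
proof -
  have "8 * 8 \<le> q * q" using q_ge by (intro mult_mono) auto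
  then show ?thesis using card_points unfolding power2_eq_square by linarith
qed

lemma F_cases:
  assumes "x \<in> carrier G" "x \<noteq> \<one>"
  obtains "F x = {}" | P where "F x = {P}" | P Q where "P \<noteq> Q" "F x = {P, Q}"
proof -
  have *: "n = 0 \<or> n = 1 \<or> n = 2" if "n \<le> 2" for n :: nat using that by arith
  from *[OF fix3[OF assms]] show thesis
  proof (elim disjE)
    assume "card (F x) = 0" then show ?thesis using that(1) by simp
  next
    assume "card (F x) = 1" then show ?thesis using that(2) by (meson card_1_singletonE)
  next
    assume "card (F x) = 2"
    then obtain P Q where "F x = {P, Q}" "P \<noteq> Q" by (meson card_2_iff)
    then show ?thesis using that(3) by simp
  qed
qed

lemma F_big: "card (F x) \<le> 64 \<Longrightarrow> x \<noteq> \<one>"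
  using card_points_big by auto

lemma not_one: "x \<in> fpf \<Longrightarrow> x \<noteq> \<one>" "F x = {P} \<Longrightarrow> x \<noteq> \<one>" "F x = {P, Q} \<Longrightarrow> x \<noteq> \<one>"
proof -
  show "x \<in> fpf \<Longrightarrow> x \<noteq> \<one>" unfolding fpf_def by (intro F_big) simp
  show "F x = {P} \<Longrightarrow> x \<noteq> \<one>" by (rule F_big) simp
  show "F x = {P, Q} \<Longrightarrow> x \<noteq> \<one>" by (rule F_big, cases "P = Q") simp_all
qed

lemma F_mult: "x \<in> carrier G \<Longrightarrow> y \<in> carrier G \<Longrightarrow> F x \<inter> F y \<subseteq> F (x \<otimes> y)"
  by (auto simp: F_iff act_mult)

lemma pstab_subgroup: "subgroup (pstab P) G"
  by unfold_locales (auto simp: pstab_def act_mult act_one act_inv_fix)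

lemma T2_subgroup: "subgroup (T2 P Q) G"
  by unfold_locales (auto simp: stab2_def act_mult act_one act_inv_fix)

lemma sstab_subgroup: "subgroup (sstab P Q) G"
proof
  show "x \<otimes> y \<in> sstab P Q" if "x \<in> sstab P Q" "y \<in> sstab P Q" for x y
    using that by (auto simp: sstab_def act_mult doubleton_eq_iff)
  show "inv x \<in> sstab P Q" if "x \<in> sstab P Q" for x
    using that by (auto simp: sstab_def doubleton_eq_iff act_inv_fix)
qed (auto simp: sstab_def act_one)

lemma U_subgroup: "subgroup (U P) G"
proof
  show "x \<otimes> y \<in> U P" if "x \<in> U P" "y \<in> U P" for x y by (rule uni_mult[OF that])
qed (auto simp: uni_def F_inv)

lemma T2_pow: "x \<in> T2 P Q \<Longrightarrow> P \<noteq> Q \<Longrightarrow> x [^] (q - 1) = \<one>"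
  using subgroup_pow_card[OF T2_subgroup] stab2_card by metis

lemma C_in: "y \<in> C x \<Longrightarrow> y \<in> carrier G" "fpf \<subseteq> carrier G"
  by (auto simp: cent_def fpf_def)

lemma one_cent: "x \<in> carrier G \<Longrightarrow> \<one> \<in> C x"
  by (simp add: cent_def)

lemma C_inv:
  assumes x: "x \<in> carrier G" and y: "y \<in> C x" shows "inv y \<in> C x"
proof -
  have yG: "y \<in> carrier G" by (rule C_in(1)[OF y])
  have "cj y x = x" using y x yG cj_eq_self[of y x] by (simp add: cent_def)
  then have "cj (inv y) x = x" using cj_inv_cancel[OF yG x] by simp
  then show ?thesis using cj_eq_self[of "inv y" x] x yG by (simp add: cent_def)
qed

lemma C_mult:
  assumes x: "x \<in> carrier G" and y: "y \<in> C x" and z: "z \<in> C x" shows "y \<otimes> z \<in> C x"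
proof -
  have yG: "y \<in> carrier G" and zG: "z \<in> carrier G" by (rule C_in(1)[OF y], rule C_in(1)[OF z])
  have "cj y x = x" "cj z x = x"
    using y z x yG zG cj_eq_self[of y x] cj_eq_self[of z x] by (simp_all add: cent_def)
  then have "cj (y \<otimes> z) x = x" using cj_comp[OF yG zG x] by simp
  then show ?thesis using cj_eq_self[of "y \<otimes> z" x] x yG zG by (simp add: cent_def)
qed

lemma C_subgroup: "x \<in> carrier G \<Longrightarrow> subgroup (C x) G"
  by unfold_locales (use C_inv C_mult C_in in \<open>simp_all add: one_cent subset_iff\<close>)

lemma fpfD: "x \<in> fpf \<Longrightarrow> x \<in> carrier G" "x \<in> fpf \<Longrightarrow> F x = {}"
  by (auto simp: fpf_def)

lemma C_image_F: "y \<in> C x \<Longrightarrow> x \<in> carrier G \<Longrightarrow> act y ` F x = F x"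
  using F_conj[of y x] cj_eq_self[of y x] by (simp add: cent_def)

text \<open>Since \<open>x\<close> commutes with \<open>y\<close>, it permutes the fixed points of
  \<open>y\<close>. A single one would be fixed by \<open>x\<close>; two would be interchanged, and
  then \<open>swap\<close> gives \<open>x\<close> a fixed point.\<close>

lemma C_fpf:
  assumes "x \<in> fpf" "y \<in> C x" "y \<noteq> \<one>" shows "y \<in> fpf"
proof -
  have y: "y \<in> carrier G" and x: "x \<in> carrier G" and xy: "x \<in> C y" using assms by (auto simp: fpf_def cent_def)
  have im: "act x ` F y = F y" by (rule C_image_F[OF xy y])
  show ?thesis
  proof (cases rule: F_cases[OF y assms(3)])
    case 1 then show ?thesis using y by (simp add: fpf_def)
  next
    case (2 P) then show ?thesis using im fpfD(2)[OF assms(1)] by (auto simp: F_iff fixpts_def)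
  next
    case (3 P Q)
    then have "act x P = Q \<and> act x Q = P" using im fpfD(2)[OF assms(1)] by (auto simp: F_iff fixpts_def doubleton_eq_iff)
    then have "card (F x) = 1" using swap[OF x 3(1)] by blast
    then show ?thesis using fpfD(2)[OF assms(1)] by simp
  qed
qed

text \<open>Nontrivial elements of \<open>C x\<close> fix no point, so \<open>C x\<close> acts
  semiregularly: its orbits all have as many points as \<open>C x\<close> has elements, and they
  partition the q^2 + 1 points.\<close>

lemma card_C_dvd:
  assumes "x \<in> fpf" shows "card (C x) dvd q\<^sup>2 + 1"
proof -
  interpret C: subgroup "C x" G using C_subgroup fpfD assms by auto
  define orb where "orb P = (\<lambda>g. act g P) ` C x" for P
  have inj: "inj_on (\<lambda>g. act g P) (C x)" for P
  proof (rule inj_onI)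
    fix g h assume gh: "g \<in> C x" "h \<in> C x" "act g P = act h P"
    then have "act (inv h \<otimes> g) P = P" by (simp add: act_mult)
    then have "F (inv h \<otimes> g) \<noteq> {}" using F_iff by blast
    moreover have "inv h \<otimes> g \<in> C x" using gh by simp
    ultimately have "inv h \<otimes> g = \<one>" using C_fpf[OF assms, of "inv h \<otimes> g"] fpfD(2) by blast
    then have "h \<otimes> (inv h \<otimes> g) = h" using gh by simp
    then show "g = h" using gh by (simp flip: m_assoc)
  qed
  have self: "P \<in> orb P" for P unfolding orb_def by (rule image_eqI[where x = \<one>]) (simp_all add: act_one)
  have sub: "orb (act g P) \<subseteq> orb P" if "g \<in> C x" for g P
  proof
    fix Q assume "Q \<in> orb (act g P)"
    then obtain h where h: "h \<in> C x" "Q = act h (act g P)" unfolding orb_def by auto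
    then have "Q = act (h \<otimes> g) P" using that by (simp add: act_mult)
    then show "Q \<in> orb P" using h that unfolding orb_def by blast
  qed
  have eq: "orb (act g P) = orb P" if "g \<in> C x" for g P
  proof
    show "orb P \<subseteq> orb (act g P)" using sub[of "inv g" "act g P"] that by (simp add: C.m_inv_closed)
  qed (rule sub[OF that])
  have "card (C x) * card (range orb) = card (\<Union> (range orb))"
  proof (rule card_partition)
    show "card c = card (C x)" if "c \<in> range orb" for c
      using that inj by (auto simp: orb_def card_image)
    show "c1 \<inter> c2 = {}" if c: "c1 \<in> range orb" "c2 \<in> range orb" "c1 \<noteq> c2" for c1 c2
    proof -
      obtain P Q where PQ: "c1 = orb P" "c2 = orb Q" using c by auto
      show ?thesis
      proof (rule ccontr)
        assume "c1 \<inter> c2 \<noteq> {}"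
        then obtain g h where "g \<in> C x" "h \<in> C x" "act g P = act h Q" unfolding PQ orb_def by auto
        then have "orb P = orb Q" using eq[of g P] eq[of h Q] by simp
        then show False using c PQ by simp
      qed
    qed
  qed auto
  moreover have "\<Union> (range orb) = UNIV" using self by auto
  ultimately have "q\<^sup>2 + 1 = card (C x) * card (range orb)" using card_points by simp
  then show ?thesis by (rule dvdI)
qed

text \<open>Turns the orbit count into the hypothesis of \<open>lin_comm\<close> and
  \<open>lin_conj\<close>, which speak of powers rather than of fixed points.\<close>

lemma C_pow: "x \<in> fpf \<Longrightarrow> y \<in> C x \<Longrightarrow> y [^] (q\<^sup>2 + 1) = \<one>"
proof -
  assume x: "x \<in> fpf" and y: "y \<in> C x"
  obtain k where k: "q\<^sup>2 + 1 = card (C x) * k" using card_C_dvd[OF x] by blast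
  have "y [^] card (C x) = \<one>" by (rule subgroup_pow_card[OF C_subgroup[OF fpfD(1)[OF x]] y])
  then show ?thesis unfolding k using C_in(1)[OF y] by (simp flip: nat_pow_pow)
qed

lemma self_C: "x \<in> carrier G \<Longrightarrow> x \<in> C x"
  by (simp add: cent_def)

lemma fpf_pow: "x \<in> fpf \<Longrightarrow> x [^] (q\<^sup>2 + 1) = \<one>"
  using C_pow self_C fpfD by blast

lemma C_comm: "x \<in> fpf \<Longrightarrow> y \<in> C x \<Longrightarrow> z \<in> C x \<Longrightarrow> y \<otimes> z = z \<otimes> y"
  using lin_comm[OF fpfD(1) not_one(1) fpf_pow] by blast

text \<open>Commutativity of centralizers makes commuting a transitive relation on fixed-point-free
  elements, so two tori are equal or meet only in the identity.\<close>

lemma C_eq: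
  assumes "x \<in> fpf" "y \<in> C x" "y \<noteq> \<one>" shows "C y = C x"
proof -
  have *: "C u \<subseteq> C v" if "u \<in> fpf" "v \<in> C u" for u v

  proof
    fix z assume "z \<in> C u"
    then show "z \<in> C v" using C_comm[OF that(1,2), of z] by (simp add: cent_def)
  qed
  have "x \<in> C y" using assms by (auto simp: cent_def fpf_def)
  then show ?thesis using *[OF assms(1,2)] *[OF C_fpf[OF assms], of x] by auto
qed

text \<open>The number 12 is the least common multiple of 1, 2, 3, 4, the possible orders of an
  element modulo a torus in its normalizer. Coprimality to 3 rests on q being 2 modulo 3.\<close>

lemma q_arith: "coprime (q\<^sup>2 + 1) (q - 1)" "coprime (q\<^sup>2 + 1) 12" "coprime (q - 1) 12" "coprime (q - 1) 2"
  "coprime (q\<^sup>2 + 1) 2" "odd (q - 1)"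
proof -
  obtain k where k: "q = 2 * k" using q_even by blast
  show odd: "odd (q - 1)" using q_ge q_even by auto
  have q3: "q\<^sup>2 mod 3 = 1" using power_mod[of q 3 2] q_mod3 by simp
  then have "(q\<^sup>2 + 1) mod 3 = 2" by (simp add: mod_Suc)
  then have n3: "\<not> 3 dvd q\<^sup>2 + 1" by presburger
  have m3: "\<not> 3 dvd q - 1" using q_mod3 q_ge by presburger
  have o2: "odd (q\<^sup>2 + 1)" using q_even by simp
  have c3: "coprime n 3" if "\<not> 3 dvd n" for n :: nat
  proof -
    have "n mod 3 = 1 \<or> n mod 3 = 2" using that by presburger
    moreover have "coprime 3 (1::nat)" "coprime 3 (2::nat)" by simp_all
    ultimately have "coprime 3 (n mod 3)" by metis
    then show ?thesis by (simp only: coprime_iff_gcd_eq_1 gcd_red_nat[of n 3])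
  qed
  show c1: "coprime (q - 1) 2" using odd by simp
  show c2: "coprime (q\<^sup>2 + 1) 2" using o2 by simp
  have "12 = (2::nat) * (2 * 3)" by simp
  then show "coprime (q\<^sup>2 + 1) 12" "coprime (q - 1) 12"
    using c1 c2 c3[OF n3] c3[OF m3] coprime_mult_right_iff by metis+
  show "coprime (q\<^sup>2 + 1) (q - 1)"
  proof (rule coprimeI)
    fix d assume d: "d dvd q\<^sup>2 + 1" "d dvd q - 1"
    obtain j where j: "q = Suc j" using q_ge by (cases q) auto
    have e: "q\<^sup>2 + 1 = (q - 1) * (q + 1) + 2" unfolding j by (simp add: power2_eq_square)
    have "d dvd (q - 1) * (q + 1)" using d(2) by simp
    then have "d dvd 2" using d(1) unfolding e by (simp only: dvd_add_right_iff)
    then show "is_unit d" using coprime_common_divisor[OF c1 d(2)] by simp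
  qed
qed

end

text \<open>Noncommuting \<open>a\<close> and \<open>b\<close> yield five distinct elements: the
  identity, \<open>a\<close>, \<open>b\<close> and the two products.\<close>

lemma (in group) card_le4_comm:
  assumes "finite (carrier G)" "card (carrier G) \<le> 4" "a \<in> carrier G" "b \<in> carrier G"
  shows "a \<otimes> b = b \<otimes> a"
proof (rule ccontr)
  assume n: "a \<otimes> b \<noteq> b \<otimes> a"
  have "a \<noteq> \<one>" "b \<noteq> \<one>" "a \<noteq> b" using n assms by auto
  moreover have "a \<otimes> b \<noteq> \<one>" using n assms by (metis inv_equality l_inv r_inv)
  moreover have "b \<otimes> a \<noteq> \<one>" using n assms by (metis inv_equality l_inv r_inv)
  moreover have "a \<otimes> b \<noteq> a" "a \<otimes> b \<noteq> b" "b \<otimes> a \<noteq> a" "b \<otimes> a \<noteq> b"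
    using assms calculation by (simp_all add: l_cancel_one r_cancel_one)
  ultimately have "card {\<one>, a, b, a \<otimes> b, b \<otimes> a} = 5" using n by auto
  moreover have "card {\<one>, a, b, a \<otimes> b, b \<otimes> a} \<le> card (carrier G)"
    using assms by (intro card_mono) auto
  ultimately show False using assms(2) by simp
qed

section \<open>Normalizers of tori and the trichotomy for solvable subgroups\<close>

context suzuki_action
begin

lemma C_conj:
  assumes "g \<in> carrier G" "x \<in> carrier G" shows "C (cj g x) = cj g ` C x"
proof -
  have *: "cj g ` C y \<subseteq> C (cj g y)" if "g \<in> carrier G" "y \<in> carrier G" for g y
    using that by (auto simp: cent_def simp flip: cj_mult)
  have "C (cj g x) \<subseteq> cj g ` C x"
  proof
    fix y assume y: "y \<in> C (cj g x)"
    then have "cj (inv g) y \<in> C (cj (inv g) (cj g x))" using *[of "inv g" "cj g x"] assms by auto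
    then have "cj (inv g) y \<in> C x" using assms by (simp only: cj_inv_cancel)
    moreover have "y = cj g (cj (inv g) y)" using assms C_in(1)[OF y] by simp
    ultimately show "y \<in> cj g ` C x" by (rule rev_image_eqI)
  qed
  then show ?thesis using *[OF assms] by (rule antisym)
qed

lemma conj_fpf: "g \<in> carrier G \<Longrightarrow> x \<in> fpf \<Longrightarrow> cj g x \<in> fpf"
  using F_conj[of g x] by (simp add: fpf_def)

text \<open>If one conjugate of \<open>x\<close> falls into \<open>C x\<close>, then its
  centralizer, the conjugated torus, is equal to \<open>C x\<close> by \<open>C_eq\<close>.\<close>

lemma nrm_iff: "x \<in> fpf \<Longrightarrow> g \<in> nrm x \<longleftrightarrow> g \<in> carrier G \<and> cj g ` C x = C x"
proof
  assume x: "x \<in> fpf" and g: "g \<in> nrm x"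
  have xG: "x \<in> carrier G" and gG: "g \<in> carrier G" and cC: "cj g x \<in> C x"
    using x g by (auto simp: fpf_def nrm_def)
  have "C (cj g x) = C x" by (rule C_eq[OF x cC not_one(1)[OF conj_fpf[OF gG x]]])
  then show "g \<in> carrier G \<and> cj g ` C x = C x" using gG C_conj[OF gG xG] by simp
next
  assume x: "x \<in> fpf" and g: "g \<in> carrier G \<and> cj g ` C x = C x"
  then show "g \<in> nrm x" using self_C[OF fpfD(1)[OF x]] by (auto simp: nrm_def)
qed

lemma nrm_eq: "x \<in> fpf \<Longrightarrow> y \<in> C x \<Longrightarrow> y \<noteq> \<one> \<Longrightarrow> nrm y = nrm x"
  using nrm_iff[of x] nrm_iff[of y] C_eq[of x y] C_fpf[of x y] by auto

lemma nrm_conj_closed: "x \<in> fpf \<Longrightarrow> g \<in> nrm x \<Longrightarrow> y \<in> C x \<Longrightarrow> cj g y \<in> C x"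
  using nrm_iff by blast

lemma C_sub_nrm: "x \<in> fpf \<Longrightarrow> C x \<subseteq> nrm x"
proof
  fix y assume x: "x \<in> fpf" and y: "y \<in> C x"
  then have "cj y x = x" using cj_eq_self[of y x] C_in(1)[OF y] fpfD(1)[OF x] by (simp add: cent_def)
  then show "y \<in> nrm x" using C_in(1)[OF y] self_C[OF fpfD(1)[OF x]] by (simp add: nrm_def)
qed

lemma cj_image_comp: "g \<in> carrier G \<Longrightarrow> h \<in> carrier G \<Longrightarrow> A \<subseteq> carrier G \<Longrightarrow> cj g ` cj h ` A = cj (g \<otimes> h) ` A"
  by (auto simp: image_image cj_comp subset_iff)

lemma C_sub: "C x \<subseteq> carrier G" by (auto simp: cent_def)

lemma nrm_subgroup: "x \<in> fpf \<Longrightarrow> subgroup (nrm x) G"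
proof
  assume x: "x \<in> fpf"
  show "nrm x \<subseteq> carrier G" by (auto simp: nrm_def)
  show "\<one> \<in> nrm x" using C_sub_nrm[OF x] one_cent[OF fpfD(1)[OF x]] by blast
  show "g \<otimes> h \<in> nrm x" if "g \<in> nrm x" "h \<in> nrm x" for g h
    using that cj_image_comp[OF _ _ C_sub, of g h x] by (simp add: nrm_iff[OF x])
  show "inv g \<in> nrm x" if "g \<in> nrm x" for g
  proof -
    have g: "g \<in> carrier G" "cj g ` C x = C x" using that nrm_iff[OF x] by auto
    have "cj (inv g) ` cj g ` C x = C x"
      using g(1) C_sub[of x] by (simp add: cj_image_comp) (simp add: subset_iff)
    then show ?thesis using g by (simp add: nrm_iff[OF x])
  qed
qed

text \<open>Elements of \<open>S\<close> conjugate \<open>x\<close> differently, because equal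
  conjugates would differ by an element of \<open>C x\<close>. The conjugates all lie in
  \<open>C x\<close>, where \<open>lin_conj\<close> allows four. Stated for sets of representatives,
  the bound applies both to powers of one element and to explicit lists.\<close>

lemma coset4:
  assumes x: "x \<in> fpf" and S: "S \<subseteq> nrm x"
    and sep: "\<And>g h. g \<in> S \<Longrightarrow> h \<in> S \<Longrightarrow> inv h \<otimes> g \<in> C x \<Longrightarrow> g = h"
  shows "card S \<le> 4"
proof -
  have xG: "x \<in> carrier G" and SG: "S \<subseteq> carrier G" using fpfD x S by (auto simp: nrm_def)
  have "inj_on (\<lambda>g. cj g x) S"
  proof (rule inj_onI)
    fix g h assume gh: "g \<in> S" "h \<in> S" "cj g x = cj h x"
    have G: "g \<in> carrier G" "h \<in> carrier G" using gh SG by auto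
    have "cj (inv h \<otimes> g) x = cj (inv h) (cj h x)" using gh(3) G xG cj_comp[of "inv h" g x] by simp
    then have "cj (inv h \<otimes> g) x = x" using G xG by simp
    then have "inv h \<otimes> g \<in> C x" using G xG cj_eq_self[of "inv h \<otimes> g" x] by (simp add: cent_def)
    then show "g = h" using sep gh by blast
  qed
  then have "card S = card ((\<lambda>g. cj g x) ` S)" by (simp add: card_image)
  also have "\<dots> \<le> card ({g \<otimes> x \<otimes> inv g | g. g \<in> carrier G} \<inter> C x)"
  proof (rule card_mono)
    have "C x \<subseteq> carrier G" by (rule C_sub)
    then show "finite ({g \<otimes> x \<otimes> inv g | g. g \<in> carrier G} \<inter> C x)"
      using fin finite_subset by blast
    show "(\<lambda>g. cj g x) ` S \<subseteq> {g \<otimes> x \<otimes> inv g | g. g \<in> carrier G} \<inter> C x"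
      using S by (auto simp: nrm_def cj_def)
  qed
  also have "\<dots> \<le> 4" by (rule lin_conj[OF xG not_one(1)[OF x] fpf_pow[OF x]])
  finally show ?thesis .
qed

lemma C_pow_closed: "x \<in> carrier G \<Longrightarrow> y \<in> C x \<Longrightarrow> y [^] (n::nat) \<in> C x"
  by (induct n) (auto simp: one_cent intro: C_mult)

lemma nrm_pow_closed: "x \<in> fpf \<Longrightarrow> y \<in> nrm x \<Longrightarrow> y [^] (n::nat) \<in> nrm x"
  by (induct n) (auto intro: subgroup.one_closed subgroup.m_closed nrm_subgroup)

text \<open>Pigeonhole on the powers 0 to 4 of \<open>g\<close>: two of them lie in one coset of
  \<open>C x\<close>, so some exponent between 1 and 4 leads into \<open>C x\<close>, and each of
  these divides 12.\<close>

lemma pow12: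
  assumes x: "x \<in> fpf" and g: "g \<in> nrm x" shows "g [^] (12::nat) \<in> C x"
proof -
  have xG: "x \<in> carrier G" and gG: "g \<in> carrier G" using x g by (auto simp: fpf_def nrm_def)
  have "\<exists>j\<in>{1..4}. g [^] (j::nat) \<in> C x"
  proof (rule ccontr)
    assume n: "\<not> ?thesis"
    have d: "inv (g [^] i) \<otimes> g [^] j \<notin> C x" if "i < j" "j \<le> 4" for i j :: nat
    proof -
      have "g [^] j = g [^] i \<otimes> g [^] (j - i)" using gG that by (simp add: nat_pow_mult)
      then have "inv (g [^] i) \<otimes> g [^] j = g [^] (j - i)" using gG by (simp flip: m_assoc)
      moreover have "j - i \<in> {1..4}" using that by auto
      ultimately show ?thesis using n by metis
    qed
    have d2: "inv (g [^] i) \<otimes> g [^] j \<notin> C x" if "j < i" "i \<le> 4" for i j :: nat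
    proof
      assume "inv (g [^] i) \<otimes> g [^] j \<in> C x"
      then have "inv (inv (g [^] i) \<otimes> g [^] j) \<in> C x" by (rule C_inv[OF xG])
      then show False using d[OF that] gG by (simp add: inv_mult_group)
    qed
    let ?S = "(\<lambda>i. g [^] i) ` {..4::nat}"
    have "inj_on (\<lambda>i. g [^] i) {..4::nat}"
    proof (rule inj_onI)
      fix i j :: nat assume ij: "i \<in> {..4}" "j \<in> {..4}" "g [^] i = g [^] j"
      then have "inv (g [^] i) \<otimes> g [^] j \<in> C x" using gG one_cent[OF xG] by simp
      then show "i = j" using d[of i j] d2[of j i] ij by (meson atMost_iff linorder_neqE_nat)
    qed
    then have "card ?S = 5" by (simp add: card_image)
    moreover have "card ?S \<le> 4"
    proof (rule coset4[OF x])
      show "?S \<subseteq> nrm x" using nrm_pow_closed[OF x g] by auto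
      fix a b assume ab: "a \<in> ?S" "b \<in> ?S" "inv b \<otimes> a \<in> C x"
      obtain i where i: "a = g [^] i" "i \<le> (4::nat)" using ab(1) by (metis imageE atMost_iff)
      obtain j where j: "b = g [^] j" "j \<le> (4::nat)" using ab(2) by (metis imageE atMost_iff)
      have "inv (g [^] j) \<otimes> g [^] i \<in> C x" using ab(3) unfolding i(1) j(1) .
      then have "\<not> j < i" "\<not> i < j" using d[of j i] d2[of i j] i(2) j(2) by blast+
      then have "i = j" by simp
      then show "a = b" by (simp only: i(1) j(1))
    qed
    ultimately show False by simp
  qed
  then obtain j where j: "j \<in> {1..4}" "g [^] (j::nat) \<in> C x" by blast
  have "j = 1 \<or> j = 2 \<or> j = 3 \<or> j = 4" using j(1) by auto
  then obtain k where k: "12 = j * k" by (auto intro: that[of 12] that[of 6] that[of 4] that[of 3])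
  have "(g [^] j) [^] k \<in> C x" by (rule C_pow_closed[OF xG j(2)])
  then show ?thesis unfolding k using gG by (simp add: nat_pow_pow)
qed

text \<open>The power \<open>g [^] 12\<close> lies in the torus. If it is nontrivial its centralizer
  is the torus, and \<open>g\<close> commutes with it; if it is trivial, so is \<open>g\<close> by
  coprimality.\<close>

lemma nrm_imp_C:
  assumes x: "x \<in> fpf" and g: "g \<in> nrm x" and n: "g [^] (n::nat) = \<one>" "coprime n 12"
  shows "g \<in> C x"
proof -
  have gG: "g \<in> carrier G" using g by (auto simp: nrm_def)
  show ?thesis
  proof (cases "g [^] (12::nat) = \<one>")
    case True
    then have "g = \<one>" using pow_coprime_eq_one[OF gG n(1)] n(2) by blast
    then show ?thesis using one_cent[OF fpfD(1)[OF x]] by simp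
  next
    case False
    have "C (g [^] (12::nat)) = C x" by (rule C_eq[OF x pow12[OF x g] False])
    moreover have "g \<in> C (g [^] (12::nat))" using gG by (simp add: cent_def nat_pow_Suc2[symmetric] flip: nat_pow_Suc)
    ultimately show ?thesis by simp
  qed
qed

lemma fpf_nrm: "x \<in> fpf \<Longrightarrow> g \<in> nrm x \<Longrightarrow> g \<in> fpf \<Longrightarrow> g \<in> C x"
  using nrm_imp_C[OF _ _ fpf_pow q_arith(2)] by blast

text \<open>Such an element has order dividing q - 1, which is coprime to 12, so it would lie in the
  torus itself, whose nontrivial elements have no fixed points.\<close>

lemma T2_nrm: "x \<in> fpf \<Longrightarrow> g \<in> nrm x \<Longrightarrow> P \<noteq> Q \<Longrightarrow> g \<in> T2 P Q \<Longrightarrow> g = \<one>"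
proof (rule ccontr)
  assume x: "x \<in> fpf" "g \<in> nrm x" "P \<noteq> Q" "g \<in> T2 P Q" and g: "g \<noteq> \<one>"
  have "g \<in> C x" by (rule nrm_imp_C[OF x(1,2) T2_pow[OF x(4,3)] q_arith(3)])
  then have "g \<in> fpf" using C_fpf x(1) g by blast
  then show False using x(4) by (auto simp: fpf_def stab2_def fixpts_def)
qed

text \<open>The last nontrivial term of the derived series is an abelian normal subgroup; the fixed points
  of one of its nontrivial elements decide which of the three cases occurs.\<close>

lemma solv_cases:
  assumes H: "subgroup H G" "solvable_seq G H" "H \<noteq> {\<one>}"
  obtains P where "H \<subseteq> pstab P" | P Q where "P \<noteq> Q" "H \<subseteq> sstab P Q" | x where "x \<in> fpf" "H \<subseteq> nrm x"
proof -
  from solvable_seq_abelian_normal[OF H] obtain A where A0': "A \<subseteq> H \<and> (\<exists>a\<in>A. a \<noteq> \<one>) \<and>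
    (\<forall>a\<in>A. \<forall>b\<in>A. a \<otimes> b = b \<otimes> a) \<and> (\<forall>h\<in>H. \<forall>a\<in>A. cj h a \<in> A)" by (rule exE)
  note A0 = A0'[THEN conjunct1] A0'[THEN conjunct2, THEN conjunct1]
    A0'[THEN conjunct2, THEN conjunct2, THEN conjunct1] A0'[THEN conjunct2, THEN conjunct2, THEN conjunct2]
  have ac: "a \<otimes> b = b \<otimes> a" if "a \<in> A" "b \<in> A" for a b using that A0(3) by simp
  have an: "cj h a \<in> A" if "h \<in> H" "a \<in> A" for h a using that A0(4) by simp
  from A0(2) obtain a where "a \<in> A" "a \<noteq> \<one>" by (rule bexE)
  note A = A0(1) this
  have HG: "H \<subseteq> carrier G" by (rule subgroup.subset[OF H(1)])
  have aG: "a \<in> carrier G" using A HG by auto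
  have hC: "cj h a \<in> C a" if "h \<in> H" for h
    using ac[OF A(2) an[OF that A(2)]] an[OF that A(2)] A(1) HG by (auto simp: cent_def)
  have hF: "F (cj h a) = act h ` F a" if "h \<in> H" for h using F_conj that aG HG by auto
  have hI: "act (cj h a) ` F a = F a" if "h \<in> H" for h by (rule C_image_F[OF hC[OF that] aG])
  show thesis
  proof (cases rule: F_cases[OF aG A(3)])
    case 1
    then have "a \<in> fpf" using aG by (simp add: fpf_def)
    moreover have "H \<subseteq> nrm a" using hC HG by (auto simp: nrm_def)
    ultimately show ?thesis by (rule that(3))
  next
    case (2 P)
    have "H \<subseteq> pstab P"
    proof
      fix h assume h: "h \<in> H"
      have "act (cj h a) P = P" using hI[OF h] 2 by simp
      then have "P \<in> F (cj h a)" by (simp add: F_iff)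
      then have "act h P = P" using hF[OF h] 2 by simp
      then show "h \<in> pstab P" using h HG by (auto simp: pstab_def)
    qed
    then show ?thesis by (rule that(1))
  next
    case (3 P Q)
    have "H \<subseteq> sstab P Q"
    proof
      fix h assume h: "h \<in> H"
      have hG: "h \<in> carrier G" using h HG by auto
      have cG: "cj h a \<in> carrier G" using hG aG by simp
      have c2: "card (act h ` {P, Q}) = 2"
        using 3(1) act_inj[OF hG] by (simp add: card_insert_if)
      have im: "act (cj h a) ` {P, Q} = {P, Q}" using hI[OF h] 3(2) by simp
      \<comment> \<open>The conjugate commutes with \<open>a\<close> and so permutes
        \<open>{P, Q}\<close>. It cannot interchange the two points: it would then have one fixed
        point, while a conjugate of \<open>a\<close> has two.\<close>
      have "act (cj h a) P = P \<and> act (cj h a) Q = Q"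
      proof (rule ccontr)
        assume "\<not> ?thesis"
        then have "act (cj h a) P = Q" "act (cj h a) Q = P" using im 3(1) by (auto simp: doubleton_eq_iff)
        then have "card (F (cj h a)) = 1" using swap[OF cG 3(1)] by blast
        then show False using c2 hF[OF h] 3(2) by simp
      qed
      then have "{P, Q} \<subseteq> act h ` {P, Q}" using hF[OF h] 3(2) F_iff by (metis empty_subsetI insert_subset)
      then have "{P, Q} = act h ` {P, Q}" using c2 3(1) by (intro card_subset_eq) (auto simp: card_insert_if)
      then have "act h ` {P, Q} = {P, Q}" by (rule sym)
      then show "h \<in> sstab P Q" unfolding sstab_def using hG by blast
    qed
    then show ?thesis by (rule that(2)[OF 3(1)])
  qed
qed

section \<open>Solvabilizers of elements of odd order\<close>

text \<open>Commutators descend along the point stabilizer, its unipotent part \<open>U P\<close>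
  and the set \<open>?Z\<close> of square roots of the identity in \<open>U P\<close>, which is an
  abelian subgroup.\<close>

lemma pstab_solvable: "solvable_seq G (pstab P)"
proof -
  let ?Z = "{x \<in> U P. x \<otimes> x = \<one>}"
  have UG: "x \<in> carrier G" if "x \<in> U P" for x using that by (simp add: uni_def)
  have U1: "\<one> \<in> U P" by (simp add: uni_def)
  have Z: "subgroup ?Z G"
  proof
    show "?Z \<subseteq> carrier G" using UG by blast
    show "\<one> \<in> ?Z" using U1 by simp
    show "x \<otimes> y \<in> ?Z" if xy: "x \<in> ?Z" "y \<in> ?Z" for x y
    proof -
      have c: "x \<otimes> y = y \<otimes> x" using xy invol_comm[of x P y] by simp
      have G: "x \<in> carrier G" "y \<in> carrier G" using xy UG by auto
      have "x \<otimes> y \<otimes> (x \<otimes> y) = x \<otimes> y \<otimes> (y \<otimes> x)" by (simp only: c)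
      also have "\<dots> = x \<otimes> (y \<otimes> y) \<otimes> x" using G by (simp add: m_assoc)
      also have "\<dots> = \<one>" using xy G by simp
      finally show ?thesis using uni_mult[of x P y] xy by simp
    qed
    show "inv x \<in> ?Z" if x: "x \<in> ?Z" for x
    proof -
      have "inv x = x" using x UG by (auto intro: inv_equality)
      then show ?thesis using x by simp
    qed
  qed
  have 1: "solvable_seq G ?Z"
    by (rule solvable_seq_comm[OF Z]) (use invol_comm in blast)
  have 2: "solvable_seq G (U P)"
  proof (rule solvable_seq_step[OF U_subgroup 1])
    fix a b assume ab: "a \<in> U P" "b \<in> U P"
    have "a \<otimes> b \<otimes> inv a \<otimes> inv b \<in> U P"
      using ab U_subgroup[of P] by (intro uni_mult) (auto intro: subgroup.m_inv_closed)
    then show "a \<otimes> b \<otimes> inv a \<otimes> inv b \<in> ?Z" using uni_comm[OF ab refl] by simp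
  qed
  show ?thesis
    by (rule solvable_seq_step[OF pstab_subgroup 2]) (auto simp: pstab_def intro: borel_comm)
qed

text \<open>The permutations of a two-point set commute, so commutators fix both points and land in
  the abelian group \<open>T2 P Q\<close>.\<close>

lemma sstab_solvable:
  assumes "P \<noteq> Q" shows "solvable_seq G (sstab P Q)"
proof (rule solvable_seq_step[OF sstab_subgroup])
  show "solvable_seq G (T2 P Q)"
    by (rule solvable_seq_comm[OF T2_subgroup]) (rule stab2_comm[OF assms])
  fix a b assume ab: "a \<in> sstab P Q" "b \<in> sstab P Q"
  have G: "a \<in> carrier G" "b \<in> carrier G" using ab by (auto simp: sstab_def)
  have c: "(act a P = P \<and> act a Q = Q) \<or> (act a P = Q \<and> act a Q = P)"
    "(act b P = P \<and> act b Q = Q) \<or> (act b P = Q \<and> act b Q = P)"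
    using ab by (auto simp: sstab_def doubleton_eq_iff)
  show "a \<otimes> b \<otimes> inv a \<otimes> inv b \<in> T2 P Q"
    using c G by (elim disjE conjE) (simp_all add: stab2_def act_mult act_inv_fix)
qed

lemma C_normal:
  assumes x: "x \<in> fpf" shows "C x \<lhd> G\<lparr>carrier := nrm x\<rparr>"
proof -
  interpret K: group "G\<lparr>carrier := nrm x\<rparr>" by (rule subgroup_imp_group[OF nrm_subgroup[OF x]])
  have s: "subgroup (C x) (G\<lparr>carrier := nrm x\<rparr>)"
    by (rule subgroup_incl[OF C_subgroup[OF fpfD(1)[OF x]] nrm_subgroup[OF x] C_sub_nrm[OF x]])
  show ?thesis
    unfolding K.normal_inv_iff
    using s nrm_conj_closed[OF x] m_inv_consistent[OF nrm_subgroup[OF x]] by (simp add: cj_def)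
qed

lemma nrm_cosets:
  assumes x: "x \<in> fpf"
  shows "card (carrier (G\<lparr>carrier := nrm x\<rparr> Mod C x)) \<le> 4"
proof -
  let ?R = "carrier (G\<lparr>carrier := nrm x\<rparr> Mod C x)"
  have xG: "x \<in> carrier G" by (rule fpfD(1)[OF x])
  have nG: "nrm x \<subseteq> carrier G" by (rule subgroup.subset[OF nrm_subgroup[OF x]])
  have R: "?R = (\<lambda>g. C x #> g) ` nrm x" by (auto simp: FactGroup_def RCOSETS_def r_coset_def)
  \<comment> \<open>Picks one representative from each coset, so that \<open>coset4\<close> bounds
    the number of cosets.\<close>
  define f where "f X = (SOME g. g \<in> nrm x \<and> X = C x #> g)" for X
  have f: "f X \<in> nrm x \<and> X = C x #> f X" if "X \<in> ?R" for X
  proof -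
    have "\<exists>g. g \<in> nrm x \<and> X = C x #> g" using that unfolding R by (elim imageE) (rule exI, rule conjI)
    then show ?thesis unfolding f_def by (rule someI_ex)
  qed
  have "inj_on f ?R"
  proof (rule inj_onI)
    fix X Y assume XY: "X \<in> ?R" "Y \<in> ?R" "f X = f Y"
    have "X = C x #> f X" "Y = C x #> f Y" using f[OF XY(1)] f[OF XY(2)] by (metis, metis)
    then show "X = Y" using XY(3) by simp
  qed
  then have "card ?R = card (f ` ?R)" by (simp add: card_image)
  also have "\<dots> \<le> 4"
  proof (rule coset4[OF x])
    show "f ` ?R \<subseteq> nrm x" using f by blast
    fix g h assume gh: "g \<in> f ` ?R" "h \<in> f ` ?R" "inv h \<otimes> g \<in> C x"
    then obtain X Y where XY: "X \<in> ?R" "g = f X" "Y \<in> ?R" "h = f Y" by blast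
    have n: "g \<in> nrm x" "h \<in> nrm x" unfolding XY(2,4) using f[OF XY(1)] f[OF XY(3)] by (metis, metis)
    then have G: "g \<in> carrier G" "h \<in> carrier G" using nG by auto
    have "cj h (inv h \<otimes> g) \<in> C x" by (rule nrm_conj_closed[OF x n(2) gh(3)])
    then have "g \<otimes> inv h \<in> C x" using G by (simp add: cj_def flip: m_assoc)
    moreover have "g = (g \<otimes> inv h) \<otimes> h" using G by (simp add: m_assoc)
    ultimately have "g \<in> C x #> h" unfolding r_coset_def by blast
    then have "C x #> h = C x #> g" by (rule repr_independence[OF _ G(2) C_subgroup[OF xG]])
    then have "X = Y" using f[OF XY(1)] f[OF XY(3)] \<open>C x #> h = C x #> g\<close> unfolding XY(2,4) by metis
    then show "g = h" using XY by simp
  qed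
  finally show ?thesis .
qed

text \<open>An extension of the abelian group \<open>C x\<close> by a quotient with at most four
  elements, which is abelian for reasons of size.\<close>

lemma nrm_solvable:
  assumes x: "x \<in> fpf" shows "solvable_seq G (nrm x)"
proof (rule solvable_seq.extension[OF _ C_normal[OF x] nrm_subgroup[OF x]])
  show "solvable_seq G (C x)"
    by (rule solvable_seq_comm[OF C_subgroup[OF fpfD(1)[OF x]]]) (rule C_comm[OF x])
  interpret Q: group "G\<lparr>carrier := nrm x\<rparr> Mod C x" by (rule normal.factorgroup_is_group[OF C_normal[OF x]])
  have "finite (carrier (G\<lparr>carrier := nrm x\<rparr> Mod C x))"
  proof -
    have "nrm x \<subseteq> carrier G" by (rule subgroup.subset[OF nrm_subgroup[OF x]])
    then have "finite (nrm x)" using fin finite_subset by blast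
    then show ?thesis by (auto simp: FactGroup_def RCOSETS_def)
  qed
  then show "comm_group (G\<lparr>carrier := nrm x\<rparr> Mod C x)"
    by (intro Q.group_comm_groupI Q.card_le4_comm nrm_cosets[OF x])
qed

section \<open>Solvabilizers of elements with two or no fixed points\<close>

lemma Sol_iff:
  assumes "x \<in> carrier G" "y \<in> carrier G"
  shows "y \<in> Sol G x \<longleftrightarrow> solvable_seq G (generate G {x, y})"
  using assms solvable_carrier_iff[OF generate_is_subgroup[of "{x, y}"]] by (simp add: Sol_def)

lemma Sol_sub: "Sol G x \<subseteq> carrier G" by (auto simp: Sol_def)

lemma Sol_sym: "x \<in> carrier G \<Longrightarrow> y \<in> carrier G \<Longrightarrow> y \<in> Sol G x \<longleftrightarrow> x \<in> Sol G y"
  by (simp add: Sol_iff insert_commute)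

lemma Sol_I:
  assumes "solvable_seq G K" "x \<in> K" "y \<in> K" shows "y \<in> Sol G x"
proof -
  have K: "subgroup K G" by (rule solvable_imp_subgroup[OF assms(1)])
  have G: "{x, y} \<subseteq> carrier G" using assms subgroup.subset[OF K] by auto
  have "solvable_seq G (generate G {x, y})"
    using assms K G by (intro solvable_seq_mono[OF assms(1)] generate_is_subgroup generate_subgroup_incl) auto
  then show ?thesis using G by (simp add: Sol_iff)
qed

lemma Sol_cases:
  assumes "y \<in> Sol G x" "x \<in> carrier G" "x \<noteq> \<one>"
  obtains P where "x \<in> pstab P" "y \<in> pstab P"
  | P Q where "P \<noteq> Q" "x \<in> sstab P Q" "y \<in> sstab P Q"
  | z where "z \<in> fpf" "x \<in> nrm z" "y \<in> nrm z"
proof -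
  have y: "y \<in> carrier G" using assms(1) Sol_sub by blast
  have s: "solvable_seq G (generate G {x, y})" using assms y by (simp add: Sol_iff)
  have m: "x \<in> generate G {x, y}" "y \<in> generate G {x, y}" by (auto intro: generate.incl)
  then have "generate G {x, y} \<noteq> {\<one>}" using assms(3) by blast
  from solv_cases[OF solvable_imp_subgroup[OF s] s this] show thesis
  proof cases
    case (1 P) then show ?thesis using m that(1) by blast
  next
    case (2 P Q) then show ?thesis using m that(2) by blast
  next
    case (3 z) then show ?thesis using m that(3) by blast
  qed
qed

lemma sstab_cases:
  assumes "x \<in> sstab P Q" "P \<noteq> Q"
  obtains "act x P = P" "act x Q = Q" | "act x P = Q" "act x Q = P" "card (F x) = 1"
proof -
  have xG: "x \<in> carrier G" using assms by (simp add: sstab_def)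
  have "(act x P = P \<and> act x Q = Q) \<or> (act x P = Q \<and> act x Q = P)"
    using assms(1) by (auto simp: sstab_def doubleton_eq_iff)
  then show thesis using that swap[OF xG assms(2)] by blast
qed

text \<open>Of the three kinds of solvable overgroup, torus normalizers are excluded by
  \<open>T2_nrm\<close>. A point stabilizer containing \<open>y\<close> belongs to \<open>Q\<close>
  or \<open>R\<close>, and a pair stabilizer containing \<open>y\<close> to \<open>{Q, R}\<close>,
  since \<open>y\<close> has two fixed points and thus cannot interchange a pair.\<close>

lemma Sol_split:
  assumes y: "y \<in> carrier G" "Q \<noteq> R" "F y = {Q, R}"
  shows "Sol G y = pstab Q \<union> pstab R \<union> sstab Q R"
proof (rule antisym; rule subsetI)
  fix x assume x: "x \<in> Sol G y"
  have yQ: "act y Q = Q" "act y R = R" using y(3) F_iff by blast+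
  show "x \<in> pstab Q \<union> pstab R \<union> sstab Q R"
  proof (cases rule: Sol_cases[OF x y(1) not_one(3)[OF y(3)]])
    case (1 P)
    then have "P \<in> F y" by (simp add: pstab_def F_iff)
    then show ?thesis using 1 y(3) by auto
  next
    case (2 P P')
    have "card (F y) \<noteq> 1" using y by simp
    then have "P \<in> F y" "P' \<in> F y" using sstab_cases[OF 2(2,1)] F_iff by metis+
    then have "{P, P'} = {Q, R}" using 2(1) y(3) by auto
    then show ?thesis using 2(3) by (simp add: sstab_def)
  next
    case (3 z)
    have "y = \<one>" by (rule T2_nrm[OF 3(1,2) y(2)]) (simp add: stab2_def y(1) yQ)
    then show ?thesis using not_one(3)[OF y(3)] by blast
  qed
next
  fix x assume x: "x \<in> pstab Q \<union> pstab R \<union> sstab Q R"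
  have "y \<in> pstab Q" "y \<in> pstab R" "y \<in> sstab Q R"
  proof -
    have "act y Q = Q" "act y R = R" using y(3) F_iff by blast+
    then show "y \<in> pstab Q" "y \<in> pstab R" "y \<in> sstab Q R" using y(1) by (simp_all add: pstab_def sstab_def)
  qed
  then show "x \<in> Sol G y" using x pstab_solvable sstab_solvable[OF y(2)] Sol_I by blast
qed

text \<open>A fixed-point-free element lies in no point or pair stabilizer. If it normalizes a
  torus, it belongs to that torus by \<open>fpf_nrm\<close>, so only one torus normalizer contains
  it.\<close>

lemma Sol_fpf:
  assumes y: "y \<in> fpf" shows "Sol G y = nrm y"
proof (rule antisym; rule subsetI)
  fix x assume x: "x \<in> Sol G y"
  have yG: "y \<in> carrier G" and yF: "F y = {}" using fpfD[OF y] by auto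
  show "x \<in> nrm y"
  proof (cases rule: Sol_cases[OF x yG not_one(1)[OF y]])
    case (1 P)
    then have "P \<in> F y" by (simp add: pstab_def F_iff)
    then show ?thesis using yF by simp
  next
    case (2 P P')
    have "card (F y) \<noteq> 1" using yF by simp
    then have "P \<in> F y" using sstab_cases[OF 2(2,1)] F_iff by metis
    then show ?thesis using yF by simp
  next
    case (3 z)
    have "y \<in> C z" by (rule fpf_nrm[OF 3(1,2) y])
    then show ?thesis using nrm_eq[OF 3(1) _ not_one(1)[OF y]] 3(3) by simp
  qed
next
  fix x assume x: "x \<in> nrm y"
  have "y \<in> nrm y" using C_sub_nrm[OF y] self_C[OF fpfD(1)[OF y]] by blast
  then show "x \<in> Sol G y" using x nrm_solvable[OF y] Sol_I by blast
qed

section \<open>Counting elements and tori\<close>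

lemma T2_F:
  assumes "y \<in> T2 Q R" "y \<noteq> \<one>" "Q \<noteq> R" shows "F y = {Q, R}"
proof -
  have "{Q, R} \<subseteq> F y" using assms(1) by (simp add: stab2_def F_iff)
  moreover have "card (F y) \<le> card {Q, R}" using fix3[of y] assms by (simp add: stab2_def card_insert_if)
  ultimately show ?thesis by (intro card_seteq[symmetric]) auto
qed

lemma T2_ex:
  assumes "Q \<noteq> R" obtains y where "y \<in> T2 Q R" "y \<noteq> \<one>"
proof -
  have "\<not> T2 Q R \<subseteq> {\<one>}"
  proof
    assume "T2 Q R \<subseteq> {\<one>}"
    then have "card (T2 Q R) \<le> card {\<one>}" by (intro card_mono) auto
    then show False using stab2_card[OF assms] q_ge by simp
  qed
  then show thesis using that by blast
qed

lemma card_left_translate: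
  assumes "h \<in> carrier G" "A \<subseteq> carrier G" shows "card ((\<lambda>a. h \<otimes> a) ` A) = card A"
proof (rule card_image, rule inj_onI)
  fix x y assume "x \<in> A" "y \<in> A" "h \<otimes> x = h \<otimes> y"
  moreover from this have "x \<in> carrier G" "y \<in> carrier G" using assms(2) by auto
  ultimately show "x = y" using assms(1) by simp
qed

text \<open>By double transitivity the images of a fixed pair run through all ordered pairs of
  distinct points, and each fibre is a coset of the two-point stabilizer.\<close>

lemma card_carrier: "card (carrier G) = (q - 1) * ((q\<^sup>2 + 1) * q\<^sup>2)"
proof -
  have "\<exists>P Q :: 'p. P \<noteq> Q"
  proof (rule ccontr)
    assume "\<not> ?thesis"
    then have "UNIV = {undefined :: 'p}" by blast
    then have "card (UNIV :: 'p set) = card {undefined :: 'p}" by (rule arg_cong)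
    then show False using card_points_big by simp
  qed
  then obtain P Q :: 'p where PQ: "P \<noteq> Q" by blast
  let ?f = "\<lambda>g. (act g P, act g Q)"
  have "card (carrier G) = (q - 1) * card (?f ` carrier G)"
  proof (rule card_eq_fibres[OF fin])
    fix y assume "y \<in> ?f ` carrier G"
    then obtain h where h: "h \<in> carrier G" "y = (act h P, act h Q)" by blast
    have "{g \<in> carrier G. ?f g = y} = (\<lambda>a. h \<otimes> a) ` T2 P Q"
    proof (rule antisym; rule subsetI)
      fix g assume "g \<in> {g \<in> carrier G. ?f g = y}"
      then have g: "g \<in> carrier G" "act g P = act h P" "act g Q = act h Q" using h by auto
      then have "inv h \<otimes> g \<in> T2 P Q" using h(1) by (simp add: stab2_def act_mult)
      moreover have "g = h \<otimes> (inv h \<otimes> g)" using g h(1) by (simp flip: m_assoc)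
      ultimately show "g \<in> (\<lambda>a. h \<otimes> a) ` T2 P Q" by (rule rev_image_eqI)
    next
      fix g assume "g \<in> (\<lambda>a. h \<otimes> a) ` T2 P Q"
      then show "g \<in> {g \<in> carrier G. ?f g = y}" using h by (auto simp: stab2_def act_mult)
    qed
    then show "card {g \<in> carrier G. ?f g = y} = q - 1"
      using card_left_translate[OF h(1) subgroup.subset[OF T2_subgroup]] stab2_card[OF PQ] by simp
  qed
  moreover have "?f ` carrier G = UNIV \<times> UNIV - Id"
  proof (rule antisym; rule subsetI)
    fix y assume "y \<in> ?f ` carrier G" then show "y \<in> UNIV \<times> UNIV - Id" using PQ act_inj by auto
  next
    fix y :: "'p \<times> 'p" assume "y \<in> UNIV \<times> UNIV - Id"
    then obtain A B where AB: "y = (A, B)" "A \<noteq> B" by (cases y) auto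
    then obtain g where g: "g \<in> carrier G" "act g P = A" "act g Q = B" using trans2[OF PQ AB(2)] by blast
    then have "y = ?f g" using AB by simp
    then show "y \<in> ?f ` carrier G" using g(1) by (rule image_eqI)
  qed
  moreover have "card (UNIV \<times> UNIV - (Id :: 'p rel)) = (q\<^sup>2 + 1) * (q\<^sup>2 + 1) - (q\<^sup>2 + 1)"
  proof -
    have "(Id :: 'p rel) = (\<lambda>a. (a, a)) ` UNIV" unfolding Id_def image_def by simp
    moreover have "card (range (\<lambda>a :: 'p. (a, a))) = card (UNIV :: 'p set)"
      by (rule card_image) (simp add: inj_on_def)
    ultimately have "card (Id :: 'p rel) = q\<^sup>2 + 1" using card_points by simp
    moreover have "card (UNIV \<times> UNIV :: 'p rel) = (q\<^sup>2 + 1) * (q\<^sup>2 + 1)"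
      unfolding card_cartesian_product card_points ..
    moreover have "card (UNIV \<times> UNIV - (Id :: 'p rel)) = card (UNIV \<times> UNIV :: 'p rel) - card (Id :: 'p rel)"
      by (rule card_Diff_subset) simp_all
    ultimately show ?thesis by (simp only:)
  qed
  ultimately show ?thesis by simp
qed

section \<open>Counting elements by their number of fixed points\<close>

definition E1 :: "'a set" where "E1 = {x \<in> carrier G. card (F x) = 1}"
definition E2 :: "'a set" where "E2 = {x \<in> carrier G. card (F x) = 2}"

lemma carrier_split: "carrier G = {\<one>} \<union> fpf \<union> E1 \<union> E2"
proof -
  have *: "n = 0 \<or> n = 1 \<or> n = 2" if "n \<le> 2" for n :: nat using that by arith
  have "x \<in> fpf \<or> x \<in> E1 \<or> x \<in> E2" if "x \<in> carrier G" "x \<noteq> \<one>" for x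
    using *[OF fix3[OF that]] that(1) by (auto simp: fpf_def E1_def E2_def)
  moreover have "fpf \<subseteq> carrier G" "E1 \<subseteq> carrier G" "E2 \<subseteq> carrier G" "\<one> \<in> carrier G"
    by (auto simp: fpf_def E1_def E2_def)
  ultimately show ?thesis by (intro antisym subsetI) blast+
qed

lemma carrier_disj: "\<one> \<notin> fpf" "\<one> \<notin> E1" "\<one> \<notin> E2" "fpf \<inter> E1 = {}" "fpf \<inter> E2 = {}" "E1 \<inter> E2 = {}"
  using card_points_big by (auto simp: fpf_def E1_def E2_def)

lemma fin_parts: "finite fpf" "finite E1" "finite E2"
  using fin carrier_split by (metis finite_Un)+

lemma F_image_E2: "F ` E2 = {S. card S = 2}"
proof (rule antisym; rule subsetI)
  fix S assume "S \<in> F ` E2" then show "S \<in> {S. card S = 2}" by (auto simp: E2_def)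
next
  fix S :: "'p set" assume "S \<in> {S. card S = 2}"
  then obtain P Q where PQ: "S = {P, Q}" "P \<noteq> Q" by (auto simp: card_2_iff)
  obtain y where y: "y \<in> T2 P Q" "y \<noteq> \<one>" by (rule T2_ex[OF PQ(2)])
  then have "F y = S" using T2_F PQ by simp
  moreover have "y \<in> E2" using y PQ calculation by (simp add: E2_def stab2_def)
  ultimately show "S \<in> F ` E2" by blast
qed

lemma card_E2: "card E2 = (q - 2) * ((q\<^sup>2 + 1) choose 2)"
proof -
  have fib: "{x \<in> E2. F x = {P, Q}} = T2 P Q - {\<one>}" if "P \<noteq> Q" for P Q
  proof -
    have "x \<in> E2 \<and> F x = {P, Q} \<longleftrightarrow> x \<in> T2 P Q \<and> x \<noteq> \<one>" for x
    proof
      assume x: "x \<in> E2 \<and> F x = {P, Q}"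
      then have "x \<in> carrier G" "F x = {P, Q}" by (auto simp: E2_def)
      moreover from this have "act x P = P" "act x Q = Q" using F_iff by blast+
      ultimately show "x \<in> T2 P Q \<and> x \<noteq> \<one>" using not_one(3) by (simp add: stab2_def)
    next
      assume x: "x \<in> T2 P Q \<and> x \<noteq> \<one>"
      then have "F x = {P, Q}" using T2_F that by blast
      then show "x \<in> E2 \<and> F x = {P, Q}" using x that by (simp add: E2_def stab2_def)
    qed
    then show ?thesis by (simp add: Set.set_eq_iff)
  qed
  have "card E2 = (q - 2) * card (F ` E2)"
  proof (rule card_eq_fibres[OF fin_parts(3)])
    fix S assume "S \<in> F ` E2"
    then obtain P Q where PQ: "S = {P, Q}" "P \<noteq> Q" unfolding F_image_E2 by (auto simp: card_2_iff)
    have "\<one> \<in> T2 P Q" by (rule subgroup.one_closed[OF T2_subgroup])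
    then show "card {x \<in> E2. F x = S} = q - 2"
      unfolding PQ(1) fib[OF PQ(2)] using stab2_card[OF PQ(2)] by (simp add: card_Diff_singleton)
  qed
  also have "card (F ` E2) = (q\<^sup>2 + 1) choose 2"
    unfolding F_image_E2 using n_subsets[of "UNIV :: 'p set" 2] card_points by simp
  finally show ?thesis .
qed

text \<open>Every element of \<open>E1\<close> lies in exactly one \<open>U P\<close>, which
  contributes \<open>k\<close> elements with property \<open>R\<close>; positivity of
  \<open>k\<close> makes each of the q^2 + 1 points occur. The parameter \<open>R\<close> treats
  involutions and elements of order four by one argument.\<close>

lemma card_E1_part:
  assumes "\<And>P. card {x \<in> U P. x \<noteq> \<one> \<and> R x} = k" "k > 0"
  shows "card {x \<in> E1. R x} = k * (q\<^sup>2 + 1)"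
proof -
  have fib: "{x \<in> {x \<in> E1. R x}. F x = {P}} = {x \<in> U P. x \<noteq> \<one> \<and> R x}" for P
    using not_one(2) by (auto simp: E1_def uni_def)
  have k: "card {x \<in> {x \<in> E1. R x}. F x = {P}} = k" for P unfolding fib by (rule assms(1))
  have im: "F ` {x \<in> E1. R x} = range (\<lambda>P. {P})"
  proof (rule antisym; rule subsetI)
    fix S assume "S \<in> F ` {x \<in> E1. R x}"
    then show "S \<in> range (\<lambda>P. {P})" by (auto simp: E1_def card_1_singleton_iff)
  next
    fix S :: "'p set" assume "S \<in> range (\<lambda>P. {P})"
    then obtain P where P: "S = {P}" by blast
    have "{x \<in> {x \<in> E1. R x}. F x = {P}} \<noteq> {}"
    proof
      assume e: "{x \<in> {x \<in> E1. R x}. F x = {P}} = {}"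
      show False using k[of P] assms(2) unfolding e by simp
    qed
    then obtain x where x: "x \<in> {x \<in> {x \<in> E1. R x}. F x = {P}}" by (meson ex_in_conv)
    then have "S = F x" "x \<in> {x \<in> E1. R x}" using P by simp_all
    then show "S \<in> F ` {x \<in> E1. R x}" by (rule image_eqI)
  qed
  have "card {x \<in> E1. R x} = k * card (F ` {x \<in> E1. R x})"
  proof (rule card_eq_fibres)
    show "finite {x \<in> E1. R x}" using fin_parts by simp
    show "card {x \<in> {x \<in> E1. R x}. F x = y} = k" if "y \<in> F ` {x \<in> E1. R x}" for y
      using that k unfolding im by blast
  qed
  also have "card (F ` {x \<in> E1. R x}) = q\<^sup>2 + 1" unfolding im using card_points by (simp add: card_image inj_on_def)
  finally show ?thesis .
qed

lemma one_U: "\<one> \<in> U P" by (simp add: uni_def)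

lemma fin_U: "finite (U P)" using fin by (simp add: uni_def)

lemma card_invol: "card {x \<in> E1. x \<otimes> x = \<one>} = (q - 1) * (q\<^sup>2 + 1)"
proof -
  have "card {x \<in> U P. x \<noteq> \<one> \<and> x \<otimes> x = \<one>} = q - 1" for P
  proof -
    have "{x \<in> U P. x \<noteq> \<one> \<and> x \<otimes> x = \<one>} = {x \<in> U P. x \<otimes> x = \<one>} - {\<one>}" by blast
    then show ?thesis using one_U[of P] uni_invol[of P] by (simp add: card_Diff_singleton)
  qed
  then show ?thesis using card_E1_part[of "\<lambda>x. x \<otimes> x = \<one>" "q - 1"] q_ge by simp
qed

lemma card_order4: "card {x \<in> E1. x \<otimes> x \<noteq> \<one>} = (q\<^sup>2 - q) * (q\<^sup>2 + 1)"
proof -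
  have "card {x \<in> U P. x \<noteq> \<one> \<and> x \<otimes> x \<noteq> \<one>} = q\<^sup>2 - q" for P
  proof -
    have "{x \<in> U P. x \<noteq> \<one> \<and> x \<otimes> x \<noteq> \<one>} = U P - {x \<in> U P. x \<otimes> x = \<one>}" by auto
    moreover have "card (U P - {x \<in> U P. x \<otimes> x = \<one>}) = card (U P) - card {x \<in> U P. x \<otimes> x = \<one>}"
      using fin_U[of P] by (intro card_Diff_subset) auto
    ultimately show ?thesis using uni_invol[of P] uni_card[of P] by simp
  qed
  moreover have "q\<^sup>2 - q > 0" using q_ge by (simp add: power2_eq_square)
  ultimately show ?thesis using card_E1_part[of "\<lambda>x. x \<otimes> x \<noteq> \<one>" "q\<^sup>2 - q"] by simp
qed

lemma card_E1: "card E1 = (q - 1) * (q\<^sup>2 + 1) + (q\<^sup>2 - q) * (q\<^sup>2 + 1)"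
proof -
  have "E1 = {x \<in> E1. x \<otimes> x = \<one>} \<union> {x \<in> E1. x \<otimes> x \<noteq> \<one>}" by blast
  then have "card E1 = card {x \<in> E1. x \<otimes> x = \<one>} + card {x \<in> E1. x \<otimes> x \<noteq> \<one>}"
    using fin_parts(2) card_Un_disjoint[of "{x \<in> E1. x \<otimes> x = \<one>}" "{x \<in> E1. x \<otimes> x \<noteq> \<one>}"] by auto
  then show ?thesis using card_invol card_order4 by simp
qed

text \<open>What remains of the group order after the identity, \<open>E1\<close> and
  \<open>E2\<close>. The identity is over the reals so that the subtractions are genuine.\<close>

lemma card_fpf: "2 * real (card fpf) = real q ^ 3 * (real q - 1)\<^sup>2"
proof -
  have "card (carrier G) = card ({\<one>} \<union> fpf \<union> E1) + card E2"
    using fin_parts carrier_disj by (subst carrier_split, intro card_Un_disjoint) auto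
  also have "card ({\<one>} \<union> fpf \<union> E1) = card ({\<one>} \<union> fpf) + card E1"
    using fin_parts carrier_disj by (intro card_Un_disjoint) auto
  also have "card ({\<one>} \<union> fpf) = 1 + card fpf" using fin_parts carrier_disj by simp
  finally have e: "card (carrier G) = 1 + card fpf + card E1 + card E2" .
  have r1: "real (q - 1) = real q - 1" and r2: "real (q - 2) = real q - 2" using q_ge by (simp_all add: of_nat_diff)
  have "even ((q\<^sup>2 + 1) * q\<^sup>2)" using q_even by simp
  then have ch: "2 * ((q\<^sup>2 + 1) choose 2) = (q\<^sup>2 + 1) * q\<^sup>2" unfolding choose_two by simp
  have r3: "real (q\<^sup>2 - q) = real q * (real q - 1)"
    using r1 by (simp add: power2_eq_square flip: diff_mult_distrib2 of_nat_mult) (simp add: algebra_simps)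
  have r4: "2 * real ((q\<^sup>2 + 1) choose 2) = (real q ^ 2 + 1) * real q ^ 2"
    using arg_cong[OF ch, of real] by (simp only: of_nat_mult of_nat_add of_nat_power of_nat_1 of_nat_numeral)
  have "real (card (carrier G)) = 1 + real (card fpf) + real (card E1) + real (card E2)" unfolding e by simp
  then have "(real q - 1) * ((real q ^ 2 + 1) * real q ^ 2) = 1 + real (card fpf)
      + ((real q - 1) * (real q ^ 2 + 1) + (real q * (real q - 1)) * (real q ^ 2 + 1))
      + (real q - 2) * real ((q\<^sup>2 + 1) choose 2)"
    unfolding card_carrier card_E1 card_E2
    by (simp only: r1 r2 r3 of_nat_mult of_nat_add of_nat_power of_nat_1)
  then have "2 * ((real q - 1) * ((real q ^ 2 + 1) * real q ^ 2)) = 2 + 2 * real (card fpf)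
      + 2 * ((real q - 1) * (real q ^ 2 + 1) + (real q * (real q - 1)) * (real q ^ 2 + 1))
      + (real q - 2) * ((real q ^ 2 + 1) * real q ^ 2)"
    unfolding r4[symmetric] by (simp add: algebra_simps)
  then show ?thesis by (simp add: algebra_simps power2_eq_square power3_eq_cube power4_eq_xxxx)
qed

section \<open>Conjugacy classes of tori\<close>

definition tori :: "'a set set" where "tori = C ` fpf"
definition orb :: "'a set \<Rightarrow> 'a set set" where "orb t = (\<lambda>g. cj g ` t) ` carrier G"

lemma toriE:
  assumes "t \<in> tori" obtains x where "x \<in> fpf" "t = C x"
  using assms by (auto simp: tori_def)

lemma fin_C: "finite (C x)" using finite_subset[OF C_sub fin] .

lemma tori_sub: "t \<in> tori \<Longrightarrow> t \<subseteq> carrier G"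
  using C_sub by (auto simp: tori_def)

lemma orb_tori: "t \<in> tori \<Longrightarrow> orb t \<subseteq> tori"
proof
  fix s assume t: "t \<in> tori" and s: "s \<in> orb t"
  obtain x where x: "x \<in> fpf" "t = C x" by (rule toriE[OF t])
  obtain g where g: "g \<in> carrier G" "s = cj g ` t" using s by (auto simp: orb_def)
  have "s = C (cj g x)" using C_conj[OF g(1) fpfD(1)[OF x(1)]] g x by simp
  then show "s \<in> tori" using conj_fpf[OF g(1) x(1)] by (simp add: tori_def)
qed

lemma orb_self: "t \<in> tori \<Longrightarrow> t \<in> orb t"
proof -
  assume t: "t \<in> tori"
  have "cj \<one> ` t = t" using tori_sub[OF t] by (simp add: subset_iff)
  then show ?thesis unfolding orb_def by (metis image_eqI one_closed)
qed

lemma orb_sub: "t \<in> tori \<Longrightarrow> s \<in> orb t \<Longrightarrow> orb s \<subseteq> orb t"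
proof
  fix u assume t: "t \<in> tori" and s: "s \<in> orb t" and u: "u \<in> orb s"
  obtain g where g: "g \<in> carrier G" "s = cj g ` t" using s by (auto simp: orb_def)
  obtain h where h: "h \<in> carrier G" "u = cj h ` s" using u by (auto simp: orb_def)
  have "u = cj (h \<otimes> g) ` t" using g h cj_image_comp[OF h(1) g(1) tori_sub[OF t]] by simp
  then show "u \<in> orb t" using g(1) h(1) by (auto simp: orb_def)
qed

lemma orb_sym: "t \<in> tori \<Longrightarrow> s \<in> orb t \<Longrightarrow> t \<in> orb s"
proof -
  assume t: "t \<in> tori" and s: "s \<in> orb t"
  obtain g where g: "g \<in> carrier G" "s = cj g ` t" using s by (auto simp: orb_def)
  have "cj (inv g) ` s = cj (inv g \<otimes> g) ` t" unfolding g(2) using g(1) by (intro cj_image_comp tori_sub[OF t]) auto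
  also have "\<dots> = t" using g(1) tori_sub[OF t] by (simp add: subset_iff)
  finally show "t \<in> orb s" using g(1) by (auto simp: orb_def)
qed

lemma orb_eq: "t \<in> tori \<Longrightarrow> s \<in> orb t \<Longrightarrow> orb s = orb t"
  using orb_sub orb_sym orb_tori by (intro antisym) blast+

lemma card_orb_mem: "t \<in> tori \<Longrightarrow> s \<in> orb t \<Longrightarrow> card s = card t"
proof -
  assume t: "t \<in> tori" and s: "s \<in> orb t"
  obtain g where g: "g \<in> carrier G" "s = cj g ` t" using s by (auto simp: orb_def)
  have "inj_on (cj g) t"
  proof (rule inj_onI)
    fix x y assume xy: "x \<in> t" "y \<in> t" "cj g x = cj g y"
    have "x \<in> carrier G" "y \<in> carrier G" using xy(1,2) tori_sub[OF t] by auto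
    then show "x = y" using xy(3) cj_inj[OF g(1)] by blast
  qed
  then show ?thesis using g(2) by (simp add: card_image)
qed

lemma conj_fibre:
  assumes x: "x \<in> fpf" and h: "h \<in> carrier G"
  shows "{g \<in> carrier G. cj g ` C x = cj h ` C x} = (\<lambda>a. h \<otimes> a) ` nrm x"
proof (rule antisym; rule subsetI)
  fix g assume "g \<in> {g \<in> carrier G. cj g ` C x = cj h ` C x}"
  then have g: "g \<in> carrier G" "cj g ` C x = cj h ` C x" by auto
  have "cj (inv h \<otimes> g) ` C x = cj (inv h) ` cj h ` C x"
    using cj_image_comp[of "inv h" g "C x"] g h C_sub by simp
  also have "\<dots> = C x" using cj_image_comp[of "inv h" h "C x"] h C_sub[of x] by (simp add: subset_iff)
  finally have "inv h \<otimes> g \<in> nrm x" using g(1) h nrm_iff[OF x] by simp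
  moreover have "g = h \<otimes> (inv h \<otimes> g)" using g(1) h by (simp flip: m_assoc)
  ultimately show "g \<in> (\<lambda>a. h \<otimes> a) ` nrm x" by (rule rev_image_eqI)
next
  fix g assume "g \<in> (\<lambda>a. h \<otimes> a) ` nrm x"
  then obtain a where a: "a \<in> carrier G" "cj a ` C x = C x" "g = h \<otimes> a" using nrm_iff[OF x] by auto
  have "cj g ` C x = cj h ` cj a ` C x" using cj_image_comp[OF h a(1) C_sub] a(3) by simp
  then show "g \<in> {g \<in> carrier G. cj g ` C x = cj h ` C x}" using a h by simp
qed

lemma card_orb: "x \<in> fpf \<Longrightarrow> card (orb (C x)) * card (nrm x) = card (carrier G)"
proof -
  assume x: "x \<in> fpf"
  have "card (carrier G) = card (nrm x) * card ((\<lambda>g. cj g ` C x) ` carrier G)"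
  proof (rule card_eq_fibres[OF fin])
    fix y assume "y \<in> (\<lambda>g. cj g ` C x) ` carrier G"
    then obtain h where h: "h \<in> carrier G" "y = cj h ` C x" by blast
    show "card {g \<in> carrier G. cj g ` C x = y} = card (nrm x)"
      unfolding h(2) conj_fibre[OF x h(1)]
      by (rule card_left_translate[OF h(1) subgroup.subset[OF nrm_subgroup[OF x]]])
  qed
  then show ?thesis by (simp add: orb_def mult.commute)
qed

text \<open>Excludes index 3 for a torus in its normalizer. The factors q - 1, q^2 + 1 and q^2 are
  1, 2 and 1 modulo 3.\<close>

lemma card_mod3: "\<not> 3 dvd card (carrier G)"
proof -
  have *: "a * b mod 3 = 2" if "a mod 3 = 1 \<and> b mod 3 = 2 \<or> a mod 3 = 2 \<and> b mod 3 = 1" for a b :: nat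
    using that mod_mult_eq[of a 3 b] by auto
  have q3: "q\<^sup>2 mod 3 = 1" using power_mod[of q 3 2] q_mod3 by simp
  have "\<exists>j. q = 3 * j + 2" using q_mod3 by presburger
  then obtain j where "q = 3 * j + 2" by blast
  then have "q - 1 = 1 + 3 * j" by simp
  then have a: "(q - 1) mod 3 = 1" by (simp only: mod_mult_self2) simp
  have b: "(q\<^sup>2 + 1) mod 3 = 2" using q3 by (simp add: mod_Suc)
  have "(q - 1) * ((q\<^sup>2 + 1) * q\<^sup>2) mod 3 = 2"
    by (rule *, rule disjI1, rule conjI[OF a], rule *, rule disjI2, rule conjI[OF b q3])
  then have "card (carrier G) mod 3 = 2" by (simp only: card_carrier)
  then show ?thesis by (simp add: dvd_eq_mod_eq_0)
qed

text \<open>The index is the number of conjugates of \<open>x\<close> under its torus normalizer,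
  because the stabilizer of \<open>x\<close> there is \<open>C x\<close>. These conjugates lie in
  \<open>C x\<close>, so there are at most four, and three would make the group order divisible by
  3.\<close>

lemma card_nrm:
  assumes x: "x \<in> fpf" obtains m where "card (nrm x) = card (C x) * m" "m \<in> {1, 2, 4}"
proof -
  have xG: "x \<in> carrier G" by (rule fpfD(1)[OF x])
  have nG: "nrm x \<subseteq> carrier G" by (rule subgroup.subset[OF nrm_subgroup[OF x]])
  have finN: "finite (nrm x)" by (rule finite_subset[OF nG fin])
  let ?I = "(\<lambda>g. cj g x) ` nrm x"
  have c: "card (nrm x) = card (C x) * card ?I"
  proof (rule card_eq_fibres[OF finN])
    fix y assume "y \<in> ?I"
    then obtain h where h: "h \<in> nrm x" "y = cj h x" by blast
    have hG: "h \<in> carrier G" using h nG by auto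
    have "{g \<in> nrm x. cj g x = y} = (\<lambda>a. h \<otimes> a) ` C x"
    proof (rule antisym; rule subsetI)
      fix g assume "g \<in> {g \<in> nrm x. cj g x = y}"
      then have g: "g \<in> nrm x" "cj g x = cj h x" using h by auto
      have gG: "g \<in> carrier G" using g nG by auto
      have "cj (inv h \<otimes> g) x = cj (inv h) (cj h x)" using g(2) gG hG xG cj_comp[of "inv h" g x] by simp
      then have "cj (inv h \<otimes> g) x = x" using hG xG by simp
      then have "inv h \<otimes> g \<in> C x" using gG hG xG cj_eq_self[of "inv h \<otimes> g" x] by (simp add: cent_def)
      moreover have "g = h \<otimes> (inv h \<otimes> g)" using gG hG by (simp flip: m_assoc)
      ultimately show "g \<in> (\<lambda>a. h \<otimes> a) ` C x" by (rule rev_image_eqI)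
    next
      fix g assume "g \<in> (\<lambda>a. h \<otimes> a) ` C x"
      then obtain a where a: "a \<in> C x" "g = h \<otimes> a" by blast
      have aG: "a \<in> carrier G" by (rule C_in(1)[OF a(1)])
      have "cj a x = x" using a(1) aG xG cj_eq_self[of a x] by (simp add: cent_def)
      then have "cj g x = cj h x" using cj_comp[OF hG aG xG] a(2) by simp
      moreover have "g \<in> nrm x" unfolding a(2)
        using h(1) a(1) C_sub_nrm[OF x] by (intro subgroup.m_closed[OF nrm_subgroup[OF x]]) auto
      ultimately show "g \<in> {g \<in> nrm x. cj g x = y}" using h(2) by simp
    qed
    then show "card {g \<in> nrm x. cj g x = y} = card (C x)"
      using card_left_translate[OF hG C_sub] by simp
  qed
  have "card ?I \<le> card ({g \<otimes> x \<otimes> inv g | g. g \<in> carrier G} \<inter> C x)"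
  proof (rule card_mono)
    show "finite ({g \<otimes> x \<otimes> inv g | g. g \<in> carrier G} \<inter> C x)" using fin_C by simp
    show "?I \<subseteq> {g \<otimes> x \<otimes> inv g | g. g \<in> carrier G} \<inter> C x" by (auto simp: nrm_def cj_def)
  qed
  also have "\<dots> \<le> 4" by (rule lin_conj[OF xG not_one(1)[OF x] fpf_pow[OF x]])
  finally have le: "card ?I \<le> 4" .
  have "\<one> \<in> nrm x" by (rule subgroup.one_closed[OF nrm_subgroup[OF x]])
  then have "card ?I \<noteq> 0" using finN by auto
  moreover have "card ?I \<noteq> 3"
  proof
    assume "card ?I = 3"
    then have "3 dvd card (nrm x)" using c by simp
    then have "3 dvd card (carrier G)" using card_orb[OF x] by (metis dvd_mult)
    then show False using card_mod3 by blast
  qed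
  ultimately have "card ?I = 1 \<or> card ?I = 2 \<or> card ?I = 4" using le by linarith
  then show thesis using that c by blast
qed

text \<open>The order is at least 2 and coprime to 12, which excludes 2, 3 and 4. The bound 5 is the
  source of the factor 4/5 in the estimates below.\<close>

lemma card_C_ge5: "x \<in> fpf \<Longrightarrow> card (C x) \<ge> 5"
proof -
  assume x: "x \<in> fpf"
  have "{\<one>, x} \<subseteq> C x" using one_cent self_C fpfD[OF x] by simp
  then have "card {\<one>, x} \<le> card (C x)" by (intro card_mono fin_C)
  then have ge: "card (C x) \<ge> 2" using not_one(1)[OF x] by (simp add: card_insert_if split: if_splits)
  have cop: "coprime (card (C x)) 12" using card_C_dvd[OF x] q_arith(2) by (metis coprime_divisors dvd_refl)
  have "card (C x) \<noteq> 2" "card (C x) \<noteq> 3" "card (C x) \<noteq> 4"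
    using coprime_common_divisor[OF cop, of 2] coprime_common_divisor[OF cop, of 3] by auto
  then show ?thesis using ge by linarith
qed

lemma fpf_fibre: "t \<in> tori \<Longrightarrow> card {x \<in> fpf. C x = t} = card t - 1"
proof -
  assume t: "t \<in> tori"
  obtain z where z: "z \<in> fpf" "t = C z" by (rule toriE[OF t])
  have "{x \<in> fpf. C x = t} = t - {\<one>}"
  proof (rule antisym; rule subsetI)
    fix x assume "x \<in> {x \<in> fpf. C x = t}"
    then show "x \<in> t - {\<one>}" using self_C fpfD(1) not_one(1) by auto
  next
    fix x assume "x \<in> t - {\<one>}"
    then have "x \<in> C z" "x \<noteq> \<one>" using z by auto
    then show "x \<in> {x \<in> fpf. C x = t}" using C_fpf[OF z(1)] C_eq[OF z(1)] z(2) by simp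
  qed
  moreover have "\<one> \<in> t" using one_cent z fpfD by simp
  ultimately show ?thesis by (simp add: card_Diff_singleton)
qed

lemma fin_tori: "finite tori" using fin_parts by (simp add: tori_def)

lemma sum_orbits:
  fixes f :: "'a set \<Rightarrow> real"
  shows "(\<Sum>t\<in>tori. f t) = (\<Sum>Ob\<in>orb ` tori. \<Sum>t\<in>Ob. f t)"
proof -
  have "{t \<in> tori. orb t = Ob} = Ob" if Ob: "Ob \<in> orb ` tori" for Ob
  proof -
    obtain s where s: "s \<in> tori" "Ob = orb s" using Ob by blast
    show ?thesis
    proof (rule antisym; rule subsetI)
      fix t assume "t \<in> {t \<in> tori. orb t = Ob}" then show "t \<in> Ob" using orb_self by auto
    next
      fix t assume "t \<in> Ob"
      then show "t \<in> {t \<in> tori. orb t = Ob}" using orb_tori[OF s(1)] orb_eq[OF s(1)] s(2) by auto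
    qed
  qed
  then show ?thesis using sum.image_gen[OF fin_tori, of f orb] by simp
qed

lemma card_fpf_sum: "real (card fpf) = (\<Sum>Ob\<in>orb ` tori. \<Sum>t\<in>Ob. real (card t) - 1)"
proof -
  have "real (card fpf) = (\<Sum>x\<in>fpf. 1)" by simp
  also have "\<dots> = (\<Sum>t\<in>C ` fpf. \<Sum>x\<in>{x \<in> fpf. C x = t}. 1)" by (rule sum.image_gen[OF fin_parts(1)])
  also have "\<dots> = (\<Sum>t\<in>tori. real (card t) - 1)"
    unfolding tori_def[symmetric]
  proof (rule sum.cong[OF refl])
    fix t assume t: "t \<in> tori"
    obtain z where z: "z \<in> fpf" "t = C z" by (rule toriE[OF t])
    have "card t \<ge> 5" using card_C_ge5[OF z(1)] z(2) by simp
    then show "(\<Sum>x\<in>{x \<in> fpf. C x = t}. 1) = real (card t) - 1"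
      using fpf_fibre[OF t] by (simp add: of_nat_diff)
  qed
  finally show ?thesis by (simp only: sum_orbits)
qed

text \<open>Order and index are constant on a class of tori: conjugate tori have equally many
  elements, and the order of the normalizer is fixed by the size of the class.\<close>

lemma orbit_data:
  assumes "Ob \<in> orb ` tori"
  obtains n m where "card Ob * n * m = card (carrier G)" "n \<ge> 5" "m \<in> {1, 2, 4}"
    "(\<Sum>t\<in>Ob. real (card t) - 1) = real (card Ob) * (real n - 1)"
    "\<And>x. x \<in> fpf \<Longrightarrow> C x \<in> Ob \<Longrightarrow> card (nrm x) = card (C x) * m"
proof -
  obtain s where s: "s \<in> tori" "Ob = orb s" using assms by blast
  obtain z where z: "z \<in> fpf" "s = C z" by (rule toriE[OF s(1)])
  obtain m where m: "card (nrm z) = card (C z) * m" "m \<in> {1, 2, 4}" by (rule card_nrm[OF z(1)])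
  have c: "card Ob * card (nrm z) = card (carrier G)" using card_orb[OF z(1)] s z by simp
  have pos: "card (carrier G) > 0" using fin by (simp add: card_gt_0_iff) blast
  show thesis
  proof (rule that[of "card s" m])
    show "card Ob * card s * m = card (carrier G)" using c m(1) z(2) by simp
    show "5 \<le> card s" using card_C_ge5[OF z(1)] z(2) by simp
    have "(\<Sum>t\<in>Ob. real (card t) - 1) = (\<Sum>t\<in>Ob. real (card s) - 1)"
      using card_orb_mem[OF s(1)] s(2) by (intro sum.cong) auto
    then show "(\<Sum>t\<in>Ob. real (card t) - 1) = real (card Ob) * (real (card s) - 1)" by simp
    fix x assume x: "x \<in> fpf" "C x \<in> Ob"
    have "orb (C x) = Ob" using orb_eq[OF s(1)] x(2) s(2) by simp
    then have "card Ob * card (nrm x) = card (carrier G)" using card_orb[OF x(1)] by simp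
    then have "card (nrm x) = card (nrm z)" using c pos by (metis mult_cancel_left neq0_conv mult_is_0)
    moreover have "card (C x) = card (C z)" using card_orb_mem[OF s(1)] x(2) s(2) z(2) by simp
    ultimately show "card (nrm x) = card (C x) * m" using m(1) by simp
  qed (rule m(2))
qed

text \<open>A class of \<open>N\<close> tori of order \<open>n\<close> and index \<open>m\<close>
  covers N (n - 1) = (g / m)(1 - 1/n) nontrivial elements, and 1 - 1/n is at least 4/5.\<close>

lemma orbit_bound:
  fixes N n m g k :: real
  assumes "N * n * m = g" "n \<ge> 5" "0 \<le> N" "0 < m" "m \<le> k"
  shows "4 * g \<le> 5 * k * (N * (n - 1))"
proof -
  have k: "0 \<le> k" and nn: "0 \<le> N * (4 * n)" using assms by simp_all
  have "N * (4 * n) \<le> N * (5 * (n - 1))" using assms by (intro mult_left_mono) auto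
  then have "m * (N * (4 * n)) \<le> k * (N * (5 * (n - 1)))" by (rule mult_mono[OF assms(5) _ k nn])
  moreover have "m * (N * (4 * n)) = 4 * g" unfolding assms(1)[symmetric] by simp
  moreover have "k * (N * (5 * (n - 1))) = 5 * k * (N * (n - 1))" by (simp only: ac_simps)
  ultimately show ?thesis by (simp only:)
qed

text \<open>Let \<open>T\<close> run through representatives of the conjugacy classes of tori, with \<open>n\<close> elements and
  \<open>m\<close> the index of \<open>T\<close> in its normalizer. Each class contributes \<open>(1 - 1/n) / m\<close> times the group order
  to the fixed-point-free elements, at least one fifth of it, and the total is slightly below one half.
  Since \<open>m\<close> is 1, 2 or 4, there must be exactly two classes, both with \<open>m = 4\<close>.\<close>

lemma tori_count:
  "(\<forall>x\<in>fpf. card (nrm x) = card (C x) * 4) \<and> 2 * real (card tori) = real q ^ 4 - real q ^ 2"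
proof -
  let ?OO = "orb ` tori"
  define Q where "Q = real q"
  have Q8: "Q \<ge> 8" using q_ge by (simp add: Q_def)
  define g where "g = real (card (carrier G))"
  define X where "X = real (card fpf)"
  define c where "c Ob = (\<Sum>t\<in>Ob. real (card t) - 1)" for Ob :: "'a set set"
  have r1: "real (q - 1) = Q - 1" using q_ge by (simp add: of_nat_diff Q_def)
  have g: "g = (Q - 1) * ((Q\<^sup>2 + 1) * Q\<^sup>2)" unfolding g_def card_carrier
    by (simp only: of_nat_mult of_nat_add of_nat_power of_nat_1 r1) (simp add: Q_def)
  have X: "2 * X = Q ^ 3 * (Q - 1)\<^sup>2" using card_fpf by (simp add: X_def Q_def)
  have gpos: "g > 0" unfolding g using Q8 by (intro mult_pos_pos) (auto simp: add_nonneg_pos)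
  \<comment> \<open>The amount by which the fixed-point-free elements fall short of half the group,
    doubled; it turns out to be twice the number of tori.\<close>
  have e: "g - 2 * X = Q\<^sup>2 * (Q - 1) * (Q + 1)" unfolding g X
    by (simp add: algebra_simps power2_eq_square power3_eq_cube)
  have "Q\<^sup>2 * (Q - 1) * (Q + 1) > 0" using Q8 by (intro mult_pos_pos) auto
  then have Xg: "2 * X < g" using e by linarith
  have "Q ^ 3 * (Q - 1)\<^sup>2 > 0" using Q8 by (intro mult_pos_pos zero_less_power) auto
  then have Xpos: "X > 0" using X by linarith
  have finOO: "finite ?OO" using fin_tori by simp
  have XS: "X = (\<Sum>Ob\<in>?OO. c Ob)" unfolding X_def c_def by (rule card_fpf_sum)
  have TS: "real (card tori) = (\<Sum>Ob\<in>?OO. real (card Ob))"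
    using sum_orbits[of "\<lambda>_. 1"] by simp
  have data: "\<exists>n m. real (card Ob) * n * m = g \<and> n \<ge> 5 \<and> m \<in> {1, 2, 4} \<and> c Ob = real (card Ob) * (n - 1) \<and>
      (\<forall>x\<in>fpf. C x \<in> Ob \<longrightarrow> real (card (nrm x)) = real (card (C x)) * m)" if Ob: "Ob \<in> ?OO" for Ob
  proof -
    obtain n m where nm: "card Ob * n * m = card (carrier G)" "n \<ge> 5" "m \<in> {1, 2, 4}"
      "(\<Sum>t\<in>Ob. real (card t) - 1) = real (card Ob) * (real n - 1)"
      "\<And>x. x \<in> fpf \<Longrightarrow> C x \<in> Ob \<Longrightarrow> card (nrm x) = card (C x) * m"
      by (rule orbit_data[OF Ob]) (rule that, assumption+)
    have "real (card Ob) * real n * real m = g" unfolding g_def using nm(1) by (metis of_nat_mult)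
    moreover have "real m \<in> {1, 2, 4}" using nm(3) by auto
    moreover have "\<forall>x\<in>fpf. C x \<in> Ob \<longrightarrow> real (card (nrm x)) = real (card (C x)) * real m"
    proof (intro ballI impI)
      fix x assume "x \<in> fpf" "C x \<in> Ob"
      then have "card (nrm x) = card (C x) * m" by (rule nm(5))
      then show "real (card (nrm x)) = real (card (C x)) * real m" by simp
    qed
    moreover have "real n \<ge> 5" using nm(2) by simp
    moreover have "c Ob = real (card Ob) * (real n - 1)" using nm(4) by (simp only: c_def)
    ultimately show ?thesis by (intro exI[of _ "real n"] exI[of _ "real m"] conjI)
  qed
  have low: "g \<le> 5 * c Ob" if Ob: "Ob \<in> ?OO" for Ob
  proof -
    obtain n m where nm: "real (card Ob) * n * m = g" "n \<ge> 5" "m \<in> {1, 2, 4}" "c Ob = real (card Ob) * (n - 1)"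
      using data[OF Ob] by (elim exE conjE) (rule that, assumption+)
    have "4 * g \<le> 5 * 4 * (real (card Ob) * (n - 1))" by (rule orbit_bound[OF nm(1,2)]) (use nm(3) in auto)
    then have "4 * g \<le> 5 * 4 * c Ob" by (simp only: nm(4))
    then show ?thesis by simp
  qed
  have "(\<Sum>Ob\<in>?OO. g) \<le> (\<Sum>Ob\<in>?OO. 5 * c Ob)" by (rule sum_mono) (rule low)
  \<comment> \<open>Each class supplies at least a fifth of the group and the total stays below one
    half, so three classes are impossible.\<close>
  then have "real (card ?OO) * g \<le> 5 * X" using XS by (simp add: sum_distrib_left)
  then have "real (card ?OO) * g < 3 * g" using Xg gpos by linarith
  then have le2: "card ?OO \<le> 2" using gpos by simp
  have "card ?OO \<noteq> 0" using XS Xpos finOO by auto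
  moreover have "card ?OO \<noteq> 1"
  proof
    assume "card ?OO = 1"
    then obtain Ob where Ob: "?OO = {Ob}" by (rule card_1_singletonE)
    then have mem: "Ob \<in> ?OO" by simp
    obtain n m where nm: "real (card Ob) * n * m = g" "n \<ge> 5" "m \<in> {1, 2, 4}" "c Ob = real (card Ob) * (n - 1)"
      and o: "\<forall>x\<in>fpf. C x \<in> Ob \<longrightarrow> real (card (nrm x)) = real (card (C x)) * m"
      using data[OF mem] by (elim exE conjE) (rule that, assumption+)
    have XN: "X = real (card Ob) * (n - 1)" using XS Ob nm(4) by simp
    have "2 * X * (n * m) = 2 * (real (card Ob) * n * m) * (n - 1)" unfolding XN by (simp only: ac_simps)
    then have "2 * X * (n * m) = 2 * g * (n - 1)" by (simp only: nm(1))
    then have "(Q\<^sup>2 * (Q - 1)) * (Q * (Q - 1) * n * m) = (Q\<^sup>2 * (Q - 1)) * (2 * (Q\<^sup>2 + 1) * (n - 1))"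
      unfolding X g by (simp add: algebra_simps power2_eq_square power3_eq_cube)
    moreover have ne: "Q\<^sup>2 * (Q - 1) \<noteq> 0" using Q8 by simp
    ultimately have eq: "Q * (Q - 1) * n * m = 2 * (Q\<^sup>2 + 1) * (n - 1)"
      by (simp only: mult_left_cancel[OF ne])
    have QQ: "Q * Q \<ge> 8 * Q" by (rule mult_right_mono) (use Q8 in simp_all)
    have QQ1: "Q * (Q - 1) = Q * Q - Q" by (simp add: right_diff_distrib)
    have lin1: False if "8 / 5 * (s + 1) \<le> s - Q" "8 \<le> Q" "8 * Q \<le> s" for s :: real using that by argo
    have lin2: False if "4 * (s - Q) \<le> 2 * (s + 1)" "8 \<le> Q" "8 * Q \<le> s" for s :: real using that by argo
    \<comment> \<open>With a single class, \<open>eq\<close> fails for each index. For 1 the right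
      side is too large because n - 1 is at least 4n/5; for 4 the left side is too large; for 2 it
      reduces to (q + 1) n = q^2 + 1, against divisibility.\<close>
    have "m = 1 \<or> m = 2 \<or> m = 4" using nm(3) by simp
    then show False
    proof (elim disjE)
      assume 1: "m = 1"
      have "2 * (Q\<^sup>2 + 1) * (4 * n / 5) \<le> 2 * (Q\<^sup>2 + 1) * (n - 1)"
        using nm(2) by (intro mult_left_mono) auto
      also have "\<dots> = Q * (Q - 1) * n" using eq unfolding 1 by (simp only: mult_1_right)
      finally have "(8 / 5 * (Q\<^sup>2 + 1)) * n \<le> (Q * (Q - 1)) * n" by (simp add: field_simps)
      then have "8 / 5 * (Q\<^sup>2 + 1) \<le> Q * (Q - 1)" by (rule mult_right_le_imp_le) (use nm(2) in simp)
      then show False using lin1[of "Q * Q"] Q8 QQ unfolding power2_eq_square QQ1 by blast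
    next
      assume 2: "m = 2"
      have "Q * (Q - 1) * n = (Q\<^sup>2 + 1) * (n - 1)" using eq unfolding 2 by linarith
      then have "(Q * Q - Q) * n = (Q * Q + 1) * (n - 1)" by (simp only: power2_eq_square QQ1)
      then have "(Q + 1) * n = Q\<^sup>2 + 1" by (simp add: algebra_simps power2_eq_square)
      \<comment> \<open>Up to here \<open>n\<close> is only a real number. The divisibility argument
        needs an integer, recovered as the order of an actual torus in the class.\<close>
      moreover obtain n' where "n = real n'"
      proof -
        have "tori \<noteq> {}" using Ob by auto
        then obtain x where x: "x \<in> fpf" "C x \<in> tori" by (auto simp: tori_def)
        then have xo: "orb (C x) = Ob" using Ob by blast
        have "C x \<in> Ob" using orb_self[OF x(2)] xo by simp
        then have "real (card (nrm x)) = real (card (C x) * 2)" using o x(1) 2 by simp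
        then have "card (nrm x) = card (C x) * 2" by (simp only: of_nat_eq_iff)
        then have "card Ob * (card (C x) * 2) = card (carrier G)" using card_orb[OF x(1)] xo by simp
        then have "real (card Ob * (card (C x) * 2)) = g" unfolding g_def by (simp only:)
        then have "real (card Ob) * real (card (C x)) * 2 = g" by simp
        then have "real (card Ob) * real (card (C x)) = real (card Ob) * n"
          using nm(1) unfolding 2 by argo
        moreover have "real (card Ob) \<noteq> 0"
        proof
          assume "real (card Ob) = 0"
          then show False using nm(1) gpos by simp
        qed
        ultimately have "n = real (card (C x))" by simp
        then show ?thesis by (rule that)
      qed
      ultimately have "real ((q + 1) * n') = real (q\<^sup>2 + 1)"
        by (simp only: Q_def of_nat_mult of_nat_add of_nat_power of_nat_1)
      then have "(q + 1) * n' = q\<^sup>2 + 1" by (simp only: of_nat_eq_iff)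
      then have d: "q + 1 dvd q\<^sup>2 + 1" by (metis dvd_triv_left)
      obtain j where j: "q = Suc j" using q_ge by (cases q) auto
      have e: "q\<^sup>2 + 1 = (q + 1) * (q - 1) + 2" unfolding j by (simp add: power2_eq_square)
      have "q + 1 dvd 2" using d unfolding e by (simp only: dvd_add_right_iff dvd_triv_left)
      then show False using q_ge by (auto dest: dvd_imp_le)
    next
      assume 3: "m = 4"
      have "Q * (Q - 1) * n * 4 = 2 * (Q\<^sup>2 + 1) * (n - 1)" using eq unfolding 3 .
      also have "\<dots> \<le> 2 * (Q\<^sup>2 + 1) * n" by (intro mult_left_mono) auto
      finally have "(4 * (Q * (Q - 1))) * n \<le> (2 * (Q\<^sup>2 + 1)) * n" by linarith
      then have "4 * (Q * (Q - 1)) \<le> 2 * (Q\<^sup>2 + 1)" by (rule mult_right_le_imp_le) (use nm(2) in simp)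
      then show False using lin2[of "Q * Q"] Q8 QQ unfolding power2_eq_square QQ1 by blast
    qed
  qed
  ultimately have "card ?OO = 2" using le2 by arith
  then obtain A B where AB: "?OO = {A, B}" "A \<noteq> B" by (auto simp: card_2_iff)
  have XAB: "X = c A + c B" using XS AB by simp
  have four: "4 * c Ob = g - 4 * real (card Ob) \<and> (\<forall>x\<in>fpf. C x \<in> Ob \<longrightarrow> card (nrm x) = card (C x) * 4)"
    if Ob: "Ob \<in> ?OO" for Ob
  proof -
    obtain n m where nm: "real (card Ob) * n * m = g" "n \<ge> 5" "m \<in> {1, 2, 4}" "c Ob = real (card Ob) * (n - 1)"
      and o: "\<forall>x\<in>fpf. C x \<in> Ob \<longrightarrow> real (card (nrm x)) = real (card (C x)) * m"
      using data[OF Ob] by (elim exE conjE) (rule that, assumption+)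
    \<comment> \<open>With index 1 or 2 this class would supply at least 2/5 of the group and the
      other one at least 1/5, together more than one half.\<close>
    have "m = 4"
    proof (rule ccontr)
      assume "m \<noteq> 4"
      have "4 * g \<le> 5 * 2 * (real (card Ob) * (n - 1))"
        by (rule orbit_bound[OF nm(1,2)]) (use nm(3) \<open>m \<noteq> 4\<close> in auto)
      then have "4 * g \<le> 5 * 2 * c Ob" by (simp only: nm(4))
      then have "2 * g \<le> 5 * c Ob" by simp
      moreover have "g \<le> 5 * c A" "g \<le> 5 * c B" using low AB by auto
      moreover have "Ob = A \<or> Ob = B" using Ob AB by auto
      ultimately have "3 * g \<le> 5 * X" using XAB by auto
      then show False using Xg gpos by linarith
    qed
    have "\<forall>x\<in>fpf. C x \<in> Ob \<longrightarrow> card (nrm x) = card (C x) * 4"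
    proof (intro ballI impI)
      fix x assume "x \<in> fpf" "C x \<in> Ob"
      then have "real (card (nrm x)) = real (card (C x) * 4)" using o \<open>m = 4\<close> by simp
      then show "card (nrm x) = card (C x) * 4" by (simp only: of_nat_eq_iff)
    qed
    moreover have "4 * c Ob = g - 4 * real (card Ob)" using nm(1,4) \<open>m = 4\<close> by (simp add: algebra_simps)
    ultimately show ?thesis by blast
  qed
  have "card (nrm x) = card (C x) * 4" if x: "x \<in> fpf" for x
  proof -
    have "C x \<in> tori" using x by (simp add: tori_def)
    then have "orb (C x) \<in> ?OO" "C x \<in> orb (C x)" using orb_self by auto
    then show ?thesis using four x by blast
  qed
  moreover have "real (card tori) = real (card A) + real (card B)" using TS AB by simp
  moreover have "4 * c A = g - 4 * real (card A)" "4 * c B = g - 4 * real (card B)" using four AB by auto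
  \<comment> \<open>Adding the relations for the two classes gives 4 X = 2 g - 4 |tori|, so 2 |tori|
    is the difference g - 2 X.\<close>
  ultimately show ?thesis using XAB e
    by (simp add: Q_def algebra_simps power2_eq_square power4_eq_xxxx)
qed

end

section \<open>Counting solvabilizers\<close>

text \<open>Both images enumerate the classes of one equivalence relation on \<open>A\<close>.
  Solvabilizers are counted in this way through fixed-point sets, tori and inverse pairs.\<close>

lemma card_image_eq:
  assumes "\<And>x y. x \<in> A \<Longrightarrow> y \<in> A \<Longrightarrow> f x = f y \<longleftrightarrow> g x = g y"
  shows "card (f ` A) = card (g ` A)"
proof -
  define h where "h u = g (SOME x. x \<in> A \<and> f x = u)" for u
  have h: "h (f x) = g x" if x: "x \<in> A" for x
  proof -
    have "\<exists>z. z \<in> A \<and> f z = f x" using x by blast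
    then have "(SOME z. z \<in> A \<and> f z = f x) \<in> A \<and> f (SOME z. z \<in> A \<and> f z = f x) = f x" by (rule someI_ex)
    then show ?thesis unfolding h_def using assms x by blast
  qed
  have "inj_on h (f ` A)"
  proof (rule inj_onI)
    fix u v assume uv: "u \<in> f ` A" "v \<in> f ` A" "h u = h v"
    obtain x where x: "x \<in> A" "u = f x" using uv(1) by (rule imageE)
    obtain y where y: "y \<in> A" "v = f y" using uv(2) by (rule imageE)
    show "u = v" using uv(3) h[OF x(1)] h[OF y(1)] assms[OF x(1) y(1)] x(2) y(2) by simp
  qed
  then have "card (f ` A) = card (h ` f ` A)" by (simp add: card_image)
  also have "h ` f ` A = g ` A" unfolding image_image by (rule image_cong[OF refl h])
  finally show ?thesis .
qed

section \<open>Torus normalizers and elements with one fixed point\<close>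

context suzuki_action
begin

lemma nrm_conj:
  assumes z: "z \<in> fpf" and w: "w \<in> nrm z" and g: "g \<in> carrier G"
  shows "cj g w \<in> nrm (cj g z)"
proof -
  have zG: "z \<in> carrier G" and wG: "w \<in> carrier G" using fpfD(1)[OF z] w by (auto simp: nrm_def)
  have "cj (cj g w) (cj g z) = cj g (cj w z)"
    using zG wG g by (simp add: cj_def m_assoc inv_mult_group) (simp flip: m_assoc)
  moreover have "cj w z \<in> C z" using w by (simp add: nrm_def)
  ultimately show ?thesis using C_conj[OF g zG] g wG by (simp add: nrm_def)
qed

text \<open>The product \<open>?y\<close> of \<open>z\<close> and its conjugate is centralized by
  \<open>g\<close>, as \<open>g\<close> exchanges the two commuting factors. Were it nontrivial, its
  centralizer would be \<open>C z\<close>, which does not contain \<open>g\<close>.\<close>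

lemma involution_inverts:
  assumes z: "z \<in> fpf" and g: "g \<in> nrm z" "g \<notin> C z" "g \<otimes> g = \<one>"
  shows "cj g z = inv z"
proof -
  have zG: "z \<in> carrier G" and gG: "g \<in> carrier G" and c: "cj g z \<in> C z"
    using fpfD(1)[OF z] g by (auto simp: nrm_def)
  let ?y = "z \<otimes> cj g z"
  have y: "?y \<in> C z" by (rule C_mult[OF zG self_C[OF zG] c])
  have "cj g ?y = cj g z \<otimes> cj g (cj g z)" by (rule cj_mult[OF gG zG]) (use gG zG in simp)
  also have "cj g (cj g z) = z" using cj_comp[OF gG gG zG] g(3) zG by simp
  also have "cj g z \<otimes> z = ?y" using C_comm[OF z c self_C[OF zG]] .
  finally have "g \<otimes> ?y = ?y \<otimes> g" using cj_eq_self[of g ?y] gG zG by simp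
  then have gy: "g \<in> C ?y" using gG by (simp add: cent_def)
  have "?y = \<one>"
  proof (rule ccontr)
    assume "?y \<noteq> \<one>"
    then have "C ?y = C z" by (rule C_eq[OF z y])
    then show False using gy g(2) by simp
  qed
  then show ?thesis using zG gG by (metis C_comm[OF z c self_C[OF zG]] cj_closed inv_equality)
qed

lemma E1_U: "x \<in> E1 \<Longrightarrow> \<exists>P. F x = {P} \<and> x \<in> U P"
  by (auto simp: E1_def uni_def card_1_singleton_iff)

lemma E1_inv: "x \<in> E1 \<Longrightarrow> inv x \<in> E1"
  by (simp add: E1_def F_inv)

text \<open>If every element of the normalizer outside \<open>C z\<close> were an involution, all of
  them would invert \<open>z\<close>. A product of two of them would centralize \<open>z\<close>,
  leaving only two cosets where the index is 4. An element outside \<open>C z\<close> that is not an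
  involution has exactly one fixed point, since the other cases are covered by
  \<open>fpf_nrm\<close> and \<open>T2_nrm\<close>.\<close>

lemma exists_order4_nrm: "\<exists>z\<in>fpf. \<exists>g\<in>E1. g \<in> nrm z \<and> g \<otimes> g \<noteq> \<one>"
proof -
  have "card fpf \<noteq> 0"
  proof
    assume "card fpf = 0"
    then have "real q ^ 3 * (real q - 1)\<^sup>2 = 0" using card_fpf by simp
    then show False using q_ge by simp
  qed
  then obtain z where z: "z \<in> fpf" by fastforce
  have zG: "z \<in> carrier G" by (rule fpfD(1)[OF z])
  have N: "card (nrm z) = card (C z) * 4" using tori_count z by blast
  have c5: "card (C z) \<ge> 5" by (rule card_C_ge5[OF z])
  have "\<exists>g. g \<in> nrm z \<and> g \<notin> C z \<and> g \<otimes> g \<noteq> \<one>"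
  proof (rule ccontr)
    assume "\<not> ?thesis"
    then have inv: "g \<otimes> g = \<one>" if "g \<in> nrm z" "g \<notin> C z" for g using that by blast
    have "\<not> nrm z \<subseteq> C z"
    proof
      assume "nrm z \<subseteq> C z"
      then have "card (nrm z) \<le> card (C z)" by (intro card_mono fin_C)
      then show False using N c5 by simp
    qed
    then obtain g where g: "g \<in> nrm z" "g \<notin> C z" by blast
    have gG: "g \<in> carrier G" using g by (simp add: nrm_def)
    let ?D = "C z \<union> (\<lambda>a. g \<otimes> a) ` C z"
    have "\<not> nrm z \<subseteq> ?D"
    proof
      assume "nrm z \<subseteq> ?D"
      then have "card (nrm z) \<le> card ?D" by (intro card_mono) (simp_all add: fin_C)
      also have "\<dots> \<le> card (C z) + card ((\<lambda>a. g \<otimes> a) ` C z)" by (rule card_Un_le)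
      also have "card ((\<lambda>a. g \<otimes> a) ` C z) = card (C z)" by (rule card_left_translate[OF gG C_sub])
      finally show False using N c5 by simp
    qed
    then obtain h where h: "h \<in> nrm z" "h \<notin> C z" "h \<notin> (\<lambda>a. g \<otimes> a) ` C z" by blast
    have hG: "h \<in> carrier G" using h by (simp add: nrm_def)
    have "g \<otimes> h \<notin> C z"
    proof
      assume gh: "g \<otimes> h \<in> C z"
      have "h = (g \<otimes> g) \<otimes> h" using inv[OF g] hG by simp
      then have "h = g \<otimes> (g \<otimes> h)" using gG hG by (simp add: m_assoc)
      then have "h \<in> (\<lambda>a. g \<otimes> a) ` C z" using gh by (rule image_eqI)
      then show False using h(3) by blast
    qed
    moreover have "g \<otimes> h \<in> C z"
    proof -
      have "cj (g \<otimes> h) z = cj g (cj h z)" by (rule cj_comp[OF gG hG zG, symmetric])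
      also have "\<dots> = cj g (inv z)" using involution_inverts[OF z h(1,2) inv[OF h(1,2)]] by simp
      also have "\<dots> = inv (cj g z)" by (rule cj_inv[OF gG zG])
      also have "\<dots> = z" using involution_inverts[OF z g inv[OF g]] zG by simp
      finally show ?thesis using cj_eq_self[of "g \<otimes> h" z] gG hG zG by (simp add: cent_def)
    qed
    ultimately show False by blast
  qed
  then obtain g where g: "g \<in> nrm z" "g \<notin> C z" "g \<otimes> g \<noteq> \<one>" by blast
  have gG: "g \<in> carrier G" using g by (simp add: nrm_def)
  have g1: "g \<noteq> \<one>" using g(3) by auto
  have "g \<in> E1"
  proof (cases rule: F_cases[OF gG g1])
    case 1
    then have "g \<in> fpf" using gG by (simp add: fpf_def)
    then show ?thesis using fpf_nrm[OF z g(1)] g(2) by blast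
  next
    case (2 P) then show ?thesis using gG by (simp add: E1_def)
  next
    case (3 P Q)
    have "P \<in> F g" "Q \<in> F g" using 3 by auto
    then have "g \<in> T2 P Q" using gG by (simp add: F_iff stab2_def)
    then have "g = \<one>" by (rule T2_nrm[OF z g(1) 3(1)])
    then show ?thesis using g1 by blast
  qed
  then show ?thesis using g z by blast
qed

lemma E1_conj_U: "x \<in> E1 \<Longrightarrow> y \<in> E1 \<Longrightarrow> \<exists>g\<in>carrier G. \<exists>P. cj g x \<in> U P \<and> y \<in> U P"
proof -
  assume x: "x \<in> E1" and y: "y \<in> E1"
  obtain P Q where P: "F x = {P}" and Q: "F y = {Q}" "y \<in> U Q" using E1_U[OF x] E1_U[OF y] by blast
  have xG: "x \<in> carrier G" using x by (simp add: E1_def)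
  have "\<exists>g\<in>carrier G. act g P = Q"
  proof (cases "P = Q")
    case True then show ?thesis using act_one by blast
  next
    case False then show ?thesis using trans2[OF False, of Q P] by blast
  qed
  then obtain g where g: "g \<in> carrier G" "act g P = Q" by blast
  have "F (cj g x) = {Q}" using F_conj[OF g(1) xG] P g(2) by simp
  then have "cj g x \<in> U Q" using g(1) xG by (simp add: uni_def)
  then show ?thesis using g(1) Q(2) by blast
qed

text \<open>A single example is carried to \<open>x\<close> by moving its fixed point to that of
  \<open>x\<close> and applying \<open>uni_conj\<close>. The ambiguity between \<open>x\<close> and
  its inverse is harmless because the normalizer is a subgroup.\<close>

lemma order4_nrm:
  assumes x: "x \<in> E1" "x \<otimes> x \<noteq> \<one>" shows "\<exists>z\<in>fpf. x \<in> nrm z"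
proof -
  obtain z g where z: "z \<in> fpf" and g: "g \<in> E1" "g \<in> nrm z" "g \<otimes> g \<noteq> \<one>"
    using exists_order4_nrm by blast
  have gG: "g \<in> carrier G" and xG: "x \<in> carrier G" using g x by (auto simp: E1_def)
  obtain h P where h: "h \<in> carrier G" "cj h g \<in> U P" "x \<in> U P" using E1_conj_U[OF g(1) x(1)] by blast
  have "cj h g \<otimes> cj h g \<noteq> \<one>" using cj_mult[OF h(1) gG gG] cj_eq_one[OF h(1), of "g \<otimes> g"] gG g(3) by simp
  then obtain k where k: "k \<in> carrier G" "k \<otimes> cj h g \<otimes> inv k = x \<or> k \<otimes> cj h g \<otimes> inv k = inv x"
    using uni_conj[OF h(2,3) _ x(2)] by blast
  let ?w = "cj k (cj h z)"
  have w: "?w \<in> fpf" by (intro conj_fpf k(1) h(1) z)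
  have "cj k (cj h g) \<in> nrm ?w" by (intro nrm_conj conj_fpf k(1) h(1) z g(2))
  moreover have "cj k (cj h g) = x \<or> cj k (cj h g) = inv x" using k(2) by (simp only: cj_def)
  ultimately have "x \<in> nrm ?w \<or> inv x \<in> nrm ?w" by auto
  then have "x \<in> nrm ?w"
    using subgroup.m_inv_closed[OF nrm_subgroup[OF w], of "inv x"] xG by auto
  then show ?thesis using w by blast
qed

text \<open>The fixed points of an element can be read off its solvabilizer: this separates the solvabilizers
  of elements of different types.\<close>

lemma F_determined:
  assumes x: "x \<in> carrier G"
  shows "F x = {Q. \<forall>R. R \<noteq> Q \<longrightarrow> T2 Q R - {\<one>} \<subseteq> Sol G x}"
proof (rule antisym; rule subsetI)
  fix Q assume Q: "Q \<in> F x"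
  have "y \<in> Sol G x" if y: "R \<noteq> Q" "y \<in> T2 Q R" "y \<noteq> \<one>" for R y
  proof -
    have yG: "y \<in> carrier G" using y by (simp add: stab2_def)
    have QR: "Q \<noteq> R" using y by simp
    have "x \<in> pstab Q" using x Q by (simp add: pstab_def F_iff)
    then have "x \<in> Sol G y" using Sol_split[OF yG QR T2_F[OF y(2,3) QR]] by blast
    then show ?thesis using Sol_sym[OF x yG] by blast
  qed
  then show "Q \<in> {Q. \<forall>R. R \<noteq> Q \<longrightarrow> T2 Q R - {\<one>} \<subseteq> Sol G x}" by blast
next
  fix Q assume Q: "Q \<in> {Q. \<forall>R. R \<noteq> Q \<longrightarrow> T2 Q R - {\<one>} \<subseteq> Sol G x}"
  show "Q \<in> F x"
  proof (rule ccontr)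
    assume n: "Q \<notin> F x"
    then have "x \<noteq> \<one>" by auto
    \<comment> \<open>The point \<open>R\<close> avoids at most four points. With these excluded,
      \<open>x\<close> fixes neither \<open>Q\<close> nor \<open>R\<close> and does not preserve
      \<open>{Q, R}\<close>, contradicting \<open>Sol_split\<close> for an element fixing
      \<open>Q\<close> and \<open>R\<close>.\<close>
    let ?B = "F x \<union> {Q, act x Q}"
    have "card ?B \<le> card (F x) + card {Q, act x Q}" by (rule card_Un_le)
    also have "\<dots> \<le> 2 + 2" using fix3[OF x \<open>x \<noteq> \<one>\<close>] by (intro add_mono) (simp_all add: card_insert_if)
    finally have "card ?B < card (UNIV :: 'p set)" using card_points_big by simp
    then have "?B \<noteq> UNIV" by auto
    then obtain R where R: "R \<notin> F x" "R \<noteq> Q" "R \<noteq> act x Q" by blast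
    have QR: "Q \<noteq> R" using R by simp
    obtain y where y: "y \<in> T2 Q R" "y \<noteq> \<one>" by (rule T2_ex[OF QR])
    have yG: "y \<in> carrier G" using y by (simp add: stab2_def)
    have "y \<in> Sol G x" using Q R(2) y by blast
    then have "x \<in> Sol G y" using Sol_sym[OF x yG] by blast
    then have "x \<in> pstab Q \<or> x \<in> pstab R \<or> x \<in> sstab Q R" using Sol_split[OF yG QR T2_F[OF y QR]] by blast
    moreover have "x \<notin> pstab Q" "x \<notin> pstab R" using n R(1) by (auto simp: pstab_def F_iff)
    moreover have "x \<notin> sstab Q R" using n R(3) by (auto simp: sstab_def F_iff doubleton_eq_iff)
    ultimately show False by blast
  qed
qed

lemma Sol_eq_F: "x \<in> carrier G \<Longrightarrow> y \<in> carrier G \<Longrightarrow> Sol G x = Sol G y \<Longrightarrow> F x = F y"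
  by (simp add: F_determined)

lemma Sol_inv: "x \<in> carrier G \<Longrightarrow> Sol G (inv x) = Sol G x"
proof -
  have *: "Sol G x \<subseteq> Sol G (inv x)" if x: "x \<in> carrier G" for x
  proof
    fix y assume y: "y \<in> Sol G x"
    then have yG: "y \<in> carrier G" using Sol_sub by blast
    have s: "solvable_seq G (generate G {x, y})" using y Sol_iff[OF x yG] by blast
    have "inv x \<in> generate G {x, y}" "y \<in> generate G {x, y}" by (auto intro: generate.intros)
    then show "y \<in> Sol G (inv x)" by (rule Sol_I[OF s])
  qed
  assume x: "x \<in> carrier G"
  then show ?thesis using *[OF x] *[of "inv x"] by auto
qed

text \<open>The involution \<open>x\<close> interchanges \<open>Q\<close> and
  \<open>act x Q\<close>, so its solvabilizer contains the elements fixing these two points.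
  Equality of solvabilizers makes \<open>y\<close> preserve the pair as well; it fixes neither
  point, so \<open>y\<close> sends \<open>Q\<close> where \<open>x\<close> does. The quotient of
  \<open>x\<close> and \<open>y\<close> lies in \<open>U P\<close> and fixes \<open>Q\<close>, hence
  is trivial.\<close>

lemma invol_determined:
  assumes x: "x \<in> E1" "x \<otimes> x = \<one>" and y: "y \<in> E1" and S: "Sol G x = Sol G y"
  shows "x = y"
proof -
  have xG: "x \<in> carrier G" and yG: "y \<in> carrier G" using x y by (auto simp: E1_def)
  obtain P where P: "F x = {P}" "x \<in> U P" using E1_U[OF x(1)] by blast
  have Fy: "F y = {P}" using Sol_eq_F[OF xG yG S] P(1) by simp
  then have yU: "y \<in> U P" using yG by (simp add: uni_def)
  have "\<exists>Q. Q \<noteq> P"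
  proof (rule ccontr)
    assume "\<not> ?thesis"
    then have "(UNIV :: 'p set) = {P}" by auto
    then have "card (UNIV :: 'p set) = card {P}" by (rule arg_cong)
    then show False using card_points_big by simp
  qed
  then obtain Q where Q: "Q \<noteq> P" by blast
  let ?R = "act x Q"
  have xP: "act x P = P" using P(1) F_iff by blast
  have xR: "act x ?R = Q" using act_mult[OF xG xG, of Q] x(2) act_one by simp
  have QR: "Q \<noteq> ?R" using P(1) Q F_iff[of Q x] by auto
  have RP: "?R \<noteq> P" using act_inj[OF xG, of Q P] xP Q by auto
  obtain z where z: "z \<in> T2 Q ?R" "z \<noteq> \<one>" by (rule T2_ex[OF QR])
  have zG: "z \<in> carrier G" using z by (simp add: stab2_def)
  have SZ: "Sol G z = pstab Q \<union> pstab ?R \<union> sstab Q ?R" by (rule Sol_split[OF zG QR T2_F[OF z QR]])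
  have "x \<in> sstab Q ?R" using xG xR by (auto simp: sstab_def)
  then have "x \<in> Sol G z" using SZ by blast
  then have "z \<in> Sol G y" using Sol_sym[OF xG zG] S by blast
  then have "y \<in> Sol G z" using Sol_sym[OF yG zG] by blast
  moreover have "y \<notin> pstab Q" "y \<notin> pstab ?R" using Fy Q RP F_iff[of _ y] by (auto simp: pstab_def)
  ultimately have "y \<in> sstab Q ?R" "act y Q \<noteq> Q" using SZ yG by (auto simp: pstab_def)
  then have yQ: "act y Q = ?R" by (auto simp: sstab_def doubleton_eq_iff)
  let ?w = "inv x \<otimes> y"
  have w: "?w \<in> U P" by (rule uni_mult) (use P(2) yU subgroup.m_inv_closed[OF U_subgroup] in auto)
  have "act ?w Q = Q" using xG yG yQ by (simp add: act_mult)
  then have "Q \<in> F ?w" by (simp add: F_iff)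
  then have "F ?w \<noteq> {P}" using Q by auto
  then have "?w = \<one>" using w by (simp add: uni_def)
  then show ?thesis using xG yG by (metis inv_equality inv_inv inv_closed)
qed

text \<open>Both elements normalize a common torus \<open>C z\<close>. Quotients of elements of
  \<open>U P\<close> lie in \<open>U P\<close>, so nontrivial ones have a fixed point and are not in
  the torus: distinct elements of \<open>?S\<close> represent distinct cosets. If \<open>y\<close>
  were neither \<open>x\<close> nor its inverse, \<open>?S\<close> would have five elements.\<close>

lemma order4_determined:
  assumes x: "x \<in> E1" "x \<otimes> x \<noteq> \<one>" and y: "y \<in> E1" "y \<otimes> y \<noteq> \<one>" and S: "Sol G x = Sol G y"
  shows "y = x \<or> y = inv x"
proof (rule ccontr)
  assume n: "\<not> ?thesis"
  have xG: "x \<in> carrier G" and yG: "y \<in> carrier G" using x y by (auto simp: E1_def)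
  obtain P where P: "F x = {P}" "x \<in> U P" using E1_U[OF x(1)] by blast
  have Fy: "F y = {P}" using Sol_eq_F[OF xG yG S] P(1) by simp
  then have yU: "y \<in> U P" using yG by (simp add: uni_def)
  obtain z where z: "z \<in> fpf" "x \<in> nrm z" using order4_nrm[OF x] by blast
  have zG: "z \<in> carrier G" by (rule fpfD(1)[OF z(1)])
  have "x \<in> Sol G z" using Sol_fpf[OF z(1)] z(2) by simp
  then have "z \<in> Sol G y" using Sol_sym[OF xG zG] S by blast
  then have "y \<in> Sol G z" using Sol_sym[OF yG zG] by blast
  then have yn: "y \<in> nrm z" using Sol_fpf[OF z(1)] by simp
  let ?S = "{\<one>, x, x \<otimes> x, inv x, y}"
  have Ui: "inv w \<in> U P" if "w \<in> U P" for w by (rule subgroup.m_inv_closed[OF U_subgroup that])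
  have SU: "?S \<subseteq> U P" using P(2) yU Ui[OF P(2)] uni_mult[OF P(2) P(2)] one_U by blast
  note N = nrm_subgroup[OF z(1)]
  have SN: "?S \<subseteq> nrm z"
    using z(2) yn subgroup.m_closed[OF N z(2) z(2)] subgroup.m_inv_closed[OF N z(2)] subgroup.one_closed[OF N]
    by blast
  have "card ?S \<le> 4"
  proof (rule coset4[OF z(1) SN])
    fix g h assume gh: "g \<in> ?S" "h \<in> ?S" "inv h \<otimes> g \<in> C z"
    have ghU: "g \<in> U P" "h \<in> U P" using gh(1,2) SU by blast+
    then have G: "g \<in> carrier G" "h \<in> carrier G" by (simp_all add: uni_def)
    have w: "inv h \<otimes> g \<in> U P" by (rule uni_mult[OF Ui[OF ghU(2)] ghU(1)])
    have "inv h \<otimes> g = \<one>"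
    proof (rule ccontr)
      assume w1: "inv h \<otimes> g \<noteq> \<one>"
      have "F (inv h \<otimes> g) = {}" by (rule fpfD(2)[OF C_fpf[OF z(1) gh(3) w1]])
      moreover have "F (inv h \<otimes> g) = {P}" using w w1 by (simp add: uni_def)
      ultimately show False by (metis insert_not_empty)
    qed
    moreover have "h \<otimes> (inv h \<otimes> g) = (h \<otimes> inv h) \<otimes> g" using G by (simp only: m_assoc inv_closed)
    ultimately have "h \<otimes> \<one> = \<one> \<otimes> g" using G by (simp only: r_inv)
    then show "g = h" using G by simp
  qed
  moreover have "card ?S = 5"
  proof -
    have x4: "(x \<otimes> x) \<otimes> (x \<otimes> x) = \<one>" by (rule uni_pow4[OF P(2)])
    have "x \<noteq> \<one>" "y \<noteq> \<one>" using x(2) y(2) by auto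
    moreover have "x \<noteq> inv x"
    proof
      assume "x = inv x"
      then have "x \<otimes> x = \<one>" using r_inv[OF xG] by simp
      then show False using x(2) by blast
    qed
    moreover have "x \<otimes> x \<noteq> x" using xG \<open>x \<noteq> \<one>\<close> by (simp add: l_cancel_one)
    moreover have "x \<otimes> x \<noteq> inv x"
    proof
      assume e: "x \<otimes> x = inv x"
      have "x = (x \<otimes> x) \<otimes> (x \<otimes> x)"
      proof -
        have "inv x = inv (inv (x \<otimes> x))" unfolding e using xG by simp
        then have "inv x \<otimes> inv x = x" using e xG inv_mult_group[OF xG xG] by simp
        then show ?thesis unfolding e by simp
      qed
      then show False using x4 \<open>x \<noteq> \<one>\<close> by simp
    qed
    moreover have "y \<noteq> x \<otimes> x" using x4 y(2) by auto
    moreover have "inv x \<noteq> \<one>" using \<open>x \<noteq> \<one>\<close> xG by simp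
    ultimately show ?thesis using n x(2) by auto
  qed
  ultimately show False by simp
qed

lemma Sol_E1_eq: "x \<in> E1 \<Longrightarrow> y \<in> E1 \<Longrightarrow> Sol G x = Sol G y \<longleftrightarrow> {x, inv x} = {y, inv y}"
proof
  assume x: "x \<in> E1" and y: "y \<in> E1" and S: "Sol G x = Sol G y"
  have xG: "x \<in> carrier G" and yG: "y \<in> carrier G" using x y by (auto simp: E1_def)
  consider "x \<otimes> x = \<one>" | "y \<otimes> y = \<one>" | "x \<otimes> x \<noteq> \<one>" "y \<otimes> y \<noteq> \<one>" by blast
  then show "{x, inv x} = {y, inv y}"
  proof cases
    case 1 then show ?thesis using invol_determined[OF x 1 y S] by simp
  next
    case 2 then show ?thesis using invol_determined[OF y 2 x S[symmetric]] by simp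
  next
    case 3
    then have "y = x \<or> y = inv x" using order4_determined[OF x 3(1) y 3(2) S] by blast
    then show ?thesis using xG by (auto simp: insert_commute)
  qed
next
  assume x: "x \<in> E1" and y: "y \<in> E1" and e: "{x, inv x} = {y, inv y}"
  have yG: "y \<in> carrier G" using y by (simp add: E1_def)
  have "x = y \<or> x = inv y" using e by blast
  then show "Sol G x = Sol G y" using Sol_inv[OF yG] by auto
qed

text \<open>Passing to the pairs \<open>{x, inv x}\<close> keeps involutions apart and identifies
  elements of order four two by two.\<close>

lemma card_Sol_E1: "2 * card (Sol G ` E1) = 2 * ((q - 1) * (q\<^sup>2 + 1)) + (q\<^sup>2 - q) * (q\<^sup>2 + 1)"
proof -
  let ?h = "\<lambda>x. {x, inv x}"
  let ?I = "{x \<in> E1. x \<otimes> x = \<one>}" and ?J = "{x \<in> E1. x \<otimes> x \<noteq> \<one>}"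
  have EG: "x \<in> carrier G" if "x \<in> E1" for x using that by (simp add: E1_def)
  have sqinv: "inv x \<otimes> inv x = \<one> \<longleftrightarrow> x \<otimes> x = \<one>" if "x \<in> carrier G" for x
    using that inv_mult_group[OF that that] inv_eq_1_iff[of "x \<otimes> x"] by simp
  have E: "E1 = ?I \<union> ?J" by blast
  have "card (Sol G ` E1) = card (?h ` E1)" by (rule card_image_eq) (rule Sol_E1_eq)
  also have "?h ` E1 = ?h ` ?I \<union> ?h ` ?J" by (subst E) (rule image_Un)
  also have "card \<dots> = card (?h ` ?I) + card (?h ` ?J)"
  proof (rule card_Un_disjoint)
    show "finite (?h ` ?I)" "finite (?h ` ?J)" using fin_parts(2) by simp_all
    show "?h ` ?I \<inter> ?h ` ?J = {}"
    proof (rule ccontr)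
      assume "\<not> ?thesis"
      then obtain x y where x: "x \<in> ?I" and y: "y \<in> ?J" and e: "{x, inv x} = {y, inv y}" by blast
      have "y = x \<or> y = inv x" using e by blast
      then show False using x y sqinv[of x] EG[of x] by auto
    qed
  qed
  also have "card (?h ` ?I) = card ?I"
  proof (rule card_image, rule inj_onI)
    fix x y assume x: "x \<in> ?I" and y: "y \<in> ?I" and e: "{x, inv x} = {y, inv y}"
    have "inv x = x" "inv y = y" using x y EG by (auto intro: inv_equality)
    then show "x = y" using e by simp
  qed
  also have "card ?I = (q - 1) * (q\<^sup>2 + 1)" by (rule card_invol)
  finally have 1: "card (Sol G ` E1) = (q - 1) * (q\<^sup>2 + 1) + card (?h ` ?J)" .
  have "card ?J = 2 * card (?h ` ?J)"
  proof (rule card_eq_fibres)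
    show "finite ?J" using fin_parts(2) by simp
    fix s assume "s \<in> ?h ` ?J"
    then obtain y where y: "y \<in> ?J" "s = {y, inv y}" by (rule imageE)
    have yG: "y \<in> carrier G" using y EG by blast
    have "{x \<in> ?J. ?h x = s} = {y, inv y}"
    proof (rule antisym; rule subsetI)
      fix x assume "x \<in> {x \<in> ?J. ?h x = s}"
      then show "x \<in> {y, inv y}" using y(2) by blast
    next
      fix x assume "x \<in> {y, inv y}"
      then show "x \<in> {x \<in> ?J. ?h x = s}" using y yG E1_inv[of y] sqinv[of y] by (auto simp: insert_commute)
    qed
    moreover have "y \<noteq> inv y" using y(1) r_inv[OF yG] by auto
    ultimately show "card {x \<in> ?J. ?h x = s} = 2" by simp
  qed
  then have "2 * card (?h ` ?J) = (q\<^sup>2 - q) * (q\<^sup>2 + 1)" using card_order4 by simp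
  then show ?thesis unfolding 1 by simp
qed

lemma card_Sol_E2: "card (Sol G ` E2) = (q\<^sup>2 + 1) choose 2"
proof -
  have "card (Sol G ` E2) = card (F ` E2)"
  proof (rule card_image_eq)
    fix x y assume xy: "x \<in> E2" "y \<in> E2"
    have G: "x \<in> carrier G" "y \<in> carrier G" using xy by (auto simp: E2_def)
    show "Sol G x = Sol G y \<longleftrightarrow> F x = F y"
    proof
      assume "Sol G x = Sol G y" then show "F x = F y" by (rule Sol_eq_F[OF G])
    next
      assume e: "F x = F y"
      have "card (F x) = 2" using xy by (simp add: E2_def)
      then obtain P Q where PQ: "F x = {P, Q}" "P \<noteq> Q" by (meson card_2_iff)
      then show "Sol G x = Sol G y" using Sol_split[OF G(1) PQ(2,1)] Sol_split[OF G(2) PQ(2)] e by simp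
    qed
  qed
  also have "F ` E2 = {S. S \<subseteq> UNIV \<and> card S = 2}" using F_image_E2 by simp
  also have "card \<dots> = (q\<^sup>2 + 1) choose 2" using n_subsets[of "UNIV :: 'p set" 2] card_points by simp
  finally show ?thesis .
qed

lemma card_Sol_fpf: "card (Sol G ` fpf) = card tori"
  unfolding tori_def
proof (rule card_image_eq)
  fix x y assume x: "x \<in> fpf" and y: "y \<in> fpf"
  show "Sol G x = Sol G y \<longleftrightarrow> C x = C y"
  proof
    assume "Sol G x = Sol G y"
    then have "nrm x = nrm y" using Sol_fpf x y by simp
    then have "y \<in> nrm x" using C_sub_nrm[OF y] self_C[OF fpfD(1)[OF y]] by blast
    then have "y \<in> C x" using fpf_nrm[OF x] y by blast
    then show "C x = C y" using C_eq[OF x _ not_one(1)[OF y]] by simp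
  next
    assume "C x = C y"
    then have "y \<in> C x" using self_C[OF fpfD(1)[OF y]] by simp
    then have "nrm y = nrm x" by (rule nrm_eq[OF x _ not_one(1)[OF y]])
    then show "Sol G x = Sol G y" using Sol_fpf x y by simp
  qed
qed

theorem card_Solv: "2 * real (card (Solv G)) = 3 * real q ^ 4 + real q ^ 3 - real q ^ 2 + real q"
proof -
  have disj: "Sol G ` A \<inter> Sol G ` B = {}" if "A \<subseteq> carrier G" "B \<subseteq> carrier G" "\<And>x y. x \<in> A \<Longrightarrow> y \<in> B \<Longrightarrow> F x \<noteq> F y" for A B
    using that Sol_eq_F by blast
  have sub: "fpf \<subseteq> carrier G" "E1 \<subseteq> carrier G" "E2 \<subseteq> carrier G" by (auto simp: fpf_def E1_def E2_def)
  have cF: "card (F x) = 0" if "x \<in> fpf" for x using that by (simp add: fpf_def)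
  have c1: "card (F x) = 1" if "x \<in> E1" for x using that by (simp add: E1_def)
  have c2: "card (F x) = 2" if "x \<in> E2" for x using that by (simp add: E2_def)
  \<comment> \<open>The four types of elements have 0, 1, 2 and more than 64 fixed points. Equal
    solvabilizers have equal fixed-point sets, so the four images are disjoint.\<close>
  have cone: "card (F \<one>) > 64" using card_points_big by simp
  have "Solv G = Sol G ` ({\<one>} \<union> fpf \<union> E1 \<union> E2)" unfolding Solv_def using carrier_split by simp
  also have "\<dots> = Sol G ` ({\<one>} \<union> fpf \<union> E1) \<union> Sol G ` E2" by (rule image_Un)
  also have "card \<dots> = card (Sol G ` ({\<one>} \<union> fpf \<union> E1)) + card (Sol G ` E2)"
  proof (intro card_Un_disjoint disj)
    fix x y assume "x \<in> {\<one>} \<union> fpf \<union> E1" "y \<in> E2"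
    then show "F x \<noteq> F y" using cF[of x] c1[of x] c2[of y] cone by auto
  qed (use fin_parts sub in auto)
  also have "Sol G ` ({\<one>} \<union> fpf \<union> E1) = Sol G ` ({\<one>} \<union> fpf) \<union> Sol G ` E1" by (rule image_Un)
  also have "card \<dots> = card (Sol G ` ({\<one>} \<union> fpf)) + card (Sol G ` E1)"
  proof (intro card_Un_disjoint disj)
    fix x y assume "x \<in> {\<one>} \<union> fpf" "y \<in> E1"
    then show "F x \<noteq> F y" using cF[of x] c1[of y] cone by auto
  qed (use fin_parts sub in auto)
  also have "Sol G ` ({\<one>} \<union> fpf) = Sol G ` {\<one>} \<union> Sol G ` fpf" by (rule image_Un)
  also have "card \<dots> = card (Sol G ` {\<one>}) + card (Sol G ` fpf)"
  proof (intro card_Un_disjoint disj)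
    fix x y assume "x \<in> {\<one>}" "y \<in> fpf"
    then show "F x \<noteq> F y" using cF[of y] cone by auto
  qed (use fin_parts sub in auto)
  also have "card (Sol G ` {\<one>}) = 1" by simp
  finally have e: "card (Solv G) = 1 + card tori + card (Sol G ` E1) + ((q\<^sup>2 + 1) choose 2)"
    unfolding card_Sol_fpf card_Sol_E2 .
  have r1: "real (q - 1) = real q - 1" using q_ge by (simp add: of_nat_diff)
  have qq: "q \<le> q\<^sup>2" using q_ge by (simp add: power2_eq_square)
  have r3: "real (q\<^sup>2 - q) = real q ^ 2 - real q" using of_nat_diff[OF qq] by (simp only: of_nat_power)
  have "even ((q\<^sup>2 + 1) * q\<^sup>2)" using q_even by simp
  then have ch: "2 * ((q\<^sup>2 + 1) choose 2) = (q\<^sup>2 + 1) * q\<^sup>2" unfolding choose_two by simp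
  have r4: "2 * real ((q\<^sup>2 + 1) choose 2) = (real q ^ 2 + 1) * real q ^ 2"
    using arg_cong[OF ch, of real] by (simp only: of_nat_mult of_nat_add of_nat_power of_nat_1 of_nat_numeral)
  have r5: "2 * real (card (Sol G ` E1)) = 2 * ((real q - 1) * (real q ^ 2 + 1)) + (real q ^ 2 - real q) * (real q ^ 2 + 1)"
    using arg_cong[OF card_Sol_E1, of real]
    by (simp only: r1 r3 of_nat_mult of_nat_add of_nat_power of_nat_1 of_nat_numeral)
  have r6: "2 * real (card tori) = real q ^ 4 - real q ^ 2" using tori_count by blast
  have "2 * real (card (Solv G)) = 2 + 2 * real (card tori) + 2 * real (card (Sol G ` E1)) + 2 * real ((q\<^sup>2 + 1) choose 2)"
    unfolding e by simp
  also have "\<dots> = 2 + (real q ^ 4 - real q ^ 2) + (2 * ((real q - 1) * (real q ^ 2 + 1)) + (real q ^ 2 - real q) * (real q ^ 2 + 1))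
     + (real q ^ 2 + 1) * real q ^ 2" by (simp only: r4 r5 r6)
  finally show ?thesis by (simp add: algebra_simps power2_eq_square power3_eq_cube power4_eq_xxxx)
qed

end

section \<open>Operators of order dividing \<open>q\<^sup>2 + 1\<close> on a four-dimensional space\<close>

lemma finite_field_power_card:
  fixes c :: "'a::{field,finite}" shows "c ^ card (UNIV :: 'a set) = c"
proof (cases "c = 0")
  case True then show ?thesis by (simp add: card_gt_0_iff)
next
  case False
  let ?S = "UNIV - {0::'a}"
  have "(\<Prod>x\<in>?S. c * x) = (\<Prod>x\<in>?S. x)"
  proof (rule prod.reindex_bij_witness[where i = "\<lambda>x. x / c" and j = "\<lambda>x. c * x"])
  qed (use False in auto)
  then have "c ^ card ?S * (\<Prod>x\<in>?S. x) = 1 * (\<Prod>x\<in>?S. x)" by (simp add: prod.distrib)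
  moreover have "(\<Prod>x\<in>?S. x) \<noteq> 0" by simp
  ultimately have "c ^ card ?S = 1" using mult_right_cancel by blast
  moreover have "card (UNIV :: 'a set) = Suc (card ?S)"
    by (rule card.remove) simp_all
  ultimately show ?thesis by (simp only: power_Suc mult_1_right)
qed

lemma char2_pow_add:
  fixes x y :: "'b::comm_ring_1" assumes "(1::'b) + 1 = 0"
  shows "(x + y) ^ (2 ^ k) = x ^ (2 ^ k) + y ^ (2 ^ k)"
proof (induction k)
  case (Suc k)
  have "(2::'b) = 0" using assms by simp
  then have 2: "2 * z = 0" for z :: 'b by simp
  have sq: "z ^ (2 ^ Suc k) = (z ^ (2 ^ k))\<^sup>2" for z :: 'b
    by (simp only: power_Suc2 power_mult)
  have "((x + y) ^ (2 ^ k))\<^sup>2 = (x ^ 2 ^ k)\<^sup>2 + (y ^ 2 ^ k)\<^sup>2"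
    using 2[of "x ^ 2 ^ k * y ^ 2 ^ k"] unfolding Suc power2_sum by (simp add: mult.assoc)
  then show ?case by (simp only: sq)
qed simp

text \<open>Raising to the power 2^k is additive in characteristic 2 and by assumption fixes the
  coefficients, so it only acts on the variable.\<close>

lemma frobenius_pcompose:
  fixes f :: "'a::field poly"
  assumes "(1::'a) + 1 = 0" "\<And>c::'a. c ^ (2 ^ k) = c"
  shows "pcompose f (monom 1 (2 ^ k)) = f ^ (2 ^ k)"
proof (induction f)
  case 0 then show ?case by simp
next
  case (pCons c f)
  have one: "(1::'a poly) + 1 = 0" using assms(1) by (simp add: one_pCons)
  have "pCons c f = [:c:] + [:0, 1:] * f" by simp
  then have "(pCons c f) ^ (2 ^ k) = [:c:] ^ (2 ^ k) + ([:0, 1:] * f) ^ (2 ^ k)" using char2_pow_add[OF one] by metis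
  also have "[:c:] ^ (2 ^ k) = [:c:]" using assms(2) by (simp add: poly_const_pow)
  also have "([:0, 1:] * f) ^ (2 ^ k) = monom 1 (2 ^ k) * f ^ (2 ^ k)"
    by (simp only: power_mult_distrib) (simp add: monom_altdef)
  finally show ?case using pCons by (simp add: pcompose_pCons)
qed

text \<open>By Bezout some multiple of \<open>m\<close> exceeds a multiple of \<open>n\<close> by
  one. No inverse of \<open>f\<close> is required in this form.\<close>

lemma funpow_coprime_fix:
  assumes "(f ^^ m) w = w" "(f ^^ n) w = w" "coprime m n" shows "f w = w"
proof (cases "n = 1")
  case True
  then show ?thesis using assms(2) by simp
next
  case False
  have it: "(f ^^ (k * j)) w = w" if "(f ^^ k) w = w" for k j
    by (induction j) (simp_all add: funpow_add that)
  obtain x y where xy: "m * x = n * y + 1" using coprime_bezout_strong[OF assms(3) False] by blast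
  have "w = (f ^^ (m * x)) w" using it[OF assms(1)] by simp
  also have "\<dots> = f ((f ^^ (n * y)) w)" by (simp only: xy Suc_eq_plus1[symmetric] funpow.simps comp_apply)
  finally show ?thesis using it[OF assms(2)] by simp
qed

text \<open>A Vandermonde argument without division: it is applied with \<open>I\<close> the annihilator of a vector,
  which is not known to be prime at that stage.\<close>

lemma divided_differences:
  fixes a1 a2 a3 a4 c0 c1 c2 c3 c4 :: "'b::comm_ring_1"
  assumes add: "\<And>x y. I x \<Longrightarrow> I y \<Longrightarrow> I (x - y)"
    and "\<And>h. I ((a1 - a2) * h) \<Longrightarrow> I h" "\<And>h. I ((a1 - a3) * h) \<Longrightarrow> I h" "\<And>h. I ((a1 - a4) * h) \<Longrightarrow> I h"
    "\<And>h. I ((a2 - a3) * h) \<Longrightarrow> I h" "\<And>h. I ((a2 - a4) * h) \<Longrightarrow> I h" "\<And>h. I ((a3 - a4) * h) \<Longrightarrow> I h"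
    and F: "\<And>a. a \<in> {a1, a2, a3, a4} \<Longrightarrow> I (c0 + c1 * a + c2 * a^2 + c3 * a^3 + c4 * a^4)"
  shows "I (c3 + c4 * (a1 + a2 + a3 + a4))"
    and "I (c2 + c3 * (a1 + a2 + a3) + c4 * (a1^2 + a2^2 + a3^2 + a1*a2 + a1*a3 + a2*a3))"
    and "I (c1 + c2 * (a1 + a2) + c3 * (a1^2 + a1*a2 + a2^2) + c4 * (a1^3 + a1^2*a2 + a1*a2^2 + a2^3))"
proof -
  \<comment> \<open>\<open>G\<close> and \<open>H\<close> are the first and second divided
    differences of \<open>F'\<close> with nodes \<open>a1\<close> and \<open>a1\<close>,
    \<open>a2\<close>. Each difference of values exhibits a factor that the assumptions allow to
    cancel.\<close>
  define G where "G a = c1 + c2 * (a1 + a) + c3 * (a1^2 + a1*a + a^2) + c4 * (a1^3 + a1^2*a + a1*a^2 + a^3)" for a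
  define H where "H a = c2 + c3 * (a1 + a2 + a) + c4 * (a1^2 + a2^2 + a^2 + a1*a2 + a1*a + a2*a)" for a
  define F' where "F' a = c0 + c1 * a + c2 * a^2 + c3 * a^3 + c4 * a^4" for a
  have FG: "F' a1 - F' a = (a1 - a) * G a" for a unfolding F'_def G_def by (simp add: algebra_simps power2_eq_square power3_eq_cube power4_eq_xxxx)
  have GH: "G a2 - G a = (a2 - a) * H a" for a unfolding G_def H_def by (simp add: algebra_simps power2_eq_square power3_eq_cube)
  have HK: "H a3 - H a4 = (a3 - a4) * (c3 + c4 * (a1 + a2 + a3 + a4))" unfolding H_def by (simp add: algebra_simps power2_eq_square)
  have IF: "I (F' a1)" "I (F' a2)" "I (F' a3)" "I (F' a4)" unfolding F'_def by (rule F, simp)+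
  have G: "I (G a2)" "I (G a3)" "I (G a4)"
    using assms(2-4) add[OF IF(1) IF(2)] add[OF IF(1) IF(3)] add[OF IF(1) IF(4)] unfolding FG by blast+
  have H: "I (H a3)" "I (H a4)"
    using assms(5,6) add[OF G(1) G(2)] add[OF G(1) G(3)] unfolding GH by blast+
  show "I (c3 + c4 * (a1 + a2 + a3 + a4))" using assms(7) add[OF H(1) H(2)] unfolding HK by blast
  show "I (c2 + c3 * (a1 + a2 + a3) + c4 * (a1^2 + a2^2 + a3^2 + a1*a2 + a1*a3 + a2*a3))"
    using H(1) unfolding H_def .
  show "I (c1 + c2 * (a1 + a2) + c3 * (a1^2 + a1*a2 + a2^2) + c4 * (a1^3 + a1^2*a2 + a1*a2^2 + a2^3))"
    using G(1) unfolding G_def .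
qed

text \<open>The natural module as seen by one element of order dividing q^2 + 1. Dimension four is
  expressed by the number q^4 of vectors because spanning is obtained by counting. In effect the
  polynomials in \<open>L\<close> turn out to act as a field with q^4 elements.\<close>

locale finite_cyclic_operator = vector_space scale
  for scale :: "'a::{field,finite} \<Rightarrow> 'v::{ab_group_add,finite} \<Rightarrow> 'v" (infixr "*s" 75) +
  fixes L :: "'v \<Rightarrow> 'v" and q p :: nat
  assumes L_add: "L (u + v) = L u + L v" and L_scale: "L (c *s v) = c *s L v"
    and q: "q = 2 ^ p" "0 < p" and card_a: "card (UNIV :: 'a set) = q" and char2: "(1::'a) + 1 = 0"
    and card_v: "card (UNIV :: 'v set) = q ^ 4"
    and L_pow: "(L ^^ (q\<^sup>2 + 1)) v = v" and L_id: "\<exists>v. L v \<noteq> v"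
begin

text \<open>Evaluation of \<open>f\<close> at the operator \<open>L\<close>, in Horner form; it
  makes the vectors a module over the polynomial ring.\<close>

definition pact :: "'a poly \<Rightarrow> 'v \<Rightarrow> 'v" where
  "pact f v = fold_coeffs (\<lambda>c w. c *s v + L w) f 0"

lemma L_0 [simp]: "L 0 = 0" using L_add[of 0 0] by simp

lemma L_diff: "L (u - v) = L u - L v"
  using L_add[of "u - v" v] by (simp add: algebra_simps)

lemma v2: "v + v = (0::'v)"
proof -
  have "v + v = (1 + 1) *s v" by (simp only: scale_left_distrib scale_one)
  then show ?thesis using char2 by simp
qed

lemma minus_v: "- v = (v::'v)" using v2[of v] by (rule minus_unique)

lemma pact_0 [simp]: "pact 0 v = 0" by (simp add: pact_def)

lemma pact_pCons [simp]: "pact (pCons c f) v = c *s v + L (pact f v)"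
proof (cases "f = 0 \<and> c = 0")
  case False then show ?thesis by (auto simp: pact_def)
qed (auto simp: pact_def)

lemma pact_1 [simp]: "pact 1 v = v" by (simp add: one_pCons)

lemma pact_add: "pact (f + g) v = pact f v + pact g v"
  by (induction f g rule: poly_induct2) (simp_all add: L_add scale_left_distrib algebra_simps)

lemma pact_smult: "pact (smult c f) v = c *s pact f v"
  by (induction f) (simp_all add: L_scale scale_right_distrib)

lemma pact_diff: "pact (f - g) v = pact f v - pact g v"
  using pact_add[of "f - g" g v] by (simp add: algebra_simps)

lemma pact_mult: "pact (f * g) v = pact f (pact g v)"
  by (induction f) (simp_all add: mult_pCons_left pact_add pact_smult)

lemma pact_comm: "pact f (pact g v) = pact g (pact f v)"
  by (metis mult.commute pact_mult)

lemma pact_hom: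
  assumes "\<And>u v. y (u + v) = y u + y v" "\<And>c v. y (c *s v) = c *s y v" "\<And>v. y (L v) = L (y v)"
  shows "y (pact f v) = pact f (y v)"
proof -
  have "y 0 = 0" using assms(1)[of 0 0] by simp
  then show ?thesis by (induction f) (simp_all add: assms)
qed

lemma L_pact: "L (pact f v) = pact f (L v)" by (rule pact_hom) (simp_all add: L_add L_scale)

lemma pact_of_0 [simp]: "pact f 0 = 0" by (induction f) simp_all

lemma pact_add_right: "pact f (u + v) = pact f u + pact f v"
  by (induction f) (simp_all add: L_add scale_right_distrib algebra_simps)

lemma pact_diff_right: "pact f (u - v) = pact f u - pact f v"
  using pact_add_right[of f "u - v" v] by (simp add: algebra_simps)

lemma pact_monom: "pact (monom 1 n) v = (L ^^ n) v"
  by (induction n) (simp_all add: monom_0 monom_Suc one_pCons[symmetric])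

lemma L_funpow_inj: "(L ^^ n) u = (L ^^ n) v \<Longrightarrow> u = v"
proof -
  have "inj L"
  proof (rule injI)
    fix x y assume "L x = L y"
    then have "(L ^^ (q\<^sup>2 + 1)) x = (L ^^ (q\<^sup>2 + 1)) y" by (simp add: funpow_swap1)
    then show "x = y" by (simp only: L_pow)
  qed
  then have "inj (L ^^ n)" by (rule inj_fn)
  then show "(L ^^ n) u = (L ^^ n) v \<Longrightarrow> u = v" by (rule injD)
qed

section \<open>Frobenius powers of the operator\<close>

definition frob :: "nat \<Rightarrow> 'a poly" where "frob i = monom 1 (q ^ i)"

lemma q_gt1: "q > 1" using q by (metis one_less_power one_less_numeral_iff semiring_norm(76))
lemma q_even: "even q" using q by simp

text \<open>These are the differences of two powers of q. A common divisor of q^2 + 1 with q - 1 or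
  q^2 - 1 divides 2, and q^2 + 1 is odd; for q^3 - 1 the relation q (q^2 + 1) = (q^3 - 1) + (q + 1)
  leads back to q^2 - 1.\<close>

lemma coprimes:
  assumes d: "d \<in> {1, 2, 3}" shows "coprime (q ^ i * (q ^ d - 1)) (q\<^sup>2 + 1)"
proof -
  have odd: "odd (q\<^sup>2 + 1)" using q_even by simp
  have unit2: "is_unit c" if "c dvd 2" "c dvd q\<^sup>2 + 1" for c
  proof -
    have "coprime 2 (q\<^sup>2 + 1)" using odd by simp
    then show ?thesis using that coprime_common_divisor by blast
  qed
  have cq: "coprime q (q\<^sup>2 + 1)"
  proof (rule coprimeI)
    fix c assume c: "c dvd q" "c dvd q\<^sup>2 + 1"
    then have "c dvd q\<^sup>2" by (simp add: power2_eq_square)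
    then show "is_unit c" using c(2) dvd_add_right_iff by blast
  qed
  have "coprime (q ^ d - 1) (q\<^sup>2 + 1)"
  proof (rule coprimeI)
    fix c assume c: "c dvd q ^ d - 1" "c dvd q\<^sup>2 + 1"
    obtain j where j: "q = Suc j" using q_gt1 by (cases q) auto
    have e1: "q\<^sup>2 + 1 = (q - 1) * (q + 1) + 2" and e2: "q\<^sup>2 + 1 = (q\<^sup>2 - 1) + 2"
      and e3: "q * (q\<^sup>2 + 1) = (q ^ 3 - 1) + (q + 1)"
      unfolding j by (simp_all add: power2_eq_square power3_eq_cube algebra_simps)
    consider "d = 1" | "d = 2" | "d = 3" using d by blast
    then show "is_unit c"
    proof cases
      case 1
      then have "c dvd (q - 1) * (q + 1)" using c(1) by (simp only: power_one_right dvd_mult2)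
      then have "c dvd 2" using c(2) unfolding e1 by (simp only: dvd_add_right_iff)
      then show ?thesis using unit2 c(2) by blast
    next
      case 2
      have "c dvd q\<^sup>2 - 1" using c(1) unfolding 2 .
      then have "c dvd 2" using c(2) unfolding e2 by (simp only: dvd_add_right_iff)
      then show ?thesis using unit2 c(2) by blast
    next
      case 3
      have "c dvd q * (q\<^sup>2 + 1)" by (rule dvd_mult[OF c(2)])
      then have "c dvd q + 1" using c(1) unfolding 3 e3 by (simp only: dvd_add_right_iff)
      then have "c dvd (q - 1) * (q + 1)" by (rule dvd_mult)
      then have "c dvd 2" using c(2) unfolding e1 by (simp only: dvd_add_right_iff)
      then show ?thesis using unit2 c(2) by blast
    qed
  qed
  moreover have "coprime (q ^ i) (q\<^sup>2 + 1)" using cq by (simp only: coprime_power_left_iff simp_thms)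
  ultimately show ?thesis by (simp only: coprime_mult_left_iff simp_thms)
qed

text \<open>Two Frobenius powers of \<open>L\<close> agreeing on \<open>w\<close> means that a power
  of \<open>L\<close> with exponent coprime to q^2 + 1 fixes \<open>w\<close>; so does the power q^2
  + 1 itself.\<close>

lemma frob_diff_fix:
  assumes ij: "i < j" "j < 4" and w: "pact (frob i - frob j) w = 0" shows "L w = w"
proof -
  have "(L ^^ (q ^ i)) w = (L ^^ (q ^ j)) w" using w by (simp add: pact_diff frob_def pact_monom)
  also have "q ^ j = q ^ i + q ^ i * (q ^ (j - i) - 1)"
  proof -
    have "q ^ i * (q ^ (j - i) - 1) = q ^ i * q ^ (j - i) - q ^ i" by (simp add: diff_mult_distrib2)
    moreover have "q ^ i * q ^ (j - i) = q ^ j" using ij by (simp add: power_add[symmetric])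
    moreover have "q ^ i \<le> q ^ j" using ij q_gt1 by (intro power_increasing) auto
    ultimately show ?thesis by simp
  qed
  finally have "(L ^^ (q ^ i)) w = (L ^^ (q ^ i)) ((L ^^ (q ^ i * (q ^ (j - i) - 1))) w)"
    by (simp only: funpow_add comp_apply)
  then have "(L ^^ (q ^ i * (q ^ (j - i) - 1))) w = w" by (rule L_funpow_inj[symmetric])
  moreover have "j - i \<in> {1, 2, 3}" using ij by auto
  ultimately show ?thesis using funpow_coprime_fix[OF _ L_pow coprimes] by blast
qed

text \<open>Since f(X^(q^i)) is the q^i-th power of f, a polynomial killing \<open>v\<close> still
  kills it after substituting a Frobenius power: the four elements \<open>frob i\<close> behave as
  conjugate roots.\<close>

lemma frob_compose: "pact (pcompose f (frob i)) v = pact (f ^ (q ^ i - 1)) (pact f v)"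
proof -
  have c: "c ^ (2 ^ (p * i)) = c" for c :: 'a
  proof (induction i)
    case (Suc i)
    have "c ^ (2 ^ (p * Suc i)) = (c ^ (2 ^ (p * i))) ^ q" by (simp add: q power_add power_mult[symmetric] mult.commute)
    then show ?case using Suc finite_field_power_card[of c] card_a by simp
  qed simp
  have qi: "q ^ i = 2 ^ (p * i)" unfolding q(1) by (simp only: power_mult)
  have "pcompose f (frob i) = f ^ (q ^ i)"
    unfolding frob_def qi by (rule frobenius_pcompose[OF char2 c])
  also have "\<dots> = f ^ Suc (q ^ i - 1)" using q_gt1 by simp
  also have "\<dots> = f ^ (q ^ i - 1) * f" by (rule power_Suc2)
  finally show ?thesis by (simp only: pact_mult)
qed

text \<open>In characteristic 2 the assumption says that the square of \<open>L\<close> fixes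
  \<open>u\<close>, and the order of \<open>L\<close> is odd. Hence fixed vectors and the image of
  \<open>L\<close> minus the identity meet only in 0.\<close>

lemma fix_image: "L (L u - u) = L u - u \<Longrightarrow> L u - u = 0"
proof -
  assume "L (L u - u) = L u - u"
  then have "L (L u) = L u - u + L u" by (simp add: L_diff algebra_simps)
  also have "\<dots> = u" using v2[of "L u"] minus_v[of u] by (simp add: algebra_simps)
  finally have "(L ^^ 2) u = u" by (simp add: numeral_2_eq_2)
  moreover have "coprime 2 (q\<^sup>2 + 1)" using q_even by simp
  ultimately have "L u = u" using funpow_coprime_fix[OF _ L_pow] by blast
  then show ?thesis by simp
qed

definition comb :: "'v \<Rightarrow> 'a \<times> 'a \<times> 'a \<times> 'a \<Rightarrow> 'v" where
  "comb w = (\<lambda>(c0, c1, c2, c3). pact [:c0, c1, c2, c3:] w)"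

text \<open>This is the cancellation required by \<open>divided_differences\<close>. Irreducibility
  is not yet available, so it is proved only on the image of \<open>L\<close> minus the identity,
  where fixed vectors vanish.\<close>

lemma frob_inj_image:
  assumes "i < 4" "j < 4" "i \<noteq> j" "pact ((frob i - frob j) * h) (L u - u) = 0"
  shows "pact h (L u - u) = 0"
proof -
  let ?w = "pact h (L u - u)"
  have "pact (frob i - frob j) ?w = 0" using assms(4) by (simp add: pact_mult)
  moreover have "pact (frob j - frob i) ?w = - pact (frob i - frob j) ?w" by (simp add: pact_diff)
  ultimately have "L ?w = ?w"
    using assms(1-3) frob_diff_fix[of i j ?w] frob_diff_fix[of j i ?w] by (cases "i < j") auto
  moreover have "?w = L (pact h u) - pact h u" by (simp add: pact_diff_right L_pact)
  ultimately show ?thesis using fix_image[of "pact h u"] by simp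
qed

lemma pcompose_quartic: "pcompose [:c0, c1, c2, c3, c4:] a = [:c0:] + [:c1:] * a + [:c2:] * a^2 + [:c3:] * a^3 + [:c4:] * a^4"
  for a :: "'a poly"
  by (simp add: pcompose_pCons algebra_simps power2_eq_square power3_eq_cube power4_eq_xxxx smult_add_right)

text \<open>A cubic killing \<open>w\<close> has the four roots \<open>frob 0\<close> to
  \<open>frob 3\<close> modulo the annihilator of \<open>w\<close>. Its divided differences remove
  the coefficients from the top down.\<close>

lemma comb_zero:
  assumes w: "w = L u - u" "w \<noteq> 0" and z: "pact [:c0, c1, c2, c3:] w = 0"
  shows "c0 = 0 \<and> c1 = 0 \<and> c2 = 0 \<and> c3 = 0"
proof -
  let ?I = "\<lambda>f. pact f w = 0"
  let ?c = "\<lambda>c. [:c::'a:]"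
  have add: "?I (x - y)" if "?I x" "?I y" for x y using that by (simp add: pact_diff)
  have inj: "?I h" if "?I ((frob i - frob j) * h)" "i < 4" "j < 4" "i \<noteq> j" for i j h
    using frob_inj_image[of i j h u] that w(1) by simp
  have F: "?I (?c c0 + ?c c1 * a + ?c c2 * a^2 + ?c c3 * a^3 + 0 * a^4)"
    if a: "a \<in> {frob 0, frob 1, frob 2, frob 3}" for a
  proof -
    have "?I (pcompose [:c0, c1, c2, c3:] a)" using a z by (auto simp: frob_compose)
    then show ?thesis using pcompose_quartic[of c0 c1 c2 c3 0 a] by simp
  qed
  note D = divided_differences[of ?I "frob 0" "frob 1" "frob 2" "frob 3", OF add _ _ _ _ _ _ F]
  have z: "c = 0" if "?I (?c c)" for c using that w(2) by simp
  have i3: "?I (?c c3 + 0 * (frob 0 + frob 1 + frob 2 + frob 3))" by (rule D(1)) (assumption | erule inj; simp)+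
  then have 3: "c3 = 0" using z[of c3] by simp
  have "?I (?c c2 + ?c c3 * (frob 0 + frob 1 + frob 2) + 0 * ((frob 0)^2 + (frob 1)^2 + (frob 2)^2 + frob 0*frob 1 + frob 0*frob 2 + frob 1*frob 2))"
    by (rule D(2)) (assumption | erule inj; simp)+
  then have 2: "c2 = 0" using z[of c2] 3 by simp
  have "?I (?c c1 + ?c c2 * (frob 0 + frob 1) + ?c c3 * ((frob 0)^2 + frob 0*frob 1 + (frob 1)^2) + 0 * ((frob 0)^3 + (frob 0)^2*frob 1 + frob 0*(frob 1)^2 + (frob 1)^3))"
    by (rule D(3)) (assumption | erule inj; simp)+
  then have 1: "c1 = 0" using z[of c1] 3 2 by simp
  have "c0 = 0" using \<open>pact [:c0, c1, c2, c3:] w = 0\<close> 1 2 3 w(2) by simp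
  then show ?thesis using 1 2 3 by simp
qed

text \<open>There are q^4 coefficient quadruples and q^4 vectors, so independence of
  \<open>w\<close> and its first three images already gives spanning.\<close>

lemma comb_surj_image:
  assumes "w = L u - u" "w \<noteq> 0" shows "range (comb w) = UNIV"
proof -
  have "inj (comb w)"
  proof (rule injI)
    fix x y assume e: "comb w x = comb w y"
    obtain a0 a1 a2 a3 where x: "x = (a0, a1, a2, a3)" by (cases x)
    obtain b0 b1 b2 b3 where y: "y = (b0, b1, b2, b3)" by (cases y)
    have "pact ([:a0, a1, a2, a3:] - [:b0, b1, b2, b3:]) w = 0" using e by (simp add: comb_def x y pact_diff del: diff_pCons pact_pCons)
    then have "pact [:a0 - b0, a1 - b1, a2 - b2, a3 - b3:] w = 0" by (simp only: diff_pCons diff_zero)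
    then have "a0 - b0 = 0 \<and> a1 - b1 = 0 \<and> a2 - b2 = 0 \<and> a3 - b3 = 0" by (rule comb_zero[OF assms])
    then show "x = y" using x y by simp
  qed
  then have "card (range (comb w)) = card (UNIV :: ('a \<times> 'a \<times> 'a \<times> 'a) set)" by (rule card_image)
  also have "\<dots> = q ^ 4"
  proof -
    have "card (UNIV :: ('a \<times> 'a \<times> 'a \<times> 'a) set) = q * (q * (q * q))"
      by (simp only: UNIV_Times_UNIV[symmetric] card_cartesian_product card_a)
    then show ?thesis by (simp add: power4_eq_xxxx)
  qed
  finally have "card (range (comb w)) = card (UNIV :: 'v set)" using card_v by simp
  then show ?thesis by (intro card_subset_eq) auto
qed

lemma comb_rangeD: "v \<in> range (comb w) \<Longrightarrow> \<exists>c0 c1 c2 c3. v = pact [:c0, c1, c2, c3:] w"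
proof -
  assume "v \<in> range (comb w)"
  then obtain x where x: "v = comb w x" by blast
  obtain a0 a1 a2 a3 where "x = (a0, a1, a2, a3)" by (cases x)
  then have "v = pact [:a0, a1, a2, a3:] w" by (simp only: x comb_def prod.case)
  then show ?thesis by (intro exI)
qed

text \<open>One nonzero vector of the form \<open>L u - u\<close> generates everything, and its
  multiples by polynomials in \<open>L\<close> are again of that form. Thus the restriction to the
  image disappears and every nonzero vector is cyclic.\<close>

lemma all_in_image: "\<exists>u. v = L u - u"
proof -
  obtain u where u: "L u \<noteq> u" using L_id by blast
  let ?w = "L u - u"
  have "v \<in> range (comb ?w)" using comb_surj_image[OF refl, of u] u by simp
  then obtain f where "v = pact f ?w" using comb_rangeD by blast
  then have "v = L (pact f u) - pact f u" by (simp only: pact_diff_right L_pact)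
  then show ?thesis by blast
qed

lemma cyclic: assumes "w \<noteq> 0" shows "\<exists>c0 c1 c2 c3. v = pact [:c0, c1, c2, c3:] w"
proof -
  obtain u where "w = L u - u" using all_in_image by blast
  then have "v \<in> range (comb w)" using comb_surj_image assms by blast
  then show ?thesis by (rule comb_rangeD)
qed

lemma cyclicE: assumes "w \<noteq> 0" obtains f where "v = pact f w"
  using cyclic[OF assms] by blast

lemma ex_nonzero: "\<exists>v::'v. v \<noteq> 0" using L_id by (metis L_0)

text \<open>Every nonzero vector generates the module over a commutative ring, so killing one of
  them means killing all. This makes the annihilator prime, as in a field.\<close>

lemma operator_zero: "pact f w = 0 \<Longrightarrow> w \<noteq> 0 \<Longrightarrow> pact f v = 0"
proof -
  assume z: "pact f w = 0" and w: "w \<noteq> 0"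
  obtain g where "v = pact g w" by (rule cyclicE[OF w])
  then show ?thesis using z pact_comm[of f g w] by simp
qed

text \<open>An operator commuting with \<open>L\<close> is determined by its value at a cyclic
  vector, and that value is itself a polynomial in \<open>L\<close> applied to the vector.\<close>

lemma centralizer_pact:
  assumes "\<And>u v. y (u + v) = y u + y v" "\<And>c v. y (c *s v) = c *s y v" "\<And>v. y (L v) = L (y v)"
  obtains f where "\<And>v. y v = pact f v"
proof -
  obtain w :: 'v where w: "w \<noteq> 0" using ex_nonzero by blast
  obtain f where f: "y w = pact f w" by (rule cyclicE[OF w])
  have "y v = pact f v" for v
  proof -
    obtain g where g: "v = pact g w" by (rule cyclicE[OF w])
    have "y v = pact g (y w)" unfolding g by (rule pact_hom) (rule assms)+
    then show ?thesis using f g pact_comm[of g f w] by simp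
  qed
  then show thesis by (rule that)
qed

theorem centralizer_commutative:
  assumes "\<And>u v. y (u + v) = y u + y v" "\<And>c v. y (c *s v) = c *s y v" "\<And>v. y (L v) = L (y v)"
    and "\<And>u v. z (u + v) = z u + z v" "\<And>c v. z (c *s v) = c *s z v" "\<And>v. z (L v) = L (z v)"
  shows "y (z v) = z (y v)"
proof -
  obtain f where f: "\<And>v. y v = pact f v" by (rule centralizer_pact[of y]) (use assms in auto)
  obtain g where g: "\<And>v. z v = pact g v" by (rule centralizer_pact[of z]) (use assms in auto)
  show ?thesis by (simp only: f g pact_comm[of f g])
qed

text \<open>The conjugate \<open>M\<close> is a polynomial \<open>m\<close> in \<open>L\<close> and
  satisfies the same monic quartic as \<open>L\<close>. Modulo the annihilator this quartic has the
  four distinct roots \<open>frob i\<close>, and a root different from all of them is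
  impossible.\<close>

theorem conjugates_in_centralizer:
  assumes g: "\<And>u v. g (u + v) = g u + g v" "\<And>c v. g (c *s v) = c *s g v"
    and h: "\<And>u v. h (u + v) = h u + h v" "\<And>c v. h (c *s v) = c *s h v"
    and gh: "\<And>v. g (h v) = v" "\<And>v. h (g v) = v"
    and M: "\<And>v. M v = g (L (h v))" "\<And>v. M (L v) = L (M v)"
  shows "\<exists>i<4. \<forall>v. M v = (L ^^ (q ^ i)) v"
proof -
  obtain m where m: "\<And>v. M v = pact m v"
    by (rule centralizer_pact[of M]) (use g h M L_add L_scale in auto)
  obtain w :: 'v where w: "w \<noteq> 0" using ex_nonzero by blast
  obtain c0 c1 c2 c3 where c: "(L ^^ 4) w = pact [:c0, c1, c2, c3:] w" using cyclic[OF w] by blast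
  let ?F = "[:- c0, - c1, - c2, - c3, 1:]"
  have "?F = monom 1 4 - [:c0, c1, c2, c3:]" by (simp add: monom_altdef numeral_eq_Suc)
  then have "pact ?F w = 0" using c by (simp only: pact_diff pact_monom diff_self)
  then have F0: "pact ?F v = 0" for v by (rule operator_zero[OF _ w])
  have prime: "pact b v = 0" if "pact (a * b) v = 0" "\<exists>u. pact a u \<noteq> 0" for a b v
    using that operator_zero[of a "pact b v"] by (auto simp: pact_mult)
  let ?I = "\<lambda>f. \<forall>v. pact f v = 0"
  have add: "?I (x - y)" if "?I x" "?I y" for x y using that by (simp add: pact_diff)
  have FM: "?I (pcompose ?F m)"
  proof
    fix v
    \<comment> \<open>Conjugating f(L) by \<open>g\<close> gives f(M), which is the composite of
      \<open>f\<close> with \<open>m\<close> evaluated at \<open>L\<close>.\<close>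
    have *: "g (pact f (h v)) = pact (pcompose f m) v" for f v
    proof (induction f)
      case 0
      have "g 0 = 0" using g(1)[of 0 0] by simp
      then show ?case by simp
    next
      case (pCons a f)
      have "g (pact (pCons a f) (h v)) = a *s v + g (L (pact f (h v)))" by (simp add: g gh)
      also have "g (L (pact f (h v))) = M (g (pact f (h v)))" by (simp add: M(1) gh)
      finally show ?case using pCons by (simp add: pcompose_pCons pact_add m pact_mult pact_smult)
    qed
    have "g 0 = 0" using g(1)[of 0 0] by simp
    then show "pact (pcompose ?F m) v = 0" using *[of ?F v] F0 by simp
  qed
  have Fa: "?I (pcompose ?F (frob i))" for i by (simp only: frob_compose F0 pact_of_0) simp
  show ?thesis
  proof (rule ccontr)
    assume n: "\<not> ?thesis"
    have ne: "\<exists>u. pact (frob i - m) u \<noteq> 0" if "i < 4" for i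
    proof (rule ccontr)
      assume "\<not> ?thesis"
      then have "M v = (L ^^ (q ^ i)) v" for v by (simp add: pact_diff frob_def pact_monom m)
      then show False using n that by blast
    qed
    have nf: "\<exists>u. pact (frob i - frob j) u \<noteq> 0" if "i < j" "j < 4" for i j
      using frob_diff_fix[OF that] L_id by blast
    have nz: "?I b" if "\<forall>v. pact (a * b) v = 0" "\<exists>u. pact a u \<noteq> 0" for a b
      using prime that by blast
    have F: "?I ([:- c0:] + [:- c1:] * a + [:- c2:] * a^2 + [:- c3:] * a^3 + [:1:] * a^4)"
      if "a = m \<or> a = frob 0 \<or> a = frob 1 \<or> a = frob 2 \<or> a = frob 3" for a
      using FM Fa that unfolding pcompose_quartic by blast
    have 1: "?I ([:- c3:] + [:1:] * (frob 0 + frob 1 + frob 2 + frob 3))"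
      by (rule divided_differences(1)[of ?I "frob 0" "frob 1" "frob 2" "frob 3" "[:- c0:]" "[:- c1:]" "[:- c2:]"])
        (rule add; assumption | erule nz, rule nf; simp | rule F; blast)+
    \<comment> \<open>As in \<open>1\<close>, the cubic coefficient determines the sum of four
      distinct roots, this time with \<open>m\<close> in place of \<open>frob 3\<close>. Subtracting
      identifies \<open>m\<close> with \<open>frob 3\<close>.\<close>
    have 2: "?I ([:- c3:] + [:1:] * (frob 0 + frob 1 + frob 2 + m))"
      by (rule divided_differences(1)[of ?I "frob 0" "frob 1" "frob 2" m "[:- c0:]" "[:- c1:]" "[:- c2:]"])
        (rule add; assumption | erule nz, (rule nf | rule ne); simp | rule F; blast)+
    have one: "[:1:] * x = x" for x :: "'a poly" by simp
    have e: "(k + l * (s + frob 3)) - (k + l * (s + m)) = l * (frob 3 - m)" for k l s :: "'a poly"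
      by (simp add: algebra_simps)
    have "?I ([:1:] * (frob 3 - m))" using add[OF 1 2] unfolding e .
    then have "?I (frob 3 - m)" unfolding one .
    then show False using ne[of 3] by simp
  qed
qed

end

section \<open>The Suzuki generators as linear maps\<close>

text \<open>The map \<open>th\<close> is a square root of the Frobenius map. Working from these
  equations turns the later matrix computations into identities without exponents depending on
  \<open>p\<close>.\<close>

locale suzuki_field =
  fixes th :: "'a::{field,finite} \<Rightarrow> 'a"
  assumes th_add: "th (x + y) = th x + th y" and th_mult: "th (x * y) = th x * th y"
    and th_th: "th (th x) = x * x" and th_one: "th 1 = 1" and char2: "(1::'a) + 1 = 0"
begin

text \<open>Last entry in the first column of a unipotent generator, and the function whose graph is
  the affine part of the Tits ovoid.\<close>

definition N :: "'a \<Rightarrow> 'a \<Rightarrow> 'a" where "N a b = a * a * th a + a * b + th b"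

lemma two0: "(2::'a) = 0" using char2 by simp

lemma add_self: "x + x = (0::'a)" using two0 mult_2[of x] by simp
lemma add_self_left: "x + (x + y) = (y::'a)" by (simp add: add.assoc[symmetric] add_self)
lemma minus_eq_self: "- x = (x::'a)" using add_self[of x] by (rule minus_unique)
lemma th_zero [simp]: "th 0 = 0" using th_add[of 0 0] unfolding add_self by simp
lemma th_zero_iff [simp]: "th x = 0 \<longleftrightarrow> x = 0"
  using th_th[of x] by auto
lemma th_inj: "th x = th y \<longleftrightarrow> x = y"
proof
  assume "th x = th y"
  then have "th (x + y) = 0" by (simp only: th_add add_self)
  then have "y + x = 0" by (simp add: add.commute)
  then have "- y = x" by (rule minus_unique)
  then show "x = y" by (simp only: minus_eq_self)
qed simp
lemma th_div: "th (x / y) = th x / th y"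
proof (cases "y = 0")
  case False
  then have "th (x / y) * th y = th x" by (simp flip: th_mult)
  then show ?thesis using False by (simp add: eq_divide_eq)
qed simp
lemma th_surj: "\<exists>y. th y = x"
proof -
  have "inj th" by (rule injI) (simp only: th_inj)
  then have "surj th" by (simp add: finite_UNIV_inj_surj)
  then show ?thesis by (metis surjD)
qed

lemma N_zero [simp]: "N 0 0 = 0" by (simp add: N_def)

lemma th_N: "th (N a b) = th a * th a * a * a + th a * th b + b * b"
  by (simp add: N_def th_add th_mult th_th algebra_simps)

text \<open>The cleared-denominator form of \<open>N_swap\<close>. At N a b = 0 it leaves b^2 th b =
  0, which is how \<open>N\<close> is shown to vanish only at the origin.\<close>

lemma N_key: "b * b * th b + a * b * th (N a b) + th a * N a b * N a b = N a b * th (N a b)"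
  unfolding th_N unfolding N_def by (simp add: algebra_simps add_self add_self_left)

lemma N_eq_zero: "N a b = 0 \<longleftrightarrow> a = 0 \<and> b = 0"
proof
  assume n: "N a b = 0"
  then have "b * b * th b = 0" using N_key[of b a] by simp
  then have "b = 0" by simp
  then show "a = 0 \<and> b = 0" using n by (simp add: N_def)
qed simp

text \<open>Applying \<open>th\<close> to the equation multiplies its left side by \<open>k\<close>,
  because \<open>th (th k)\<close> is the square of \<open>k\<close>.\<close>

lemma mult_th_one: "k * th k = 1 \<Longrightarrow> k = 1"
proof -
  assume k: "k * th k = 1"
  then have "th (k * th k) = 1" using th_one by simp
  then have "k * (k * th k) = 1" by (simp add: th_mult th_th ac_simps)
  then show "k = 1" using k by simp
qed

lemma th_eq_one: "th k = 1 \<longleftrightarrow> k = 1" using th_inj[of k 1] th_one by simp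

lemma th_fixed: "th r = r \<Longrightarrow> r = 0 \<or> r = 1"
  using th_th[of r] by auto

text \<open>Iterating the equation would make \<open>th (th c)\<close>, the square of
  \<open>c\<close>, equal to \<open>c\<close>; then \<open>c\<close> is 0 or 1 and fixed by
  \<open>th\<close>. Used to see that 1 is not of the form r + th r.\<close>

lemma th_ne_add_one: "th c \<noteq> c + 1"
proof
  assume e: "th c = c + 1"
  then have "th (th c) = c" by (simp add: th_add th_one add_self add.assoc)
  then have "c = 0 \<or> c = 1" using th_th[of c] by auto
  then show False using e add_self by (auto simp: th_one two0)
qed

definition tT :: "'a \<Rightarrow> 'a \<Rightarrow> 'a \<times> 'a \<times> 'a \<times> 'a \<Rightarrow> 'a \<times> 'a \<times> 'a \<times> 'a" where
  "tT a b = (\<lambda>(x, y, z, w). (x, a * x + y, b * x + th a * y + z, N a b * x + (a * th a + b) * y + a * z + w))"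

text \<open>The parameter \<open>u\<close> corresponds to \<open>l = th u\<close> in the defining
  matrices: the power of \<open>l\<close> occurring there is then \<open>u\<close>, and all entries
  are rational in \<open>u\<close> and \<open>th u\<close>.\<close>

definition tD :: "'a \<Rightarrow> 'a \<times> 'a \<times> 'a \<times> 'a \<Rightarrow> 'a \<times> 'a \<times> 'a \<times> 'a" where
  "tD u = (\<lambda>(x, y, z, w). (u * th u * x, u * y, z / u, w / (u * th u)))"

definition tW :: "'a \<times> 'a \<times> 'a \<times> 'a \<Rightarrow> 'a \<times> 'a \<times> 'a \<times> 'a" where
  "tW = (\<lambda>(x, y, z, w). (w, z, y, x))"

lemma tT_zero: "tT 0 0 v = v" by (cases v) (simp add: tT_def)

lemma tT_tT: "tT a b (tT c d v) = tT (a + c) (b + d + th a * c) v"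
  by (cases v) (simp add: tT_def N_def th_add th_mult th_th algebra_simps add_self add_self_left)

lemma tD_tD: "tD u (tD v x) = tD (u * v) x"
  by (cases x) (simp add: tD_def th_mult ac_simps)

lemma tD_one: "tD 1 x = x" by (cases x) (simp add: tD_def th_one)

lemma tW_tW: "tW (tW v) = v" by (cases v) (simp add: tW_def)

lemma tW_tD: "tW (tD u v) = tD (1 / u) (tW v)"
  by (cases v) (simp add: tW_def tD_def th_div th_one)

lemma tD_tT: "u \<noteq> 0 \<Longrightarrow> tD u (tT a b v) = tT (a / th u) (b / (u * u * th u)) (tD u v)"
  by (cases v) (simp add: tT_def tD_def N_def th_div th_mult th_th field_simps)

text \<open>Reversing the coordinates of (1, a, b, N a b) and rescaling the first one to 1 gives
  again a point of the ovoid.\<close>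

lemma N_swap:
  assumes ab: "a \<noteq> 0 \<or> b \<noteq> 0" shows "N (b / N a b) (a / N a b) = 1 / N a b"
proof -
  have n0: "N a b \<noteq> 0" using ab N_eq_zero by auto
  then have m0: "th (N a b) \<noteq> 0" by simp
  have "N (b / N a b) (a / N a b) =
      (b * b * th b + a * b * th (N a b) + th a * N a b * N a b) / (N a b * N a b * th (N a b))"
    using n0 m0 by (simp add: N_def[of "b / N a b"] th_div field_simps)
  then show ?thesis using n0 m0 by (simp only: N_key) simp
qed

text \<open>The relation behind the Bruhat decomposition. Its parameters can be read off from the
  ovoid: (b/n, a/n) is the image of infinity under W T(a,b) W, and (al, be) is the point which that
  map sends to the origin's partner under W, namely infinity. The diagonal parameter th n / n is the
  solution u of u th u = n.\<close>

lemma tW_tT_tW: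
  assumes ab: "a \<noteq> 0 \<or> b \<noteq> 0" and n: "n = N a b"
    and al: "al = (b + a * th a) / n" and be: "be = a / n"
  shows "tW (tT a b (tW (tT al be v))) = tT (b / n) (a / n) (tD (th n / n) (tW v))"
proof -
  \<comment> \<open>With \<open>A\<close>, \<open>B\<close>, \<open>n\<close>, \<open>m\<close>
    abbreviating the \<open>th\<close>-values involved, the entries become rational expressions;
    after clearing denominators, \<open>nn\<close>, \<open>mm\<close> and \<open>key\<close> reduce
    each comparison to cancellation in characteristic 2.\<close>
  define A B m where "A = th a" and "B = th b" and "m = th n"
  have n0: "n \<noteq> 0" using ab n N_eq_zero by auto
  then have m0: "m \<noteq> 0" by (simp add: m_def)
  have nn: "n = a * a * A + a * b + B" by (simp add: n N_def A_def B_def)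
  have mm: "m = A * A * a * a + A * B + b * b" by (simp add: m_def n th_N A_def B_def)
  have key: "b * b * B + a * b * m + A * n * n = n * m" using N_key[of b a] by (simp add: n m_def A_def B_def)
  have tha: "th al = (B + A * a * a) / m" by (simp add: al th_div th_add th_mult th_th A_def B_def m_def ac_simps)
  have al': "al = (b + a * A) / n" by (simp add: al A_def)
  have thb: "th be = A / m" by (simp add: be th_div A_def m_def)
  have E4: "N (b / n) (a / n) = 1 / n" unfolding n by (rule N_swap[OF ab])
  have E1: "N al be = 1 / n"
  proof -
    have "N al be = ((b + a * A) * (b + a * A) * (B + A * a * a) + (b + a * A) * a * m + A * n * n) / (n * n * m)"
      using n0 m0 unfolding N_def tha thb unfolding al' be by (simp add: field_simps)
    also have "(b + a * A) * (b + a * A) * (B + A * a * a) + (b + a * A) * a * m = b * b * B + a * b * m"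
      unfolding mm by (simp add: algebra_simps add_self add_self_left)
    finally show ?thesis unfolding key using n0 m0 by simp
  qed
  have E2: "al * th al + be = b / m"
  proof -
    have "al * th al + be = ((b + a * A) * (B + A * a * a) + a * m) / (n * m)"
      unfolding tha unfolding al' be using n0 m0 by (simp add: field_simps)
    also have "(b + a * A) * (B + A * a * a) + a * m = b * n" unfolding mm nn by (simp add: algebra_simps add_self add_self_left)
    finally show ?thesis using n0 by simp
  qed
  have E3: "((b / n) * (B / m) + a / n) * (m / n) = al"
  proof -
    have "((b / n) * (B / m) + a / n) * (m / n) = (b * B + a * m) / (n * n)"
      using n0 m0 by (simp add: field_simps)
    also have "b * B + a * m = (b + a * A) * n" unfolding mm nn by (simp add: algebra_simps add_self add_self_left)
    finally show ?thesis unfolding al' using n0 by simp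
  qed
  have thmm: "th m = n * n" unfolding m_def th_th ..
  have uu: "m / n * th (m / n) = n" using n0 m0 by (simp add: th_div thmm m_def[symmetric])
  have y1: "a * (b / m) + (B + A * a * a) / m = n / m" unfolding nn by (simp add: add_divide_distrib[symmetric] ac_simps)
  have z1: "a * al + 1 = B / n"
  proof -
    have "a * al + 1 = (a * (b + a * A) + n) / n" unfolding al' using n0 by (simp add: field_simps)
    also have "a * (b + a * A) + n = B" unfolding nn by (simp add: algebra_simps add_self add_self_left)
    finally show ?thesis .
  qed
  have x2: "b * (1 / n) + A * be + al = 0" unfolding be al'
    using n0 by (simp add: add_divide_distrib[symmetric] ac_simps add_self add_self_left)
  have y2: "b * (b / m) + A * ((B + A * a * a) / m) + 1 = 0"
  proof -
    have "b * (b / m) + A * ((B + A * a * a) / m) + 1 = (b * b + A * (B + A * a * a) + m) / m"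
      using m0 by (simp add: field_simps)
    also have "b * b + A * (B + A * a * a) + m = 0" unfolding mm by (simp add: algebra_simps add_self add_self_left)
    finally show ?thesis by simp
  qed
  have z2: "b * al + A = m / n"
  proof -
    have "b * al + A = (b * (b + a * A) + A * n) / n" unfolding al' using n0 by (simp add: field_simps)
    also have "b * (b + a * A) + A * n = m" unfolding mm nn by (simp add: algebra_simps add_self add_self_left)
    finally show ?thesis .
  qed
  have x3: "(a * A + b) * be + a * al = 0" unfolding be al'
    using n0 by (simp add: field_simps add_self add_self_left)
  have y3: "n * (b / m) + (a * A + b) * ((B + A * a * a) / m) + a = 0"
  proof -
    have "n * (b / m) + (a * A + b) * ((B + A * a * a) / m) + a = (n * b + (a * A + b) * (B + A * a * a) + a * m) / m"
      using m0 by (simp add: field_simps)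
    also have "n * b + (a * A + b) * (B + A * a * a) + a * m = 0" unfolding mm nn by (simp add: algebra_simps add_self add_self_left)
    finally show ?thesis by simp
  qed
  have z3: "n * al + (a * A + b) = 0" unfolding al' using n0 by (simp add: ac_simps add_self add_self_left)
  obtain x y z w where v: "v = (x, y, z, w)" by (cases v)
  define Wd where "Wd = (1 / n) * x + (b / m) * y + al * z + w"
  have W1: "tT al be v = (x, al * x + y, be * x + (B + A * a * a) / m * y + z, Wd)"
    unfolding v tT_def prod.case E1 E2 unfolding tha Wd_def ..
  have L: "tW (tT a b (tW (tT al be v))) =
      (n * Wd + (a * A + b) * (be * x + (B + A * a * a) / m * y + z) + a * (al * x + y) + x,
       b * Wd + A * (be * x + (B + A * a * a) / m * y + z) + (al * x + y),
       a * Wd + (be * x + (B + A * a * a) / m * y + z), Wd)"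
    unfolding W1 by (simp add: tW_def tT_def n[symmetric] A_def[symmetric])
  have R: "tT (b / n) (a / n) (tD (th n / n) (tW v)) =
      (n * w, (b / n) * (n * w) + m / n * z, (a / n) * (n * w) + (B / m) * (m / n * z) + y / (m / n),
       (1 / n) * (n * w) + ((b / n) * (B / m) + a / n) * (m / n * z) + (b / n) * (y / (m / n)) + x / n)"
    unfolding v tW_def tD_def tT_def prod.case m_def[symmetric] uu E4
    unfolding th_div B_def[symmetric] m_def[symmetric] ..
  have p1: "n * Wd + (a * A + b) * (be * x + (B + A * a * a) / m * y + z) + a * (al * x + y) + x = n * w"
  proof -
    have "n * Wd + (a * A + b) * (be * x + (B + A * a * a) / m * y + z) + a * (al * x + y) + x
      = ((a * A + b) * be + a * al) * x + (n * (1 / n) * x + x) + (n * (b / m) + (a * A + b) * ((B + A * a * a) / m) + a) * y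
        + (n * al + (a * A + b)) * z + n * w" unfolding Wd_def by (simp only: ring_distribs ac_simps)
    also have "\<dots> = n * w" unfolding x3 y3 z3 using n0 by (simp add: add_self)
    finally show ?thesis .
  qed
  have p2: "b * Wd + A * (be * x + (B + A * a * a) / m * y + z) + (al * x + y) = (b / n) * (n * w) + m / n * z"
  proof -
    have "b * Wd + A * (be * x + (B + A * a * a) / m * y + z) + (al * x + y)
      = (b * (1 / n) + A * be + al) * x + (b * (b / m) + A * ((B + A * a * a) / m) + 1) * y
        + (b * al + A) * z + b * w" unfolding Wd_def by (simp only: ring_distribs ac_simps mult_1_left mult_1_right)
    also have "\<dots> = (b / n) * (n * w) + m / n * z" unfolding x2 y2 z2 using n0 by simp
    finally show ?thesis .
  qed
  have p3: "a * Wd + (be * x + (B + A * a * a) / m * y + z) = (a / n) * (n * w) + (B / m) * (m / n * z) + y / (m / n)"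
  proof -
    have "a * Wd + (be * x + (B + A * a * a) / m * y + z)
      = (a * (1 / n) + be) * x + (a * (b / m) + (B + A * a * a) / m) * y + (a * al + 1) * z + a * w"
      unfolding Wd_def by (simp only: ring_distribs ac_simps mult_1_left mult_1_right)
    also have "\<dots> = (a / n) * (n * w) + (B / m) * (m / n * z) + y / (m / n)"
      unfolding y1 z1 be using n0 m0 by (simp add: add_self)
    finally show ?thesis .
  qed
  have p4: "Wd = (1 / n) * (n * w) + ((b / n) * (B / m) + a / n) * (m / n * z) + (b / n) * (y / (m / n)) + x / n"
  proof -
    have q1: "((b / n) * (B / m) + a / n) * (m / n * z) = al * z" unfolding E3[symmetric] by (simp only: mult.assoc)
    have q2: "(b / n) * (y / (m / n)) = b / m * y" using n0 by simp
    have q3: "(1 / n) * (n * w) = w" using n0 by simp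
    show ?thesis unfolding Wd_def q1 q2 q3 by (simp add: ac_simps)
  qed
  show ?thesis unfolding L R p1 p2 p3 using p4 by simp
qed

end

section \<open>Bruhat decomposition and the action on the ovoid\<close>

text \<open>The group stays abstract and is known through a faithful linear action on quadruples, so
  each relation among generators becomes an identity of explicit maps.\<close>

locale suzuki_model = suzuki_field th + group G for th :: "'a::{field,finite} \<Rightarrow> 'a" and G :: "('g, 'b) monoid_scheme" (structure) +
  fixes lin :: "'g \<Rightarrow> 'a \<times> 'a \<times> 'a \<times> 'a \<Rightarrow> 'a \<times> 'a \<times> 'a \<times> 'a"
    and T :: "'a \<Rightarrow> 'a \<Rightarrow> 'g" and D :: "'a \<Rightarrow> 'g" and W :: 'g and p q :: nat
  assumes lin_mult: "x \<in> carrier G \<Longrightarrow> y \<in> carrier G \<Longrightarrow> lin (x \<otimes> y) v = lin x (lin y v)"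
    and lin_one: "lin \<one> v = v"
    and lin_inj: "x \<in> carrier G \<Longrightarrow> y \<in> carrier G \<Longrightarrow> (\<And>v. lin x v = lin y v) \<Longrightarrow> x = y"
    and lin_add: "x \<in> carrier G \<Longrightarrow> lin x (v + v') = lin x v + lin x v'"
    and lin_scale: "x \<in> carrier G \<Longrightarrow>
      lin x (case v of (x0, x1, x2, x3) \<Rightarrow> (c * x0, c * x1, c * x2, c * x3))
        = (case lin x v of (x0, x1, x2, x3) \<Rightarrow> (c * x0, c * x1, c * x2, c * x3))"
    and T_in [simp]: "T a b \<in> carrier G" and D_in [simp]: "u \<noteq> 0 \<Longrightarrow> D u \<in> carrier G" and W_in [simp]: "W \<in> carrier G"
    and lin_T: "lin (T a b) v = tT a b v" and lin_D: "u \<noteq> 0 \<Longrightarrow> lin (D u) v = tD u v" and lin_W: "lin W v = tW v"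
    and gen: "carrier G = generate G ({T a b | a b. True} \<union> {D u | u. u \<noteq> 0} \<union> {W})"
    and q: "q = 2 ^ p" and p: "odd p" "3 \<le> p" and card_a: "card (UNIV :: 'a set) = q"
begin

definition sc :: "'a \<Rightarrow> 'a \<times> 'a \<times> 'a \<times> 'a \<Rightarrow> 'a \<times> 'a \<times> 'a \<times> 'a" where
  "sc c v = (case v of (x0, x1, x2, x3) \<Rightarrow> (c * x0, c * x1, c * x2, c * x3))"

lemma lin_sc: "x \<in> carrier G \<Longrightarrow> lin x (sc c v) = sc c (lin x v)"
  unfolding sc_def by (rule lin_scale)

lemma sc_sc: "sc c (sc d v) = sc (c * d) v"
  by (cases v) (simp add: sc_def ac_simps)

lemma T_T: "T a b \<otimes> T c d = T (a + c) (b + d + th a * c)"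
  by (rule lin_inj) (simp_all add: lin_mult lin_T tT_tT)

lemma T_zero: "T 0 0 = \<one>"
  by (rule lin_inj) (simp_all add: lin_one lin_T tT_zero)

lemma T_eq: "T a b = T c d \<longleftrightarrow> a = c \<and> b = d"
proof
  assume "T a b = T c d"
  then have "tT a b (1, 0, 0, 0) = tT c d (1, 0, 0, 0)" by (simp flip: lin_T)
  then show "a = c \<and> b = d" by (simp add: tT_def)
qed simp

lemma T_one: "T a b = \<one> \<longleftrightarrow> a = 0 \<and> b = 0"
  using T_eq[of a b 0 0] by (simp add: T_zero)

lemma D_D: "u \<noteq> 0 \<Longrightarrow> v \<noteq> 0 \<Longrightarrow> D u \<otimes> D v = D (u * v)"
  by (rule lin_inj) (simp_all add: lin_mult lin_D tD_tD)

lemma D_one: "D 1 = \<one>"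
  by (rule lin_inj) (simp_all add: lin_one lin_D tD_one)

lemma D_eq: "u \<noteq> 0 \<Longrightarrow> v \<noteq> 0 \<Longrightarrow> D u = D v \<longleftrightarrow> u = v"
proof
  assume uv: "u \<noteq> 0" "v \<noteq> 0" "D u = D v"
  then have "tD u (0, 1, 0, 0) = tD v (0, 1, 0, 0)" by (simp flip: lin_D)
  then show "u = v" by (simp add: tD_def)
qed simp

lemma W_W: "W \<otimes> W = \<one>"
  by (rule lin_inj) (simp_all add: lin_mult lin_W tW_tW lin_one)

lemma W_D: "u \<noteq> 0 \<Longrightarrow> W \<otimes> D u = D (1 / u) \<otimes> W"
  by (rule lin_inj) (simp_all add: lin_mult lin_W lin_D tW_tD)

lemma D_T: "u \<noteq> 0 \<Longrightarrow> D u \<otimes> T a b = T (a / th u) (b / (u * u * th u)) \<otimes> D u"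
  by (rule lin_inj) (simp_all add: lin_mult lin_T lin_D tD_tT)

lemma inv_T: "inv (T a b) = T a (b + a * th a)"
  by (rule inv_equality) (simp_all add: T_T add_self add_self_left T_zero ac_simps)

lemma inv_D: "u \<noteq> 0 \<Longrightarrow> inv (D u) = D (1 / u)"
  by (rule inv_equality) (simp_all add: D_D D_one)

lemma inv_W: "inv W = W"
  by (rule inv_equality) (simp_all add: W_W)

lemma W_T_W:
  assumes "a \<noteq> 0 \<or> b \<noteq> 0"
  shows "\<exists>c d u e f. u \<noteq> 0 \<and> W \<otimes> (T a b \<otimes> W) = T c d \<otimes> (D u \<otimes> (W \<otimes> T e f))"
proof -
  define n where "n = N a b"
  define al where "al = (b + a * th a) / n"
  define be where "be = a / n"
  have n0: "n \<noteq> 0" using assms N_eq_zero by (auto simp: n_def)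
  then have u0: "th n / n \<noteq> 0" by simp
  have e: "W \<otimes> (T a b \<otimes> (W \<otimes> T al be)) = T (b / n) (a / n) \<otimes> (D (th n / n) \<otimes> W)"
    by (rule lin_inj) (use u0 in \<open>simp_all add: lin_mult lin_W lin_T lin_D tW_tT_tW[OF assms n_def al_def be_def] del: divide_eq_0_iff\<close>)
  have "W \<otimes> (T a b \<otimes> W) = (W \<otimes> (T a b \<otimes> (W \<otimes> T al be))) \<otimes> inv (T al be)"
    by (simp add: m_assoc)
  also have "\<dots> = T (b / n) (a / n) \<otimes> (D (th n / n) \<otimes> (W \<otimes> T al (be + al * th al)))"
    unfolding e inv_T using D_in[OF u0] by (simp add: m_assoc del: D_in)
  finally show ?thesis using u0 by blast
qed

text \<open>The two Bruhat cells: the stabilizer of infinity, and its complement with the diagonal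
  factor moved to the right end.\<close>

definition Gam :: "'g set" where
  "Gam = {T a b \<otimes> D u | a b u. u \<noteq> 0} \<union> {T a b \<otimes> (W \<otimes> (T c d \<otimes> D u)) | a b c d u. u \<noteq> 0}"

lemma GamI1: "u \<noteq> 0 \<Longrightarrow> T a b \<otimes> D u \<in> Gam" by (auto simp: Gam_def)
lemma GamI2: "u \<noteq> 0 \<Longrightarrow> T a b \<otimes> (W \<otimes> (T c d \<otimes> D u)) \<in> Gam" by (auto simp: Gam_def)

lemma GamE:
  assumes "x \<in> Gam"
  obtains a b u where "u \<noteq> 0" "x = T a b \<otimes> D u"
  | a b c d u where "u \<noteq> 0" "x = T a b \<otimes> (W \<otimes> (T c d \<otimes> D u))"
  using assms unfolding Gam_def by blast

lemma Gam_carrier: "x \<in> Gam \<Longrightarrow> x \<in> carrier G"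
  by (erule GamE) simp_all

lemma T_T_assoc: "x \<in> carrier G \<Longrightarrow> T a b \<otimes> (T c d \<otimes> x) = T (a + c) (b + d + th a * c) \<otimes> x"
  by (simp add: T_T flip: m_assoc)

lemma D_T_assoc: "u \<noteq> 0 \<Longrightarrow> x \<in> carrier G \<Longrightarrow>
    D u \<otimes> (T a b \<otimes> x) = T (a / th u) (b / (u * u * th u)) \<otimes> (D u \<otimes> x)"
  using D_T[of u a b] by (simp flip: m_assoc)

lemma D_W_assoc: "u \<noteq> 0 \<Longrightarrow> x \<in> carrier G \<Longrightarrow> D u \<otimes> (W \<otimes> x) = W \<otimes> (D (1 / u) \<otimes> x)"
  using W_D[of "1 / u"] by (simp flip: m_assoc)

lemma Gam_T: "x \<in> Gam \<Longrightarrow> T a b \<otimes> x \<in> Gam"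
  by (erule GamE) (simp_all add: T_T_assoc GamI1 GamI2)

lemma Gam_D: "x \<in> Gam \<Longrightarrow> v \<noteq> 0 \<Longrightarrow> D v \<otimes> x \<in> Gam"
  by (erule GamE) (simp_all add: D_T_assoc D_W_assoc D_D GamI1 GamI2)

text \<open>Two occurrences of \<open>W\<close> meet. With a trivial unipotent between them they
  cancel; otherwise \<open>W_T_W\<close> rewrites them with a single \<open>W\<close>.\<close>

lemma Gam_W: "x \<in> Gam \<Longrightarrow> W \<otimes> x \<in> Gam"
proof (erule GamE)
  fix a b u assume u: "u \<noteq> 0" and x: "x = T a b \<otimes> D u"
  have "W \<otimes> x = T 0 0 \<otimes> (W \<otimes> (T a b \<otimes> D u))" using u by (simp add: T_zero x)
  then show ?thesis using GamI2[OF u] by simp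
next
  fix a b c d u assume u: "u \<noteq> 0" and x: "x = T a b \<otimes> (W \<otimes> (T c d \<otimes> D u))"
  show ?thesis
  proof (cases "a = 0 \<and> b = 0")
    case True
    then have "W \<otimes> x = (W \<otimes> W) \<otimes> (T c d \<otimes> D u)" using u by (simp add: x T_zero m_assoc)
    then show ?thesis using GamI1[OF u] u by (simp add: W_W)
  next
    case False
    then obtain c' d' v e f where v: "v \<noteq> 0"
      and e: "W \<otimes> (T a b \<otimes> W) = T c' d' \<otimes> (D v \<otimes> (W \<otimes> T e f))" using W_T_W by blast
    have "W \<otimes> x = (W \<otimes> (T a b \<otimes> W)) \<otimes> (T c d \<otimes> D u)" using u by (simp add: x m_assoc)
    also have "\<dots> = T c' d' \<otimes> (D v \<otimes> (W \<otimes> (T e f \<otimes> (T c d \<otimes> D u))))" unfolding e using u v by (simp add: m_assoc)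
    also have "\<dots> = T c' d' \<otimes> (D v \<otimes> (T 0 0 \<otimes> (W \<otimes> (T (e + c) (f + d + th e * c) \<otimes> D u))))"
      using u v by (simp add: T_T_assoc T_zero)
    also have "\<dots> \<in> Gam" by (intro Gam_T Gam_D GamI2 u v)
    finally show ?thesis .
  qed
qed

lemma Gam_mult: "x \<in> Gam \<Longrightarrow> y \<in> Gam \<Longrightarrow> x \<otimes> y \<in> Gam"
proof -
  assume x: "x \<in> Gam" and y: "y \<in> Gam"
  have yG: "y \<in> carrier G" by (rule Gam_carrier[OF y])
  from x show ?thesis
  proof (rule GamE)
    fix a b u assume u: "u \<noteq> 0" and "x = T a b \<otimes> D u"
    then have "x \<otimes> y = T a b \<otimes> (D u \<otimes> y)" using yG by (simp add: m_assoc)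
    also have "\<dots> \<in> Gam" by (intro Gam_T Gam_D y u)
    finally show ?thesis .
  next
    fix a b c d u assume u: "u \<noteq> 0" and "x = T a b \<otimes> (W \<otimes> (T c d \<otimes> D u))"
    then have "x \<otimes> y = T a b \<otimes> (W \<otimes> (T c d \<otimes> (D u \<otimes> y)))" using yG by (simp add: m_assoc)
    also have "\<dots> \<in> Gam" by (intro Gam_T Gam_D Gam_W y u)
    finally show ?thesis .
  qed
qed

abbreviation "gens \<equiv> {T a b | a b. True} \<union> {D u | u. u \<noteq> 0} \<union> {W}"

lemma gens_inv: "x \<in> gens \<Longrightarrow> inv x \<in> gens"
  using inv_T inv_D inv_W by auto

lemma gens_Gam: "gens \<subseteq> Gam"
proof
  fix x assume "x \<in> gens"
  then consider a b where "x = T a b" | u where "u \<noteq> 0" "x = D u" | "x = W" by blast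
  then show "x \<in> Gam"
  proof cases
    case (1 a b) then show ?thesis using GamI1[of 1 a b] by (simp add: D_one)
  next
    case (2 u) then show ?thesis using GamI1[of u 0 0] by (simp add: T_zero)
  next
    case 3 then show ?thesis using GamI2[of 1 0 0 0 0] by (simp add: T_zero D_one)
  qed
qed

lemma carrier_Gam: "carrier G = Gam"
proof
  show "carrier G \<subseteq> Gam"
  proof
    fix x assume "x \<in> carrier G"
    then have "x \<in> generate G gens" using gen by simp
    then show "x \<in> Gam"
    proof (induction rule: generate.induct)
      case one show ?case using GamI1[of 1 0 0] by (simp add: T_zero D_one)
    next
      case (incl h) then show ?case using gens_Gam by blast
    next
      case (inv h) then show ?case using gens_Gam gens_inv by blast
    next
      case (eng h1 h2) then show ?case by (intro Gam_mult)
    qed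
  qed
qed (use Gam_carrier in blast)

text \<open>The Tits ovoid: \<open>None\<close> is the point at infinity.\<close>

fun pt :: "('a \<times> 'a) option \<Rightarrow> 'a \<times> 'a \<times> 'a \<times> 'a" where
  "pt None = (0, 0, 0, 1)"
| "pt (Some (a, b)) = (1, a, b, N a b)"

text \<open>Ovoid points are lines, so equality holds up to a nonzero scalar. A relation comes first
  because it is not evident that a general element preserves the ovoid; existence of the image is
  derived from the Bruhat form.\<close>

definition mv :: "'g \<Rightarrow> ('a \<times> 'a) option \<Rightarrow> ('a \<times> 'a) option \<Rightarrow> bool" where
  "mv g P Q \<longleftrightarrow> (\<exists>c. c \<noteq> 0 \<and> lin g (pt P) = sc c (pt Q))"

definition act :: "'g \<Rightarrow> ('a \<times> 'a) option \<Rightarrow> ('a \<times> 'a) option" where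
  "act g P = (THE Q. mv g P Q)"

lemma pt_unique: "c \<noteq> 0 \<Longrightarrow> d \<noteq> 0 \<Longrightarrow> sc c (pt P) = sc d (pt Q) \<Longrightarrow> P = Q"
  by (cases P; cases Q) (auto simp: sc_def)

lemma mv_unique: "mv g P Q \<Longrightarrow> mv g P R \<Longrightarrow> Q = R"
  unfolding mv_def using pt_unique by metis

lemma act_eq: "mv g P Q \<Longrightarrow> act g P = Q"
  unfolding act_def using mv_unique by (intro the_equality) auto

lemma mv_mult: "x \<in> carrier G \<Longrightarrow> y \<in> carrier G \<Longrightarrow> mv y P Q \<Longrightarrow> mv x Q R \<Longrightarrow> mv (x \<otimes> y) P R"
proof -
  assume G: "x \<in> carrier G" "y \<in> carrier G" and a: "mv y P Q" "mv x Q R"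
  obtain c d where c: "c \<noteq> 0" "lin y (pt P) = sc c (pt Q)" and d: "d \<noteq> 0" "lin x (pt Q) = sc d (pt R)"
    using a by (auto simp: mv_def)
  have "lin (x \<otimes> y) (pt P) = sc (c * d) (pt R)" using G c d by (simp add: lin_mult lin_sc sc_sc)
  then show ?thesis using c d unfolding mv_def by (intro exI[of _ "c * d"]) simp
qed

lemma sc_one: "sc 1 v = v" by (cases v) (simp add: sc_def)

lemma mv_T: "mv (T a b) None None" "mv (T a b) (Some (c, d)) (Some (a + c, b + d + th a * c))"
proof -
  have "tT a b (tT c d (1, 0, 0, 0)) = tT (a + c) (b + d + th a * c) (1, 0, 0, 0)" by (rule tT_tT)
  then have "lin (T a b) (pt (Some (c, d))) = sc 1 (pt (Some (a + c, b + d + th a * c)))"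
    by (simp add: lin_T sc_one) (simp add: tT_def)
  then show "mv (T a b) (Some (c, d)) (Some (a + c, b + d + th a * c))" unfolding mv_def by (intro exI[of _ 1]) simp
  show "mv (T a b) None None" unfolding mv_def by (intro exI[of _ 1]) (simp add: lin_T sc_def tT_def)
qed

lemma mv_D:
  assumes u: "u \<noteq> 0"
  shows "mv (D u) None None" "mv (D u) (Some (c, d)) (Some (c / th u, d / (u * u * th u)))"
proof -
  have u': "u * th u \<noteq> 0" using u by simp
  show "mv (D u) None None" unfolding mv_def
    using u u' by (intro exI[of _ "1 / (u * th u)"]) (simp add: lin_D sc_def tD_def)
  have "tD u (tT c d (1, 0, 0, 0)) = tT (c / th u) (d / (u * u * th u)) (tD u (1, 0, 0, 0))" by (rule tD_tT[OF u])
  then have "lin (D u) (pt (Some (c, d))) = sc (u * th u) (pt (Some (c / th u, d / (u * u * th u))))"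
    using u by (simp add: lin_D sc_def tT_def tD_def ac_simps)
  then show "mv (D u) (Some (c, d)) (Some (c / th u, d / (u * u * th u)))" unfolding mv_def using u' by blast
qed

lemma mv_W: "mv W None (Some (0, 0))" "mv W (Some (0, 0)) None"
  "c \<noteq> 0 \<or> d \<noteq> 0 \<Longrightarrow> mv W (Some (c, d)) (Some (d / N c d, c / N c d))"
proof -
  show "mv W None (Some (0, 0))" unfolding mv_def by (intro exI[of _ 1]) (simp add: lin_W sc_def tW_def)
  show "mv W (Some (0, 0)) None" unfolding mv_def by (intro exI[of _ 1]) (simp add: lin_W sc_def tW_def)
  assume cd: "c \<noteq> 0 \<or> d \<noteq> 0"
  then have n: "N c d \<noteq> 0" using N_eq_zero by auto
  then show "mv W (Some (c, d)) (Some (d / N c d, c / N c d))"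
    unfolding mv_def using N_swap[OF cd] by (intro exI[of _ "N c d"]) (simp add: lin_W sc_def tW_def)
qed

text \<open>By the Bruhat form every element is a product of generators, and each kind of generator
  maps the ovoid to itself.\<close>

lemma mv_ex: "g \<in> carrier G \<Longrightarrow> \<exists>Q. mv g P Q"
proof -
  have T: "\<exists>Q. mv (T a b) P Q" for a b P by (metis mv_T option.exhaust surj_pair)
  have D: "\<exists>Q. mv (D u) P Q" if "u \<noteq> 0" for u P by (metis mv_D[OF that] option.exhaust surj_pair)
  have W: "\<exists>Q. mv W P Q" for P
  proof (cases P)
    case None then show ?thesis using mv_W(1) by blast
  next
    case (Some a)
    obtain c d where "a = (c, d)" by (cases a)
    then show ?thesis using Some mv_W(2) mv_W(3)[of c d] by (cases "c = 0 \<and> d = 0") blast+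
  qed
  have m: "\<exists>Q. mv (x \<otimes> y) P Q" if "x \<in> carrier G" "y \<in> carrier G" "\<And>P. \<exists>Q. mv x P Q" "\<And>P. \<exists>Q. mv y P Q" for x y P
    using that mv_mult[of x y] by metis
  assume "g \<in> carrier G"
  then have "g \<in> Gam" using carrier_Gam by simp
  then show "\<exists>Q. mv g P Q"
  proof (rule GamE)
    fix a b u assume "u \<noteq> 0" "g = T a b \<otimes> D u"
    then show ?thesis using T D by (simp, intro m) simp_all
  next
    fix a b c d u assume "u \<noteq> 0" "g = T a b \<otimes> (W \<otimes> (T c d \<otimes> D u))"
    then show ?thesis using T D W by (simp, intro m) simp_all
  qed
qed

lemma mv_act: "g \<in> carrier G \<Longrightarrow> mv g P (act g P)"
  using mv_ex act_eq by metis

sublocale pa: point_action G act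
proof
  fix x y P assume "x \<in> carrier G" "y \<in> carrier G"
  then show "act (x \<otimes> y) P = act x (act y P)"
    by (intro act_eq mv_mult[OF _ _ mv_act mv_act])
next
  fix P show "act \<one> P = P" by (intro act_eq) (auto simp: mv_def lin_one sc_one intro!: exI[of _ 1])
qed

lemmas act_T [simp] = mv_T[THEN act_eq]
lemmas act_D [simp] = mv_D[THEN act_eq]
lemmas act_W [simp] = mv_W(1,2)[THEN act_eq]
lemmas act_W' = mv_W(3)[THEN act_eq]

lemma stab_None:
  assumes "x \<in> carrier G" "act x None = None" obtains a b u where "u \<noteq> 0" "x = T a b \<otimes> D u"
proof -
  have "x \<in> Gam" using assms(1) carrier_Gam by simp
  then show thesis
  proof (rule GamE)
    fix a b c d u assume "u \<noteq> 0" "x = T a b \<otimes> (W \<otimes> (T c d \<otimes> D u))"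
    then have "act x None = Some (a + 0, b + 0 + th a * 0)" by (simp add: pa.act_mult)
    then show thesis using assms(2) by simp
  qed (rule that)
qed

end

section \<open>Transport of stabilizers by conjugation\<close>

context point_action
begin

lemma uni_cj: "g \<in> carrier G \<Longrightarrow> x \<in> U P \<Longrightarrow> cj g x \<in> U (act g P)"
  by (auto simp: uni_def F_conj)

lemma uni_cj_image:
  assumes g: "g \<in> carrier G" shows "U (act g P) = cj g ` U P"
proof (rule antisym; rule subsetI)
  fix x assume x: "x \<in> U (act g P)"
  then have xG: "x \<in> carrier G" by (simp add: uni_def)
  have "cj (inv g) x \<in> U P" using uni_cj[of "inv g" x "act g P"] x g by simp
  moreover have "x = cj g (cj (inv g) x)" using g xG by simp
  ultimately show "x \<in> cj g ` U P" by (rule rev_image_eqI)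
next
  fix x assume "x \<in> cj g ` U P" then show "x \<in> U (act g P)" using uni_cj[OF g] by auto
qed

lemma stab2_iff: "x \<in> T2 P Q \<longleftrightarrow> x \<in> carrier G \<and> P \<in> F x \<and> Q \<in> F x"
  by (simp add: stab2_def F_iff)

lemma stab2_cj_image:
  assumes g: "g \<in> carrier G" shows "T2 (act g P) (act g Q) = cj g ` T2 P Q"
proof (rule antisym; rule subsetI)
  fix x assume x: "x \<in> T2 (act g P) (act g Q)"
  then have xG: "x \<in> carrier G" by (simp add: stab2_def)
  have "F (cj (inv g) x) = act (inv g) ` F x" using g xG by (simp add: F_conj)
  then have "cj (inv g) x \<in> T2 P Q"
    using x g xG unfolding stab2_iff by (metis act_inv cj_closed image_eqI inv_closed)
  moreover have "x = cj g (cj (inv g) x)" using g xG by simp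
  ultimately show "x \<in> cj g ` T2 P Q" by (rule rev_image_eqI)
next
  fix x assume "x \<in> cj g ` T2 P Q" then show "x \<in> T2 (act g P) (act g Q)"
    using g by (auto simp: stab2_iff F_conj)
qed

lemma card_cj_image: "g \<in> carrier G \<Longrightarrow> A \<subseteq> carrier G \<Longrightarrow> card (cj g ` A) = card A"
  by (rule card_image, rule inj_onI) (metis cj_inj subsetD)

end

section \<open>Verification of the action properties for the Suzuki group\<close>

context suzuki_model
begin

lemma finite_carrier: "finite (carrier G)"
proof -
  have "inj_on lin (carrier G)" by (rule inj_onI) (rule lin_inj, auto)
  then show ?thesis by (rule inj_on_finite[of lin _ UNIV]) auto
qed

lemma q_gt: "q \<ge> 8" "even q" "q mod 3 = 2"
proof -
  have "2 ^ 3 \<le> (2::nat) ^ p" using p(2) by (intro power_increasing) auto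
  then show "q \<ge> 8" by (simp add: q)
  show "even q" using p by (simp add: q)
  obtain k where k: "p = 2 * k + 1" using p(1) by (rule oddE)
  have "(4::nat) ^ k mod 3 = 1" using power_mod[of "4::nat" 3 k] by simp
  then have "(2 * 4 ^ k) mod (3::nat) = 2" using mod_mult_right_eq[of "2::nat" "4 ^ k" 3] by simp
  moreover have "q = 2 * 4 ^ k" unfolding q k by (simp add: power_mult)
  ultimately show "q mod 3 = 2" by simp
qed

lemma card_pts: "card (UNIV :: ('a \<times> 'a) option set) = q\<^sup>2 + 1"
proof -
  have "card (UNIV :: ('a \<times> 'a) set) = q * q" by (simp only: UNIV_Times_UNIV[symmetric] card_cartesian_product card_a)
  then show ?thesis by (simp add: UNIV_option_conv card_image power2_eq_square)
qed

lemma trans1: "\<exists>g\<in>carrier G. act g None = P"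
proof (cases P)
  case None then show ?thesis using pa.act_one by blast
next
  case (Some a)
  obtain c d where "a = (c, d)" by (cases a)
  then have "act (T c d \<otimes> W) None = P" using Some by (simp add: pa.act_mult)
  then show ?thesis using m_closed[OF T_in W_in] by blast
qed

lemma trans0:
  assumes "P \<noteq> Q" shows "\<exists>g\<in>carrier G. act g None = P \<and> act g (Some (0, 0)) = Q"
proof -
  obtain g where g: "g \<in> carrier G" "act g None = P" using trans1 by blast
  have "act (inv g) Q \<noteq> None" using g assms pa.act_inv' by metis
  then obtain c d where cd: "act (inv g) Q = Some (c, d)" by (metis option.exhaust surj_pair)
  have "act (g \<otimes> T c d) (Some (0, 0)) = act g (act (inv g) Q)" using g(1) by (simp add: pa.act_mult cd)
  then have "act (g \<otimes> T c d) (Some (0, 0)) = Q" using g(1) by simp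
  moreover have "act (g \<otimes> T c d) None = P" using g by (simp add: pa.act_mult)
  ultimately show ?thesis using m_closed[OF g(1) T_in] by blast
qed

lemma transitive2:
  assumes "P \<noteq> Q" "P' \<noteq> Q'" shows "\<exists>g\<in>carrier G. act g P = P' \<and> act g Q = Q'"
proof -
  obtain g h where g: "g \<in> carrier G" "act g None = P" "act g (Some (0, 0)) = Q"
    and h: "h \<in> carrier G" "act h None = P'" "act h (Some (0, 0)) = Q'" using trans0 assms by metis
  have "act (h \<otimes> inv g) P = P'" "act (h \<otimes> inv g) Q = Q'"
    using g h pa.act_inv_fix[OF g(1) g(2)] pa.act_inv_fix[OF g(1) g(3)] by (simp_all add: pa.act_mult)
  then show ?thesis using g(1) h(1) by blast
qed

lemma stab2_base: "stab2 G act None (Some (0, 0)) = D ` {u. u \<noteq> 0}"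
proof (rule antisym; rule subsetI)
  fix x assume "x \<in> stab2 G act None (Some (0, 0))"
  then have x: "x \<in> carrier G" "act x None = None" "act x (Some (0, 0)) = Some (0, 0)" by (auto simp: stab2_def)
  obtain a b u where u: "u \<noteq> 0" "x = T a b \<otimes> D u" by (rule stab_None[OF x(1,2)])
  have "a = 0 \<and> b = 0" using x(3) u by (simp add: pa.act_mult)
  then show "x \<in> D ` {u. u \<noteq> 0}" using u by (simp add: T_zero)
qed (auto simp: stab2_def)

lemma D_fix: "u \<noteq> 0 \<Longrightarrow> act (D u) (Some (c, d)) = Some (c, d) \<Longrightarrow> (c, d) \<noteq> (0, 0) \<Longrightarrow> u = 1"
proof -
  assume u: "u \<noteq> 0" and a: "act (D u) (Some (c, d)) = Some (c, d)" and cd: "(c, d) \<noteq> (0, 0)"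
  have "c / th u = c" "d / (u * u * th u) = d" using a u by auto
  then have e: "c * th u = c" "d * (u * u * th u) = d" using u by (auto simp: divide_eq_eq)
  show "u = 1"
  proof (cases "c = 0")
    case False then have "th u = 1" using e(1) by simp
    then show ?thesis by (simp only: th_eq_one)
  next
    case True
    then have "u * u * th u = 1" using e(2) cd by simp
    then have "th (u * th u) = 1" by (simp add: th_mult th_th ac_simps)
    then have "u * th u = 1" by (simp only: th_eq_one)
    then show ?thesis by (rule mult_th_one)
  qed
qed

text \<open>Double transitivity moves two of three fixed points to infinity and the origin. The
  element becomes diagonal, and by \<open>D_fix\<close> a diagonal element with a third fixed point
  is trivial.\<close>

lemma fix_two:
  assumes x: "x \<in> carrier G" "x \<noteq> \<one>" shows "card (fixpts act x) \<le> 2"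
proof (rule ccontr)
  assume "\<not> ?thesis"
  then have "3 \<le> card (fixpts act x)" by simp
  then obtain S where S: "S \<subseteq> fixpts act x" "card S = 3" by (meson obtain_subset_with_card_n)
  then obtain P Q R where PQR: "S = {P, Q, R}" "P \<noteq> Q" "P \<noteq> R" "Q \<noteq> R" by (metis card_3_iff)
  obtain g where g: "g \<in> carrier G" "act g None = P" "act g (Some (0, 0)) = Q" using trans0[OF PQR(2)] by blast
  let ?y = "cj (inv g) x"
  have Fy: "fixpts act ?y = act (inv g) ` fixpts act x" using pa.F_conj g(1) x(1) by simp
  have y: "?y \<in> carrier G" using g x by simp
  have i: "act (inv g) P = None" "act (inv g) Q = Some (0, 0)" using g by (auto intro: pa.act_inv_fix)
  have PQRF: "P \<in> fixpts act x" "Q \<in> fixpts act x" "R \<in> fixpts act x" using S PQR by auto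
  have "?y \<in> stab2 G act None (Some (0, 0))"
    unfolding pa.stab2_iff Fy using y PQRF i by (metis image_eqI)
  then obtain u where u: "u \<noteq> 0" "?y = D u" unfolding stab2_base by blast
  let ?R = "act (inv g) R"
  have "?R \<noteq> None" "?R \<noteq> Some (0, 0)" using i PQR pa.act_inj[of "inv g"] g(1) by (metis inv_closed)+
  then obtain c d where cd: "?R = Some (c, d)" "(c, d) \<noteq> (0, 0)" by (metis option.exhaust surj_pair)
  have "?R \<in> fixpts act ?y" unfolding Fy using PQRF(3) by blast
  then have "act (D u) (Some (c, d)) = Some (c, d)" using u(2) cd(1) pa.F_iff by metis
  then have "u = 1" by (rule D_fix[OF u(1) _ cd(2)])
  then have "?y = \<one>" using u by (simp add: D_one)
  then show False using cj_eq_one[of "inv g" x] g(1) x by simp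
qed

lemma stab2_form:
  assumes "P \<noteq> Q" obtains g where "g \<in> carrier G" "stab2 G act P Q = cj g ` D ` {u. u \<noteq> 0}"
proof -
  obtain g where g: "g \<in> carrier G" "act g None = P" "act g (Some (0, 0)) = Q" using trans0[OF assms] by blast
  show thesis using that[OF g(1)] pa.stab2_cj_image[OF g(1), of None "Some (0, 0)"] g(2,3) stab2_base by simp
qed

text \<open>In base position the element is \<open>W\<close> times a diagonal one, which
  \<open>W\<close> inverts, so its square is trivial. Two fixed points would put it into a diagonal
  group, where no nontrivial element squares to the identity.\<close>

lemma swap_points:
  assumes x: "x \<in> carrier G" and PQ: "P \<noteq> Q" "act x P = Q" "act x Q = P"
  shows "x \<otimes> x = \<one> \<and> card (fixpts act x) = 1"
proof -
  obtain g where g: "g \<in> carrier G" "act g None = P" "act g (Some (0, 0)) = Q" using trans0[OF PQ(1)] by blast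
  define y where "y = cj (inv g) x"
  have yG: "y \<in> carrier G" using g x by (simp add: y_def)
  have xy: "x = cj g y" using g x by (simp add: y_def)
  have i: "act (inv g) P = None" "act (inv g) Q = Some (0, 0)" using g by (auto intro: pa.act_inv_fix)
  have ya: "act y None = Some (0, 0)" "act y (Some (0, 0)) = None"
    using g x PQ i by (simp_all add: y_def cj_def pa.act_mult)
  have "W \<otimes> y \<in> stab2 G act None (Some (0, 0))" using yG ya by (simp add: stab2_def pa.act_mult)
  then obtain u where u: "u \<noteq> 0" "W \<otimes> y = D u" unfolding stab2_base by blast
  have "y = (W \<otimes> W) \<otimes> y" using yG by (simp add: W_W)
  also have "\<dots> = W \<otimes> (W \<otimes> y)" by (rule m_assoc[OF W_in W_in yG])
  finally have yW: "y = W \<otimes> D u" using u(2) by simp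
  have "y \<otimes> y = W \<otimes> (D u \<otimes> (W \<otimes> D u))" using u(1) by (simp add: yW m_assoc)
  also have "\<dots> = W \<otimes> (W \<otimes> (D (1 / u) \<otimes> D u))" using D_W_assoc[OF u(1), of "D u"] u(1) by simp
  also have "\<dots> = W \<otimes> W" using u(1) by (simp add: D_D D_one)
  finally have yy: "y \<otimes> y = \<one>" by (simp add: W_W)
  have xx: "x \<otimes> x = \<one>" unfolding xy using cj_mult[OF g(1) yG yG] yy g(1) by simp
  \<comment> \<open>Two preimages under \<open>th\<close> provide a square root \<open>r\<close> of
    \<open>u\<close>. Since N 1 1 = 1, \<open>W\<close> fixes the point (1, 1), and moving that
    point by \<open>D (1 / r)\<close> gives a fixed point of \<open>y\<close>.\<close>
  obtain s where s: "th s = u" using th_surj by blast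
  obtain r where r: "th r = s" using th_surj by blast
  have rr: "u = r * r" using th_th[of r] r s by simp
  have r0: "r \<noteq> 0" using rr u(1) by auto
  define Z where "Z = act (D (1 / r)) (Some (1, 1))"
  have "act (D u) Z = act (D u \<otimes> D (1 / r)) (Some (1, 1))" using u r0 by (simp only: Z_def pa.act_mult D_in divide_eq_0_iff one_neq_zero simp_thms)
  also have "D u \<otimes> D (1 / r) = D r" using u r0 by (simp add: D_D rr)
  finally have "act y Z = act (W \<otimes> D r) (Some (1, 1))" using u(1) r0 by (simp only: yW pa.act_mult D_in W_in simp_thms)
  also have "W \<otimes> D r = D (1 / r) \<otimes> W" by (rule W_D[OF r0])
  also have "act \<dots> (Some (1, 1)) = act (D (1 / r)) (act W (Some (1, 1)))" using r0 by (intro pa.act_mult) simp_all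
  also have "act W (Some (1, 1)) = Some (1, 1)"
  proof -
    have "N 1 1 = 1" by (simp only: N_def th_one mult_1_right char2 add_0_left)
    then show ?thesis using act_W'[of 1 1] by simp
  qed
  finally have "act y Z = Z" by (simp only: Z_def)
  then have "Z \<in> fixpts act y" by (simp add: pa.F_iff)
  then have ne: "fixpts act x \<noteq> {}" unfolding xy using pa.F_conj[OF g(1) yG] by blast
  have x1: "x \<noteq> \<one>" using PQ by (auto simp: pa.act_one)
  have "card (fixpts act x) \<noteq> 2"
  proof
    assume "card (fixpts act x) = 2"
    then obtain A B where AB: "fixpts act x = {A, B}" "A \<noteq> B" by (meson card_2_iff)
    then have "x \<in> stab2 G act A B" using x by (simp add: pa.stab2_iff)
    moreover obtain k where k: "k \<in> carrier G" "stab2 G act A B = cj k ` D ` {u. u \<noteq> 0}" by (rule stab2_form[OF AB(2)])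
    ultimately obtain v where v: "v \<noteq> 0" "x = cj k (D v)" by blast
    have "cj k (D v \<otimes> D v) = \<one>" using xx v k(1) by (simp add: cj_mult)
    then have "D v \<otimes> D v = \<one>" using cj_eq_one[OF k(1)] v(1) by simp
    then have "D (v * v) = D 1" using v(1) by (simp add: D_D D_one)
    then have "v * v = 1" using v(1) D_eq[of "v * v" 1] by simp
    then have "th (th v) = 1" by (simp only: th_th)
    then have "v = 1" by (simp only: th_eq_one)
    then show False using v x1 k(1) by (simp add: D_one)
  qed
  moreover have "card (fixpts act x) \<noteq> 0" using ne by simp
  ultimately show ?thesis using xx fix_two[OF x x1] by linarith
qed

text \<open>An element T(a,b) D(u) with u different from 1 fixes an affine point besides infinity,
  found by solving two linear equations one after the other; with u = 1 it acts on the affine points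
  by a fixed-point-free shift unless trivial.\<close>

lemma T_form: "uni G act None = (\<lambda>(a, b). T a b) ` UNIV"
proof (rule antisym; rule subsetI)
  fix x assume x: "x \<in> uni G act None"
  show "x \<in> (\<lambda>(a, b). T a b) ` UNIV"
  proof (cases "x = \<one>")
    case True
    then have "x = (\<lambda>(a, b). T a b) (0, 0)" by (simp add: T_zero)
    then show ?thesis by blast
  next
    case False
    then have xG: "x \<in> carrier G" and Fx: "fixpts act x = {None}" using x by (auto simp: uni_def)
    have "act x None = None" using Fx pa.F_iff by blast
    then obtain a b u where u: "u \<noteq> 0" "x = T a b \<otimes> D u" by (rule stab_None[OF xG])
    have "u = 1"
    proof (rule ccontr)
      assume u1: "u \<noteq> 1"
      have t1: "1 + 1 / th u \<noteq> 0" "1 + 1 / (u * u * th u) \<noteq> 0"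
      proof -
        have "th u \<noteq> 1" using u1 by (simp only: th_eq_one not_False_eq_True)
        moreover have "u * u * th u \<noteq> 1"
        proof
          assume "u * u * th u = 1"
          then have "th (u * th u) = 1" by (simp add: th_mult th_th ac_simps)
          then show False using u1 mult_th_one th_eq_one by blast
        qed
        moreover have "1 + 1 / z \<noteq> 0" if "z \<noteq> 1" for z :: 'a
        proof
          assume "1 + 1 / z = 0"
          then have "- 1 = 1 / z" by (rule minus_unique)
          then show False using that minus_eq_self[of 1] by (cases "z = 0") auto
        qed
        ultimately show "1 + 1 / th u \<noteq> 0" "1 + 1 / (u * u * th u) \<noteq> 0" by blast+
      qed
      \<comment> \<open>The solution is e / (1 + f), signs being irrelevant in characteristic
        2.\<close>
      have sol: "\<exists>c. e + c * f = c" if f: "1 + f \<noteq> 0" for e f :: 'a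
      proof
        have "e / (1 + f) * (1 + f) = e" using f by simp
        then have "e / (1 + f) + e / (1 + f) * f = e" by (simp only: distrib_left mult_1_right)
        then show "e + e / (1 + f) * f = e / (1 + f)"
          by (metis add.commute add.left_commute add_self_left)
      qed
      obtain c where c: "a + c * (1 / th u) = c" using sol[OF t1(1)] by blast
      obtain d where d: "(b + th a * (c / th u)) + d * (1 / (u * u * th u)) = d" using sol[OF t1(2)] by blast
      have "act x (Some (c, d)) = Some (a + c / th u, b + d / (u * u * th u) + th a * (c / th u))"
        using u by (simp add: pa.act_mult)
      also have "\<dots> = Some (c, d)" using c d by (simp add: ac_simps)
      finally have "Some (c, d) \<in> fixpts act x" by (simp add: pa.F_iff)
      then show False using Fx by simp
    qed
    then have "x = (\<lambda>(a, b). T a b) (a, b)" using u by (simp add: D_one)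
    then show ?thesis by blast
  qed
next
  fix x assume "x \<in> (\<lambda>(a, b). T a b) ` UNIV"
  then obtain a b where x: "x = T a b" by auto
  show "x \<in> uni G act None"
  proof (cases "a = 0 \<and> b = 0")
    case True then show ?thesis using x T_zero by (simp add: uni_def)
  next
    case False
    have "act x (Some (c, d)) \<noteq> Some (c, d)" for c d
    proof
      assume "act x (Some (c, d)) = Some (c, d)"
      then have "Some (a + c, b + d + th a * c) = Some (c, d)" by (simp only: x act_T)
      then have e: "a + c = c" "b + d + th a * c = d" by (simp_all only: option.inject prod.inject)
      have "a = 0" using e(1) by simp
      moreover from this have "b = 0" using e(2) by simp
      ultimately show False using False by simp
    qed
    then have "fixpts act x = {None}"
      unfolding fixpts_def
    proof -
      assume n: "\<And>c d. act x (Some (c, d)) \<noteq> Some (c, d)"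
      have "act x P = P \<longleftrightarrow> P = None" for P
      proof (cases P)
        case None then show ?thesis by (simp add: x)
      next
        case (Some z)
        then show ?thesis using n[of "fst z" "snd z"] by simp
      qed
      then show "{P. act x P = P} = {None}" by simp
    qed
    then show ?thesis by (simp add: uni_def x)
  qed
qed

lemma uni_form:
  obtains g where "g \<in> carrier G" "uni G act P = cj g ` uni G act None"
proof -
  obtain g where g: "g \<in> carrier G" "act g None = P" using trans1 by blast
  then show thesis using that[OF g(1)] pa.uni_cj_image[OF g(1), of None] by simp
qed

lemma uni_carrier: "uni G act P \<subseteq> carrier G" by (auto simp: uni_def)

lemma T_sq: "T a b \<otimes> T a b = T 0 (a * th a)"
  by (simp add: T_T add_self add_self_left ac_simps)

lemma T_sq_one: "T a b \<otimes> T a b = \<one> \<longleftrightarrow> a = 0"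
  unfolding T_sq T_one by simp

lemma T_comm: "T a b \<otimes> T c d \<otimes> inv (T a b) \<otimes> inv (T c d) = T 0 (th a * c + th c * a)"
  unfolding inv_T T_T T_eq by (simp add: th_add algebra_simps add_self add_self_left)

lemma card_uni: "card (uni G act P) = q\<^sup>2"
proof -
  obtain g where g: "g \<in> carrier G" "uni G act P = cj g ` uni G act None" by (rule uni_form)
  have "card (uni G act P) = card (uni G act None)"
    unfolding g(2) by (rule pa.card_cj_image[OF g(1) uni_carrier])
  also have "\<dots> = card (UNIV :: ('a \<times> 'a) set)"
    unfolding T_form by (rule card_image) (auto simp: inj_on_def T_eq)
  also have "\<dots> = q * q" by (simp only: UNIV_Times_UNIV[symmetric] card_cartesian_product card_a)
  finally show ?thesis by (simp add: power2_eq_square)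
qed

lemma card_uni_invol: "card {x \<in> uni G act P. x \<otimes> x = \<one>} = q"
proof -
  obtain g where g: "g \<in> carrier G" "uni G act P = cj g ` uni G act None" by (rule uni_form)
  have sq: "cj g y \<otimes> cj g y = \<one> \<longleftrightarrow> y \<otimes> y = \<one>" if "y \<in> uni G act None" for y
  proof -
    have "y \<in> carrier G" using that uni_carrier by blast
    then show ?thesis using cj_eq_one[OF g(1), of "y \<otimes> y"] cj_mult[OF g(1), of y y] by simp
  qed
  have "{x \<in> uni G act P. x \<otimes> x = \<one>} = cj g ` {y \<in> uni G act None. y \<otimes> y = \<one>}"
    unfolding g(2) using sq by blast
  also have "card \<dots> = card {y \<in> uni G act None. y \<otimes> y = \<one>}"
    by (rule pa.card_cj_image[OF g(1)]) (use uni_carrier in blast)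
  also have "{y \<in> uni G act None. y \<otimes> y = \<one>} = (\<lambda>b. T 0 b) ` UNIV"
    unfolding T_form by (auto simp: T_sq_one)
  also have "card \<dots> = card (UNIV :: 'a set)" by (rule card_image) (auto simp: inj_on_def T_eq)
  finally show ?thesis by (simp only: card_a)
qed

lemma uni_memE:
  assumes "g \<in> carrier G" "uni G act P = cj g ` uni G act None" "x \<in> uni G act P"
  obtains a b where "x = cj g (T a b)"
proof -
  obtain y where "y \<in> uni G act None" "x = cj g y" using assms by blast
  then show thesis using that unfolding T_form by auto
qed

lemma T_mem: "T a b \<in> uni G act None" unfolding T_form by (rule image_eqI[of _ _ "(a, b)"]) simp_all

lemma uni_mult_closed:
  assumes "x \<in> uni G act P" "y \<in> uni G act P" shows "x \<otimes> y \<in> uni G act P"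
proof -
  obtain g where g: "g \<in> carrier G" "uni G act P = cj g ` uni G act None" by (rule uni_form)
  obtain a b where x: "x = cj g (T a b)" by (rule uni_memE[OF g assms(1)])
  obtain c d where y: "y = cj g (T c d)" by (rule uni_memE[OF g assms(2)])
  have "x \<otimes> y = cj g (T a b \<otimes> T c d)" unfolding x y by (rule cj_mult[OF g(1) T_in T_in, symmetric])
  then show ?thesis unfolding g(2) T_T using T_mem by blast
qed

lemma uni_fourth_power: "x \<in> uni G act P \<Longrightarrow> (x \<otimes> x) \<otimes> (x \<otimes> x) = \<one>"
proof -
  assume x: "x \<in> uni G act P"
  obtain g where g: "g \<in> carrier G" "uni G act P = cj g ` uni G act None" by (rule uni_form)
  obtain a b where x: "x = cj g (T a b)" by (rule uni_memE[OF g x])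
  have "(x \<otimes> x) \<otimes> (x \<otimes> x) = cj g ((T a b \<otimes> T a b) \<otimes> (T a b \<otimes> T a b))"
    unfolding x using g(1) by (simp only: cj_mult T_in m_closed)
  also have "(T a b \<otimes> T a b) \<otimes> (T a b \<otimes> T a b) = \<one>" unfolding T_sq by (simp add: T_zero)
  finally show ?thesis using g(1) by simp
qed

lemma cj_commutator:
  assumes "g \<in> carrier G" "x \<in> carrier G" "y \<in> carrier G"
  shows "cj g x \<otimes> cj g y \<otimes> inv (cj g x) \<otimes> inv (cj g y) = cj g (x \<otimes> y \<otimes> inv x \<otimes> inv y)"
  using assms by (simp add: cj_mult cj_inv)

lemma uni_commutator_square:
  assumes "x \<in> uni G act P" "y \<in> uni G act P" and z: "z = x \<otimes> y \<otimes> inv x \<otimes> inv y" shows "z \<otimes> z = \<one>"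
proof -
  obtain g where g: "g \<in> carrier G" "uni G act P = cj g ` uni G act None" by (rule uni_form)
  obtain a b where x: "x = cj g (T a b)" by (rule uni_memE[OF g assms(1)])
  obtain c d where y: "y = cj g (T c d)" by (rule uni_memE[OF g assms(2)])
  have "z = cj g (T 0 (th a * c + th c * a))"
    unfolding z x y cj_commutator[OF g(1) T_in T_in] T_comm ..
  then have "z \<otimes> z = cj g (T 0 (th a * c + th c * a) \<otimes> T 0 (th a * c + th c * a))"
    using g(1) by (simp only: cj_mult T_in)
  also have "\<dots> = \<one>" unfolding T_sq using g(1) by (simp add: T_zero)
  finally show ?thesis .
qed

lemma involutions_commute:
  assumes "x \<in> uni G act P" "y \<in> uni G act P" "x \<otimes> x = \<one>" "y \<otimes> y = \<one>" shows "x \<otimes> y = y \<otimes> x"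
proof -
  obtain g where g: "g \<in> carrier G" "uni G act P = cj g ` uni G act None" by (rule uni_form)
  have sq: "a = 0" if "cj g (T a b) \<otimes> cj g (T a b) = \<one>" for a b
  proof -
    have "cj g (T a b \<otimes> T a b) = \<one>" using that g(1) by (simp only: cj_mult T_in)
    then have "T a b \<otimes> T a b = \<one>" using cj_eq_one[OF g(1)] by simp
    then show ?thesis by (simp only: T_sq_one)
  qed
  obtain a b where x: "x = cj g (T a b)" by (rule uni_memE[OF g assms(1)])
  obtain c d where y: "y = cj g (T c d)" by (rule uni_memE[OF g assms(2)])
  have "a = 0" "c = 0" using sq assms(3,4) x y by blast+
  then have "T a b \<otimes> T c d = T c d \<otimes> T a b" by (simp add: T_T add.commute)
  then show ?thesis unfolding x y using g(1) by (metis cj_mult T_in)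
qed

lemma borel_form:
  assumes "x \<in> carrier G" "act x None = None" "y \<in> carrier G" "act y None = None"
  shows "x \<otimes> y \<otimes> inv x \<otimes> inv y \<in> uni G act None"
proof -
  obtain a b u where u: "u \<noteq> 0" and x: "x = T a b \<otimes> D u" by (rule stab_None[OF assms(1,2)])
  obtain c d v where v: "v \<noteq> 0" and y: "y = T c d \<otimes> D v" by (rule stab_None[OF assms(3,4)])
  have prod: "\<exists>e f. (T a b \<otimes> D u) \<otimes> (T c d \<otimes> D v) = T e f \<otimes> D (u * v)" if "u \<noteq> 0" "v \<noteq> 0" for a b c d u v
    using that by (simp add: m_assoc D_T_assoc T_T_assoc D_D) blast
  have invf: "\<exists>e f. inv (T a b \<otimes> D u) = T e f \<otimes> D (1 / u)" if "u \<noteq> 0" for a b u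
    using that D_T[of "1 / u"] by (simp add: inv_mult_group inv_T inv_D) blast
  obtain e1 f1 where 1: "x \<otimes> y = T e1 f1 \<otimes> D (u * v)" using prod[OF u v] x y by blast
  obtain e2 f2 where 2: "inv x = T e2 f2 \<otimes> D (1 / u)" using invf[OF u] x by blast
  obtain e3 f3 where 3: "inv y = T e3 f3 \<otimes> D (1 / v)" using invf[OF v] y by blast
  obtain e4 f4 where 4: "x \<otimes> y \<otimes> inv x = T e4 f4 \<otimes> D (u * v * (1 / u))"
    using prod[of "u * v" "1 / u"] u v unfolding 1 2 by (metis divide_eq_0_iff mult_eq_0_iff one_neq_zero)
  obtain e5 f5 where 5: "x \<otimes> y \<otimes> inv x \<otimes> inv y = T e5 f5 \<otimes> D (u * v * (1 / u) * (1 / v))"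
    using prod[of "u * v * (1 / u)" "1 / v"] u v unfolding 4 3 by (metis divide_eq_0_iff mult_eq_0_iff one_neq_zero)
  have "u * v * (1 / u) * (1 / v) = 1" using u v by simp
  then have "x \<otimes> y \<otimes> inv x \<otimes> inv y = T e5 f5" using 5 by (simp add: D_one)
  then show ?thesis using T_mem by simp
qed

lemma borel_commutator:
  assumes "x \<in> carrier G" "y \<in> carrier G" "act x P = P" "act y P = P"
  shows "x \<otimes> y \<otimes> inv x \<otimes> inv y \<in> uni G act P"
proof -
  obtain g where g: "g \<in> carrier G" "act g None = P" using trans1 by blast
  have i: "act (inv g) P = None" using g by (auto intro: pa.act_inv_fix)
  define x' y' where "x' = cj (inv g) x" and "y' = cj (inv g) y"
  have G: "x' \<in> carrier G" "y' \<in> carrier G" using g assms by (simp_all add: x'_def y'_def)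
  have e: "x = cj g x'" "y = cj g y'" using g assms by (simp_all add: x'_def y'_def)
  have "act x' None = None" "act y' None = None"
    using g assms i by (simp_all add: x'_def y'_def cj_def pa.act_mult)
  then have "x' \<otimes> y' \<otimes> inv x' \<otimes> inv y' \<in> uni G act None" using borel_form G by blast
  then show ?thesis unfolding e cj_commutator[OF g(1) G] using pa.uni_cj[OF g(1)] g(2) by metis
qed

text \<open>The additive map r + th r has kernel {0, 1}, so its range has index 2, and 1 lies
  outside it. Hence the range and its translate by 1 cover the field.\<close>

lemma half_subgroup: "\<exists>r. z = r + th r \<or> z + 1 = r + th r"
proof -
  define f where "f r = r + th r" for r
  let ?H = "range f"
  have two: "card {x \<in> UNIV. f x = y} = 2" if y: "y \<in> f ` UNIV" for y
  proof -
    obtain s where s: "y = f s" using y by blast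
    have "f x = f s \<longleftrightarrow> x = s \<or> x = s + 1" for x
    proof
      assume "f x = f s"
      then have "f x + f s = 0" by (simp only: add_self)
      then have "(x + s) + th (x + s) = 0" by (simp add: f_def th_add ac_simps)
      then have "- (x + s) = th (x + s)" by (rule minus_unique)
      then have "th (x + s) = x + s" by (simp only: minus_eq_self)
      then have o: "x + s = 0 \<or> x + s = 1" by (rule th_fixed)
      have "x = s + (x + s)" unfolding add.commute[of x s] add_self_left ..
      then show "x = s \<or> x = s + 1" using o by (metis add_0_right)
    next
      assume "x = s \<or> x = s + 1"
      then show "f x = f s" by (auto simp: f_def th_add th_one ac_simps add_self_left)
    qed
    then have "{x \<in> UNIV. f x = y} = {s, s + 1}" unfolding s by auto
    then show ?thesis by simp
  qed
  have H: "card (UNIV :: 'a set) = 2 * card ?H" by (rule card_eq_fibres[OF finite two])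
  have add: "f r + f s = f (r + s)" for r s by (simp add: f_def th_add ac_simps)
  have one: "1 \<notin> ?H"
  proof
    assume "1 \<in> ?H"
    then obtain r where "1 = r + th r" by (auto simp: f_def)
    then have "th r = r + 1" by (metis add_self_left)
    then show False using th_ne_add_one by blast
  qed
  let ?H1 = "(\<lambda>x. x + 1) ` ?H"
  have disj: "?H \<inter> ?H1 = {}"
  proof (rule ccontr)
    assume "\<not> ?thesis"
    then obtain r s where "f r = f s + 1" by auto
    then have "1 = f s + f r" by (simp add: add_self_left)
    then show False using one add by auto
  qed
  have "card ?H1 = card ?H" by (rule card_image) (simp add: inj_on_def)
  then have "card (?H \<union> ?H1) = card (UNIV :: 'a set)" using H disj by (simp add: card_Un_disjoint)
  then have "?H \<union> ?H1 = UNIV" by (intro card_subset_eq) auto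
  then have "z \<in> ?H \<or> z \<in> ?H1" by blast
  then show ?thesis
  proof
    assume "z \<in> ?H" then show ?thesis by (auto simp: f_def)
  next
    assume "z \<in> ?H1"
    then obtain r where "z = f r + 1" by blast
    then have "z + 1 = r + th r" by (simp only: f_def add.assoc char2 add_0_right)
    then show ?thesis by blast
  qed
qed

lemma T_conj_T: "cj (T s t) (T c b) = T c (b + (th s * c + th c * s))"
  unfolding cj_def inv_T T_T T_eq by (simp add: th_add algebra_simps add_self add_self_left)

lemma T_conj_D: "u \<noteq> 0 \<Longrightarrow> cj (D u) (T a b) = T (a / th u) (b / (u * u * th u))"
  unfolding cj_def D_T inv_D using D_D[of u "1 / u"] by (simp add: m_assoc D_one)

text \<open>Conjugating by T(c r, 0) adds k (r + th r) to the second parameter, where k = c th c,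
  while inversion adds exactly k. The index two in \<open>half_subgroup\<close> is thus absorbed by
  allowing the inverse.\<close>

lemma T_conj_same:
  assumes c: "c \<noteq> 0" shows "\<exists>g\<in>carrier G. cj g (T c b) = T c d \<or> cj g (T c b) = inv (T c d)"
proof -
  define k where "k = c * th c"
  have k0: "k \<noteq> 0" using c by (simp add: k_def)
  have e: "b + (th (c * r) * c + th c * (c * r)) = b + k * (r + th r)" for r
    by (simp add: k_def th_mult algebra_simps)
  obtain r where "(b + d) / k = r + th r \<or> (b + d) / k + 1 = r + th r" using half_subgroup by blast
  then have "b + d = k * (r + th r) \<or> b + d + k = k * (r + th r)"
  proof (elim disjE)
    assume e: "(b + d) / k = r + th r"
    have "k * ((b + d) / k) = b + d" using k0 by simp
    then show ?thesis unfolding e by simp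
  next
    assume e: "(b + d) / k + 1 = r + th r"
    have "k * ((b + d) / k + 1) = k * ((b + d) / k) + k" by (simp only: distrib_left mult_1_right)
    also have "k * ((b + d) / k) = b + d" using k0 by simp
    finally show ?thesis unfolding e by simp
  qed
  then have "b + k * (r + th r) = d \<or> b + k * (r + th r) = d + k"
  proof
    assume e: "b + d = k * (r + th r)"
    show ?thesis unfolding e[symmetric] add_self_left by (rule disjI1[OF refl])
  next
    assume e: "b + d + k = k * (r + th r)"
    show ?thesis unfolding e[symmetric] add.assoc[of b d k] add_self_left by (rule disjI2[OF refl])
  qed
  then have "cj (T (c * r) 0) (T c b) = T c d \<or> cj (T (c * r) 0) (T c b) = inv (T c d)"
    unfolding T_conj_T e inv_T T_eq by (auto simp: k_def)
  then show ?thesis using T_in by blast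
qed

lemma uni_order4_conj:
  assumes "x \<in> uni G act P" "y \<in> uni G act P" "x \<otimes> x \<noteq> \<one>" "y \<otimes> y \<noteq> \<one>"
  shows "\<exists>g\<in>carrier G. g \<otimes> x \<otimes> inv g = y \<or> g \<otimes> x \<otimes> inv g = inv y"
proof -
  obtain g where g: "g \<in> carrier G" "uni G act P = cj g ` uni G act None" by (rule uni_form)
  have sq: "a \<noteq> 0" if "cj g (T a b) \<otimes> cj g (T a b) \<noteq> \<one>" for a b
  proof
    assume "a = 0"
    then have "T a b \<otimes> T a b = \<one>" by (simp only: T_sq_one)
    then have "cj g (T a b) \<otimes> cj g (T a b) = cj g \<one>" using g(1) by (simp only: cj_mult[symmetric] T_in)
    then show False using that g(1) by simp
  qed
  obtain a b where x: "x = cj g (T a b)" by (rule uni_memE[OF g assms(1)])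
  obtain c d where y: "y = cj g (T c d)" by (rule uni_memE[OF g assms(2)])
  have ac: "a \<noteq> 0" "c \<noteq> 0" using sq assms(3,4) x y by blast+
  \<comment> \<open>Diagonal conjugation divides the first parameter by \<open>th u\<close>; this
    choice makes it \<open>c\<close>, leaving only second parameters to be matched.\<close>
  obtain u where u: "th u = a / c" using th_surj by blast
  have u0: "u \<noteq> 0" using u ac th_zero_iff[of u] by auto
  have e: "cj (D u) (T a b) = T c (b / (u * u * th u))" unfolding T_conj_D[OF u0] u T_eq using ac by simp
  obtain k where k: "k \<in> carrier G"
    "cj k (T c (b / (u * u * th u))) = T c d \<or> cj k (T c (b / (u * u * th u))) = inv (T c d)"
    using T_conj_same[OF ac(2)] by blast
  have h: "cj (k \<otimes> D u) (T a b) = T c d \<or> cj (k \<otimes> D u) (T a b) = inv (T c d)"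
    using k(2) unfolding e[symmetric] cj_comp[OF k(1) D_in[OF u0] T_in] .
  let ?h = "k \<otimes> D u" let ?w = "g \<otimes> ?h \<otimes> inv g"
  have hG: "?h \<in> carrier G" using k(1) u0 by simp
  have xG: "x \<in> carrier G" using g(1) by (simp add: x)
  have "cj ?w x = cj (g \<otimes> ?h) (cj (inv g) x)"
    by (rule cj_comp[symmetric]) (simp_all only: g(1) hG xG m_closed inv_closed)
  also have "\<dots> = cj g (cj ?h (cj (inv g) x))"
    by (rule cj_comp[symmetric]) (simp_all only: g(1) hG xG cj_closed inv_closed)
  also have "cj (inv g) x = T a b" using g(1) by (simp add: x)
  finally have "cj ?w x = cj g (T c d) \<or> cj ?w x = cj g (inv (T c d))" using h by auto
  moreover have "cj g (inv (T c d)) = inv (cj g (T c d))" by (rule cj_inv[OF g(1) T_in])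
  ultimately have "cj ?w x = y \<or> cj ?w x = inv y" unfolding y by simp
  moreover have "?w \<in> carrier G" using g(1) hG by simp
  ultimately show ?thesis unfolding cj_def by blast
qed

lemma card_stab2: "P \<noteq> Q \<Longrightarrow> card (stab2 G act P Q) = q - 1"
proof -
  assume "P \<noteq> Q"
  then obtain g where g: "g \<in> carrier G" "stab2 G act P Q = cj g ` D ` {u. u \<noteq> 0}" by (rule stab2_form)
  have "card (stab2 G act P Q) = card (D ` {u. u \<noteq> 0})"
    unfolding g(2) by (rule pa.card_cj_image[OF g(1)]) auto
  also have "\<dots> = card {u :: 'a. u \<noteq> 0}" by (rule card_image) (auto simp: inj_on_def D_eq)
  also have "{u :: 'a. u \<noteq> 0} = UNIV - {0}" by auto
  also have "card \<dots> = q - 1" using card_a by (simp add: card_Diff_singleton)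
  finally show ?thesis .
qed

lemma stab2_commute:
  assumes "P \<noteq> Q" "x \<in> stab2 G act P Q" "y \<in> stab2 G act P Q" shows "x \<otimes> y = y \<otimes> x"
proof -
  obtain g where g: "g \<in> carrier G" "stab2 G act P Q = cj g ` D ` {u. u \<noteq> 0}" by (rule stab2_form[OF assms(1)])
  obtain u v where uv: "u \<noteq> 0" "v \<noteq> 0" "x = cj g (D u)" "y = cj g (D v)" using assms(2,3) unfolding g(2) by blast
  have "D u \<otimes> D v = D v \<otimes> D u" using uv by (simp add: D_D mult.commute)
  then show ?thesis unfolding uv(3,4) using g(1) uv(1,2) by (metis cj_mult D_in)
qed

lemma lin_pow: "x \<in> carrier G \<Longrightarrow> lin (x [^] (n::nat)) v = (lin x ^^ n) v"
proof (induction n arbitrary: v)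
  case 0 then show ?case by (simp add: lin_one)
next
  case (Suc n) then show ?case by (simp add: lin_mult funpow_swap1)
qed

section \<open>The matrix group\<close>

lemma card_vec4: "card (UNIV :: ('a \<times> 'a \<times> 'a \<times> 'a) set) = q ^ 4"
proof -
  have "card (UNIV :: ('a \<times> 'a \<times> 'a \<times> 'a) set) = q * (q * (q * q))"
    by (simp only: UNIV_Times_UNIV[symmetric] card_cartesian_product card_a)
  then show ?thesis by (simp add: power4_eq_xxxx)
qed

lemma lin_cyclic_operator:
  assumes x: "x \<in> carrier G" "x \<noteq> \<one>" "x [^] (q\<^sup>2 + 1) = \<one>"
  shows "finite_cyclic_operator sc (lin x) q p"
proof unfold_locales
  show "sc a (v + w) = sc a v + sc a w" for a v w
    by (cases v; cases w) (simp add: sc_def distrib_left)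
  show "sc (a + b) v = sc a v + sc b v" for a b v
    by (cases v) (simp add: sc_def distrib_right)
  show "sc a (sc b v) = sc (a * b) v" for a b v by (rule sc_sc)
  show "sc 1 v = v" for v by (rule sc_one)
  show "lin x (v + w) = lin x v + lin x w" for v w by (rule lin_add[OF x(1)])
  show "lin x (sc c v) = sc c (lin x v)" for c v by (rule lin_sc[OF x(1)])
  show "q = 2 ^ p" "card (UNIV :: 'a set) = q" by (rule q, rule card_a)
  show "0 < p" using p(2) by simp
  show "(1::'a) + 1 = 0" by (rule char2)
  show "card (UNIV :: ('a \<times> 'a \<times> 'a \<times> 'a) set) = q ^ 4" by (rule card_vec4)
  show "(lin x ^^ (q\<^sup>2 + 1)) v = v" for v
    unfolding lin_pow[OF x(1), symmetric] x(3) by (rule lin_one)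
  show "\<exists>v. lin x v \<noteq> v"
  proof (rule ccontr)
    assume "\<not> ?thesis"
    then have "lin x v = v" for v by blast
    then have "lin x v = lin \<one> v" for v unfolding lin_one .
    then have "x = \<one>" by (rule lin_inj[OF x(1) one_closed])
    then show False using x(2) by blast
  qed
qed

lemma lin_cent: "x \<in> carrier G \<Longrightarrow> y \<in> cent G x \<Longrightarrow> lin y (lin x v) = lin x (lin y v)"
  by (auto simp: cent_def simp flip: lin_mult)

lemma centralizer_comm:
  assumes x: "x \<in> carrier G" "x \<noteq> \<one>" "x [^] (q\<^sup>2 + 1) = \<one>" and y: "y \<in> cent G x" and z: "z \<in> cent G x"
  shows "y \<otimes> z = z \<otimes> y"
proof -
  interpret L: finite_cyclic_operator sc "lin x" q p by (rule lin_cyclic_operator[OF x])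
  have G: "y \<in> carrier G" "z \<in> carrier G" using y z by (auto simp: cent_def)
  have "lin y (lin z v) = lin z (lin y v)" for v
    by (rule L.centralizer_commutative) (rule lin_add lin_sc G lin_cent[OF x(1)] y z)+
  then show ?thesis using G by (intro lin_inj) (simp_all add: lin_mult)
qed

text \<open>By \<open>conjugates_in_centralizer\<close> and faithfulness, a conjugate of
  \<open>x\<close> commuting with \<open>x\<close> is one of the powers with exponent q^i, i <
  4.\<close>

lemma conjugates_le4:
  assumes x: "x \<in> carrier G" "x \<noteq> \<one>" "x [^] (q\<^sup>2 + 1) = \<one>"
  shows "card ({g \<otimes> x \<otimes> inv g | g. g \<in> carrier G} \<inter> cent G x) \<le> 4"
proof -
  interpret L: finite_cyclic_operator sc "lin x" q p by (rule lin_cyclic_operator[OF x])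
  have "{g \<otimes> x \<otimes> inv g | g. g \<in> carrier G} \<inter> cent G x \<subseteq> (\<lambda>i. x [^] (q ^ i)) ` {..<4::nat}"
  proof
    fix y assume "y \<in> {g \<otimes> x \<otimes> inv g | g. g \<in> carrier G} \<inter> cent G x"
    then obtain g where g: "g \<in> carrier G" "y = g \<otimes> x \<otimes> inv g" and c: "y \<in> cent G x" by blast
    have yG: "y \<in> carrier G" using c by (simp add: cent_def)
    have "\<exists>i<4. \<forall>v. lin y v = (lin x ^^ (q ^ i)) v"
    proof (rule L.conjugates_in_centralizer[of "lin g" "lin (inv g)" "lin y"])
      show "lin g (lin (inv g) v) = v" for v using g(1) by (simp add: lin_one flip: lin_mult)
      show "lin (inv g) (lin g v) = v" for v using g(1) by (simp add: lin_one flip: lin_mult)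
      show "lin y v = lin g (lin x (lin (inv g) v))" for v using g x(1) by (simp add: lin_mult)
      show "lin y (lin x v) = lin x (lin y v)" for v by (rule lin_cent[OF x(1) c])
    qed (rule lin_add lin_sc g(1) inv_closed)+
    then obtain i where i: "i < 4" "\<forall>v. lin y v = (lin x ^^ (q ^ i)) v" by blast
    have "lin y v = lin (x [^] (q ^ i)) v" for v
      unfolding lin_pow[OF x(1)] by (rule spec[OF i(2)])
    then have "y = x [^] (q ^ i)" by (rule lin_inj[OF yG nat_pow_closed[OF x(1)]])
    then show "y \<in> (\<lambda>i. x [^] (q ^ i)) ` {..<4::nat}" using i(1) by blast
  qed
  then have "card ({g \<otimes> x \<otimes> inv g | g. g \<in> carrier G} \<inter> cent G x) \<le> card ((\<lambda>i. x [^] (q ^ i)) ` {..<4::nat})"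
    by (intro card_mono) auto
  also have "\<dots> \<le> 4" using card_image_le[of "{..<4::nat}" "\<lambda>i. x [^] (q ^ i)"] by simp
  finally show ?thesis .
qed

sublocale suzuki_action G act q
proof
  show "finite (carrier G)" by (rule finite_carrier)
  show "even q" "8 \<le> q" "q mod 3 = 2" by (rule q_gt)+
  show "card (UNIV :: ('a \<times> 'a) option set) = q\<^sup>2 + 1" by (rule card_pts)
  show "card (uni G act P) = q\<^sup>2" for P by (rule card_uni)
  show "card {x \<in> uni G act P. x \<otimes> x = \<one>} = q" for P by (rule card_uni_invol)
qed (fact transitive2 fix_two swap_points card_stab2 stab2_commute uni_mult_closed uni_fourth_power borel_commutator uni_commutator_square
    involutions_commute uni_order4_conj centralizer_comm conjugates_le4)+

end

section \<open>Four by four matrices as maps on quadruples\<close>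

lemma mat4_mult:
  fixes A B :: "'a::field mat"
  assumes "A \<in> carrier_mat 4 4" "B \<in> carrier_mat 4 4" "i < 4" "j < 4"
  shows "(A * B) $$ (i, j) = A $$ (i, 0) * B $$ (0, j) + A $$ (i, 1) * B $$ (1, j)
    + A $$ (i, 2) * B $$ (2, j) + A $$ (i, 3) * B $$ (3, j)"
proof -
  have "{0..<4::nat} = {0, 1, 2, 3}" by auto
  then show ?thesis using assms by (simp add: scalar_prod_def)
qed

lemma less4: "(i::nat) < 4 \<longleftrightarrow> i = 0 \<or> i = 1 \<or> i = 2 \<or> i = 3" by auto

definition mlin :: "'a::field mat \<Rightarrow> 'a \<times> 'a \<times> 'a \<times> 'a \<Rightarrow> 'a \<times> 'a \<times> 'a \<times> 'a" where
  "mlin A = (\<lambda>(x, y, z, w). let r = (\<lambda>i. A $$ (i, 0) * x + A $$ (i, 1) * y + A $$ (i, 2) * z + A $$ (i, 3) * w)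
     in (r 0, r 1, r 2, r 3))"

lemma mlin_mult:
  "A \<in> carrier_mat 4 4 \<Longrightarrow> B \<in> carrier_mat 4 4 \<Longrightarrow> mlin (A * B) v = mlin A (mlin B v)"
proof -
  assume A: "A \<in> carrier_mat 4 4" and B: "B \<in> carrier_mat 4 4"
  show ?thesis
    by (cases v) (simp add: mlin_def mat4_mult[OF A B] algebra_simps del: index_mult_mat)
qed

lemma mlin_one: "mlin (1\<^sub>m 4) v = (v :: 'a::field \<times> 'a \<times> 'a \<times> 'a)"
  by (cases v) (simp add: mlin_def)

lemma mlin_inj:
  fixes A B :: "'a::field mat"
  assumes "A \<in> carrier_mat 4 4" "B \<in> carrier_mat 4 4" "\<And>v. mlin A v = mlin B v" shows "A = B"
proof (rule eq_matI)
  fix i j assume "i < dim_row B" "j < dim_col B"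
  then have ij: "i < 4" "j < 4" using assms by auto
  show "A $$ (i, j) = B $$ (i, j)"
    using ij assms(3)[of "(1, 0, 0, 0)"] assms(3)[of "(0, 1, 0, 0)"] assms(3)[of "(0, 0, 1, 0)"] assms(3)[of "(0, 0, 0, 1)"]
    unfolding less4 by (auto simp: mlin_def)
qed (use assms in auto)

lemma GL4_carrier:
  fixes A :: "'a::field mat"
  shows "A \<in> carrier GL4 \<longleftrightarrow> A \<in> carrier_mat 4 4 \<and> (\<exists>B\<in>carrier_mat 4 4. A * B = 1\<^sub>m 4 \<and> B * A = 1\<^sub>m 4)"
proof
  assume "A \<in> carrier GL4"
  then have A: "A \<in> carrier_mat 4 4" "invertible_mat A" by (auto simp: GL4_def)
  then obtain B where B: "A * B = 1\<^sub>m (dim_row A)" "B * A = 1\<^sub>m (dim_row B)"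
    by (auto simp: invertible_mat_def inverts_mat_def)
  have "dim_col (A * B) = 4" "dim_col (B * A) = dim_row B" using B A by auto
  then have "B \<in> carrier_mat 4 4" using A by auto
  then show "A \<in> carrier_mat 4 4 \<and> (\<exists>B\<in>carrier_mat 4 4. A * B = 1\<^sub>m 4 \<and> B * A = 1\<^sub>m 4)"
    using A B by auto
next
  assume "A \<in> carrier_mat 4 4 \<and> (\<exists>B\<in>carrier_mat 4 4. A * B = 1\<^sub>m 4 \<and> B * A = 1\<^sub>m 4)"
  then show "A \<in> carrier GL4" by (auto simp: GL4_def invertible_mat_def inverts_mat_def)
qed

lemma GL4_simps [simp]: "mult GL4 = (*)" "one GL4 = 1\<^sub>m 4"
  by (simp_all add: GL4_def)

lemma mat4_inverse_mult:
  fixes A B :: "'a::field mat"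
  assumes c: "A \<in> carrier_mat 4 4" "B \<in> carrier_mat 4 4" "A' \<in> carrier_mat 4 4" "B' \<in> carrier_mat 4 4"
    and e: "A * A' = 1\<^sub>m 4" "B * B' = 1\<^sub>m 4"
  shows "(A * B) * (B' * A') = 1\<^sub>m 4"
proof -
  have "(A * B) * (B' * A') = A * (B * (B' * A'))" by (rule assoc_mult_mat[OF c(1,2) mult_carrier_mat[OF c(4,3)]])
  also have "B * (B' * A') = (B * B') * A'" by (rule assoc_mult_mat[OF c(2,4,3), symmetric])
  also have "\<dots> = A'" unfolding e(2) by (rule left_mult_one_mat[OF c(3)])
  finally show ?thesis by (simp only: e(1))
qed

lemma GL4_group: "group (GL4 :: ('a::field) mat monoid)"
proof (rule groupI)
  fix A B :: "'a mat" assume "A \<in> carrier GL4" "B \<in> carrier GL4"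
  then obtain A' B' where A: "A \<in> carrier_mat 4 4" "A' \<in> carrier_mat 4 4" "A * A' = 1\<^sub>m 4" "A' * A = 1\<^sub>m 4"
    and B: "B \<in> carrier_mat 4 4" "B' \<in> carrier_mat 4 4" "B * B' = 1\<^sub>m 4" "B' * B = 1\<^sub>m 4"
    unfolding GL4_carrier by blast
  have 1: "(A * B) * (B' * A') = 1\<^sub>m 4" by (rule mat4_inverse_mult[OF A(1) B(1) A(2) B(2) A(3) B(3)])
  have 2: "(B' * A') * (A * B) = 1\<^sub>m 4" by (rule mat4_inverse_mult[OF B(2) A(2) B(1) A(1) B(4) A(4)])
  show "A \<otimes>\<^bsub>GL4\<^esub> B \<in> carrier GL4" unfolding GL4_carrier GL4_simps
    using A B 1 2 by (intro conjI bexI[of _ "B' * A'"]) auto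
next
  show "\<one>\<^bsub>GL4\<^esub> \<in> carrier (GL4 :: 'a mat monoid)" unfolding GL4_carrier GL4_simps
    by (intro conjI bexI[of _ "1\<^sub>m 4"]) auto
next
  fix A B C :: "'a mat" assume "A \<in> carrier GL4" "B \<in> carrier GL4" "C \<in> carrier GL4"
  then have "A \<in> carrier_mat 4 4" "B \<in> carrier_mat 4 4" "C \<in> carrier_mat 4 4" unfolding GL4_carrier by auto
  then show "A \<otimes>\<^bsub>GL4\<^esub> B \<otimes>\<^bsub>GL4\<^esub> C = A \<otimes>\<^bsub>GL4\<^esub> (B \<otimes>\<^bsub>GL4\<^esub> C)"
    unfolding GL4_simps by (rule assoc_mult_mat)
next
  fix A :: "'a mat" assume "A \<in> carrier GL4"
  then have "A \<in> carrier_mat 4 4 \<and> (\<exists>B\<in>carrier_mat 4 4. A * B = 1\<^sub>m 4 \<and> B * A = 1\<^sub>m 4)"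
    by (simp only: GL4_carrier)
  then obtain B where B: "A \<in> carrier_mat 4 4" "B \<in> carrier_mat 4 4" "A * B = 1\<^sub>m 4" "B * A = 1\<^sub>m 4"
    by (elim conjE bexE) (rule that)
  show "\<one>\<^bsub>GL4\<^esub> \<otimes>\<^bsub>GL4\<^esub> A = A" unfolding GL4_simps by (rule left_mult_one_mat[OF B(1)])
  have "B \<in> carrier GL4" unfolding GL4_carrier by (intro conjI bexI[of _ A] B)
  then show "\<exists>B\<in>carrier GL4. B \<otimes>\<^bsub>GL4\<^esub> A = \<one>\<^bsub>GL4\<^esub>"
    by (rule bexI[rotated]) (simp only: GL4_simps B(4))
qed

section \<open>The defining generators and the field automorphism\<close>

lemma sz_carrier:
  fixes a b l :: "'a::field"
  shows "sz_T p a b \<in> carrier_mat 4 4" "sz_M p l \<in> carrier_mat 4 4" "(sz_W :: 'a mat) \<in> carrier_mat 4 4"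
proof -
  have *: "mat_of_rows_list 4 [a, b, c, d] \<in> carrier_mat 4 4" for a b c d :: "'a list"
    by (rule carrier_matI) (simp_all add: mat_of_rows_list_def)
  show "sz_T p a b \<in> carrier_mat 4 4" "sz_M p l \<in> carrier_mat 4 4" "(sz_W :: 'a mat) \<in> carrier_mat 4 4"
    unfolding sz_T_def sz_M_def sz_W_def Let_def by (rule *)+
qed

lemma sz_theta_field:
  assumes card: "card (UNIV :: 'a set) = 2 ^ p" and p: "odd p"
  shows "suzuki_field (sz_theta p :: 'a::{field,finite} \<Rightarrow> 'a)"
proof
  have frob: "c ^ (2 ^ p) = c" for c :: 'a using finite_field_power_card[of c] card by simp
  have "p > 0" using p by (rule odd_pos)
  then have "even ((2::nat) ^ p)" by simp
  \<comment> \<open>Characteristic 2 is read off from the size of the field: the power 2^p fixes -1,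
    yet an even power of -1 is 1.\<close>
  then have "(- 1 :: 'a) ^ (2 ^ p) = 1" by simp
  then have "(- 1 :: 'a) = 1" by (simp only: frob)
  then show two: "(1::'a) + 1 = 0" by (metis add.right_inverse)
  show "sz_theta p (x + y) = sz_theta p x + sz_theta p y" for x y :: 'a
    unfolding sz_theta_def by (rule char2_pow_add[OF two])
  show "sz_theta p (x * y) = sz_theta p x * sz_theta p y" for x y :: 'a
    unfolding sz_theta_def by (rule power_mult_distrib)
  show "sz_theta p 1 = (1::'a)" unfolding sz_theta_def by simp
  show "sz_theta p (sz_theta p x) = x * x" for x :: 'a
  proof -
    have "(p + 1) div 2 + (p + 1) div 2 = p + 1" using p by (metis even_plus_one_iff even_two_times_div_two mult_2)
    then have "sz_theta p (sz_theta p x) = x ^ (2 ^ (p + 1))"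
      unfolding sz_theta_def by (simp only: power_mult[symmetric] power_add[symmetric])
    also have "\<dots> = (x ^ (2 ^ p)) ^ 2" by (simp add: power_mult[symmetric] mult.commute)
    finally show ?thesis by (simp add: frob power2_eq_square)
  qed
qed

text \<open>The exponents add up because (p + 1)/2 + (p - 1)/2 = p for odd \<open>p\<close>. So the
  power used in \<open>sz_M\<close> undoes \<open>sz_theta\<close>, which motivates the parameter of
  \<open>tD\<close>.\<close>

lemma theta_root:
  assumes card: "card (UNIV :: 'a set) = 2 ^ p" and p: "odd p"
  shows "sz_theta p u ^ (2 ^ ((p - 1) div 2)) = (u :: 'a::{field,finite})"
proof -
  have "(p + 1) div 2 + (p - 1) div 2 = p" using p by (elim oddE) simp
  then have "sz_theta p u ^ (2 ^ ((p - 1) div 2)) = u ^ (2 ^ p)"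
    unfolding sz_theta_def by (simp only: power_mult[symmetric] power_add[symmetric])
  then show ?thesis using finite_field_power_card[of u] card by simp
qed

lemma Sz_model:
  assumes card: "card (UNIV :: 'a set) = 2 ^ p" and p: "odd p" "3 \<le> p"
  shows "suzuki_model (sz_theta p) (Sz p :: ('a::{field,finite}) mat monoid) mlin (sz_T p)
    (\<lambda>u. sz_M p (sz_theta p u)) sz_W p (2 ^ p)"
proof -
  interpret th: suzuki_field "sz_theta p :: 'a \<Rightarrow> 'a" by (rule sz_theta_field[OF card p(1)])
  interpret GL: group "GL4 :: 'a mat monoid" by (rule GL4_group)
  let ?G = "Sz p :: 'a mat monoid"
  let ?D = "\<lambda>u :: 'a. sz_M p (sz_theta p u)"
  have lT: "mlin (sz_T p a b) v = th.tT a b v" for a b :: 'a and v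
    by (cases v) (simp add: mlin_def sz_T_def mat_of_rows_list_def th.tT_def th.N_def power2_eq_square)
  have lD: "mlin (?D u) v = th.tD u v" if u: "u \<noteq> 0" for u v
  proof -
    have root: "sz_theta p u ^ (2 ^ ((p - 1) div 2)) = u" by (rule theta_root[OF card p(1)])
    have "inverse (sz_theta p u) ^ (2 ^ ((p - 1) div 2)) = inverse u"
      unfolding power_inverse root ..
    then have "?D u = mat_of_rows_list 4 [[sz_theta p u * u, 0, 0, 0], [0, u, 0, 0], [0, 0, inverse u, 0],
        [0, 0, 0, inverse (sz_theta p u) * inverse u]]"
      unfolding sz_M_def Let_def power_add power_one_right root by (simp only:)
    then show ?thesis
      by (cases v) (simp add: mlin_def mat_of_rows_list_def th.tD_def divide_inverse ac_simps)
  qed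
  have lW: "mlin sz_W v = th.tW v" for v :: "'a \<times> 'a \<times> 'a \<times> 'a"
    by (cases v) (simp add: mlin_def sz_W_def mat_of_rows_list_def th.tW_def)
  have TG: "sz_T p a b \<in> carrier GL4" for a b :: 'a
  proof -
    let ?b = "b + a * sz_theta p a"
    note inj = mlin_inj[OF mult_carrier_mat[OF sz_carrier(1) sz_carrier(1)] one_carrier_mat]
    have "sz_T p a b * sz_T p a ?b = 1\<^sub>m 4"
      by (rule inj) (simp add: sz_carrier mlin_mult mlin_one lT th.tT_tT th.add_self th.add_self_left ac_simps th.tT_zero)
    moreover have "sz_T p a ?b * sz_T p a b = 1\<^sub>m 4"
      by (rule inj) (simp add: sz_carrier mlin_mult mlin_one lT th.tT_tT th.add_self th.add_self_left ac_simps th.tT_zero)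
    ultimately show ?thesis unfolding GL4_carrier using sz_carrier(1) by blast
  qed
  have DG: "?D u \<in> carrier GL4" if u: "u \<noteq> 0" for u
  proof -
    note inj = mlin_inj[OF mult_carrier_mat[OF sz_carrier(2) sz_carrier(2)] one_carrier_mat]
    have "?D u * ?D (1 / u) = 1\<^sub>m 4"
      by (rule inj) (use u in \<open>simp add: sz_carrier mlin_mult mlin_one lD th.tD_tD th.tD_one\<close>)
    moreover have "?D (1 / u) * ?D u = 1\<^sub>m 4"
      by (rule inj) (use u in \<open>simp add: sz_carrier mlin_mult mlin_one lD th.tD_tD th.tD_one\<close>)
    ultimately show ?thesis unfolding GL4_carrier using sz_carrier(2) by blast
  qed
  have WG: "sz_W \<in> carrier (GL4 :: 'a mat monoid)"
  proof -
    have "sz_W * sz_W = (1\<^sub>m 4 :: 'a mat)"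
      by (rule mlin_inj[OF mult_carrier_mat[OF sz_carrier(3) sz_carrier(3)] one_carrier_mat])
        (simp add: sz_carrier mlin_mult mlin_one lW th.tW_tW)
    then show ?thesis unfolding GL4_carrier using sz_carrier(3) by blast
  qed
  have gens: "Sz_gens p = {sz_T p a b | a b. True} \<union> {?D u | u. u \<noteq> 0} \<union> {sz_W :: 'a mat}"
  proof -
    \<comment> \<open>Surjectivity of \<open>sz_theta\<close> on nonzero elements makes the
      reparametrized diagonal matrices exhaust all of them.\<close>
    have "{sz_M p l | l :: 'a. l \<noteq> 0} = {?D u | u. u \<noteq> 0}"
    proof (rule antisym; rule subsetI)
      fix A assume "A \<in> {sz_M p l | l :: 'a. l \<noteq> 0}"
      then obtain l where l: "l \<noteq> 0" "A = sz_M p l" by blast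
      obtain u where u: "sz_theta p u = l" using th.th_surj by blast
      have "u \<noteq> 0" using l(1) u by auto
      then show "A \<in> {?D u | u. u \<noteq> 0}" using l(2) u by blast
    next
      fix A assume "A \<in> {?D u | u. u \<noteq> 0}"
      then obtain u where "u \<noteq> 0" "A = ?D u" by blast
      then show "A \<in> {sz_M p l | l :: 'a. l \<noteq> 0}" using th.th_zero_iff by blast
    qed
    then show ?thesis unfolding Sz_gens_def by simp
  qed
  have sub: "Sz_gens p \<subseteq> carrier (GL4 :: 'a mat monoid)" unfolding gens using TG DG WG by blast
  have sg: "subgroup (generate GL4 (Sz_gens p)) (GL4 :: 'a mat monoid)" by (rule GL.generate_is_subgroup[OF sub])
  have carr: "carrier ?G = generate GL4 (Sz_gens p)" by (simp add: Sz_def)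
  have c4: "A \<in> carrier_mat 4 4" if "A \<in> carrier ?G" for A
    using that subgroup.subset[OF sg] GL4_carrier unfolding carr by blast
  have ops: "mult ?G = (*)" "one ?G = 1\<^sub>m 4" by (simp_all add: Sz_def)
  have genin: "A \<in> carrier ?G" if "A \<in> Sz_gens p" for A unfolding carr using that by (rule generate.incl)
  interpret S: group ?G using GL.subgroup_imp_group[OF sg] by (simp add: Sz_def)
  show ?thesis
  proof unfold_locales
    show "mlin (x \<otimes>\<^bsub>?G\<^esub> y) v = mlin x (mlin y v)" if "x \<in> carrier ?G" "y \<in> carrier ?G" for x y v
      unfolding ops using mlin_mult[OF c4[OF that(1)] c4[OF that(2)]] .
    show "mlin \<one>\<^bsub>?G\<^esub> v = v" for v unfolding ops by (rule mlin_one)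
    show "x = y" if "x \<in> carrier ?G" "y \<in> carrier ?G" "\<And>v. mlin x v = mlin y v" for x y
      by (rule mlin_inj[OF c4[OF that(1)] c4[OF that(2)] that(3)])
    show "mlin x (v + w) = mlin x v + mlin x w" for x :: "'a mat" and v w
      by (cases v; cases w) (simp add: mlin_def algebra_simps)
    show "mlin x (case v of (x0, x1, x2, x3) \<Rightarrow> (c * x0, c * x1, c * x2, c * x3))
        = (case mlin x v of (x0, x1, x2, x3) \<Rightarrow> (c * x0, c * x1, c * x2, c * x3))" for x :: "'a mat" and v c
      by (cases v) (simp add: mlin_def algebra_simps)
    show "sz_T p a b \<in> carrier ?G" for a b by (rule genin) (auto simp: gens)
    show "?D u \<in> carrier ?G" if "u \<noteq> 0" for u by (rule genin) (use that in \<open>auto simp: gens\<close>)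
    show "sz_W \<in> carrier ?G" by (rule genin) (simp add: gens)
    show "mlin (sz_T p a b) v = th.tT a b v" for a b v by (rule lT)
    show "mlin (?D u) v = th.tD u v" if "u \<noteq> 0" for u v by (rule lD[OF that])
    show "mlin sz_W v = th.tW v" for v by (rule lW)
    \<comment> \<open>Generation inside the subgroup agrees with generation in the general linear
      group, so \<open>Sz p\<close> is generated by the same matrices when viewed as a group of its
      own.\<close>
    have "generate ?G (Sz_gens p) = generate GL4 (Sz_gens p)"
      unfolding Sz_def by (rule GL.generate_consistent[OF _ sg]) (auto intro: generate.incl)
    then show "carrier ?G = generate ?G ({sz_T p a b | a b. True} \<union> {?D u | u. u \<noteq> 0} \<union> {sz_W})"
      unfolding gens carr by simp
  qed (use p card in auto)
qed

theorem theorem3p9: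
  fixes p :: nat
  assumes "prime p" and "odd p"
    and "card (UNIV :: 'a set) = 2 ^ p"
  shows "real (card (Solv (Sz p :: ('a::{field,finite}) mat monoid)))
           = (3 * (2 ^ p) ^ 4 + (2 ^ p) ^ 3 - (2 ^ p) ^ 2 + 2 ^ p) / 2"
proof -
  have "p \<noteq> 1" "p \<noteq> 2" using assms(1,2) by auto
  then have "3 \<le> p" using odd_pos[OF assms(2)] by linarith
  then interpret suzuki_model "sz_theta p" "Sz p :: 'a mat monoid" mlin "sz_T p"
    "\<lambda>u. sz_M p (sz_theta p u)" sz_W p "2 ^ p"
    by (rule Sz_model[OF assms(3,2)])
  show ?thesis using card_Solv by simp
qed

end
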